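(* The Connected Feedback Vertex Set problem is NP-complete when restricted to line graphs.
   Context: All graphs are finite and simple. A feedback vertex set of a graph $G$ is a set $S\subseteq V(G)$ such that $G-S$ is a forest; it is connected if the induced subgraph $G[S]$ is connected. The Connected Feedback Vertex Set problem: given a graph $G$ and an integer $k$, decide whether $G$ has a connected feedback vertex set $S$ with $|S|\le k$. The line graph $L(G)$ of $G=(V,E)$ has vertex set $E$, with two vertices adjacent if and only if the corresponding edges share an end-vertex in $G$; a line graph is a graph isomorphic to $L(G)$ for some graph $G$. *)

theory Defs
  imports Main "HOL-Computational_Algebra.Polynomial"
begin

section \<open>Finite simple graphs\<close>

type_synonym 'a graph = "'a set \<times> 'a set set"

abbreviation verts :: "'a graph \<Rightarrow> 'a set" where "verts G \<equiv> fst G"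
abbreviation edges :: "'a graph \<Rightarrow> 'a set set" where "edges G \<equiv> snd G"

definition simple_graph :: "'a graph \<Rightarrow> bool" where
  "simple_graph G \<longleftrightarrow> finite (verts G) \<and> (\<forall>e\<in>edges G. e \<subseteq> verts G \<and> card e = 2)"

definition induced_subgraph :: "'a graph \<Rightarrow> 'a set \<Rightarrow> 'a graph" where
  "induced_subgraph G S = (verts G \<inter> S, {e \<in> edges G. e \<subseteq> S})"

definition delete_verts :: "'a graph \<Rightarrow> 'a set \<Rightarrow> 'a graph" where
  "delete_verts G S = induced_subgraph G (verts G - S)"

text \<open>The graph without vertices counts as connected.\<close>

definition connected_graph :: "'a graph \<Rightarrow> bool" where
  "connected_graph G \<longleftrightarrow> (\<forall>u\<in>verts G. \<forall>v\<in>verts G. (\<lambda>x y. {x, y} \<in> edges G)\<^sup>*\<^sup>* u v)"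

definition is_cycle :: "'a graph \<Rightarrow> 'a list \<Rightarrow> bool" where
  "is_cycle G xs \<longleftrightarrow> length xs \<ge> 3 \<and> distinct xs \<and>
     (\<forall>i<length xs. {xs ! i, xs ! (Suc i mod length xs)} \<in> edges G)"

definition forest :: "'a graph \<Rightarrow> bool" where
  "forest G \<longleftrightarrow> (\<nexists>xs. is_cycle G xs)"

definition feedback_vertex_set :: "'a graph \<Rightarrow> 'a set \<Rightarrow> bool" where
  "feedback_vertex_set G S \<longleftrightarrow> S \<subseteq> verts G \<and> forest (delete_verts G S)"

definition connected_feedback_vertex_set :: "'a graph \<Rightarrow> 'a set \<Rightarrow> bool" where
  "connected_feedback_vertex_set G S \<longleftrightarrow>
     feedback_vertex_set G S \<and> connected_graph (induced_subgraph G S)"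

definition line_graph :: "'a graph \<Rightarrow> 'a set graph" where
  "line_graph G =
     (edges G, {{e, f} | e f. e \<in> edges G \<and> f \<in> edges G \<and> e \<noteq> f \<and> e \<inter> f \<noteq> {}})"

definition graph_isomorphic :: "'a graph \<Rightarrow> 'b graph \<Rightarrow> bool" where
  "graph_isomorphic G H \<longleftrightarrow>
     (\<exists>f. bij_betw f (verts G) (verts H) \<and>
       (\<forall>u\<in>verts G. \<forall>v\<in>verts G. {u, v} \<in> edges G \<longleftrightarrow> {f u, f v} \<in> edges H))"

text \<open>Every finite graph is isomorphic to one whose vertices are natural numbers, so
  letting the root graph range over \<^typ>\<open>nat graph\<close> loses nothing.\<close>

definition is_line_graph :: "'a graph \<Rightarrow> bool" where
  "is_line_graph G \<longleftrightarrow> (\<exists>H :: nat graph. simple_graph H \<and> graph_isomorphic G (line_graph H))"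


section \<open>Turing machines\<close>

text \<open>Multi-tape, possibly nondeterministic machines with tapes that are infinite in both
  directions. States and tape symbols are natural numbers, of which a machine uses only
  finitely many because its transition set is finite. A transition \<open>(q, rs, q', as)\<close> applies in
  state \<open>q\<close> if the tape heads read the symbols \<open>rs\<close>; it switches to state \<open>q'\<close> and performs on
  each tape the corresponding action in \<open>as\<close> (write a symbol, then move the head).
  The symbol \<open>0\<close> is the blank; the bits are represented by \<open>1\<close> and \<open>2\<close>.\<close>

datatype move = Move_Left | Stay | Move_Right

type_synonym action = "nat \<times> move"
type_synonym transition = "nat \<times> nat list \<times> nat \<times> action list"
type_synonym tape = "(int \<Rightarrow> nat) \<times> int"
type_synonym config = "nat \<times> tape list"

record turing_machine =
  num_tapes :: nat
  start_state :: nat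
  accept_state :: nat
  transitions :: "transition set"

definition wf_tm :: "turing_machine \<Rightarrow> bool" where
  "wf_tm M \<longleftrightarrow> num_tapes M \<ge> 1 \<and> finite (transitions M) \<and>
     (\<forall>(q, rs, q', as)\<in>transitions M. length rs = num_tapes M \<and> length as = num_tapes M)"

definition deterministic :: "turing_machine \<Rightarrow> bool" where
  "deterministic M \<longleftrightarrow>
     (\<forall>q rs q1 as1 q2 as2. (q, rs, q1, as1) \<in> transitions M \<longrightarrow> (q, rs, q2, as2) \<in> transitions M
        \<longrightarrow> q1 = q2 \<and> as1 = as2)"

fun head_symbol :: "tape \<Rightarrow> nat" where
  "head_symbol (c, h) = c h"

fun move_offset :: "move \<Rightarrow> int" where
  "move_offset Move_Left = -1"
| "move_offset Stay = 0"
| "move_offset Move_Right = 1"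

fun perform :: "action \<Rightarrow> tape \<Rightarrow> tape" where
  "perform (s, d) (c, h) = (c(h := s), h + move_offset d)"

inductive tm_step :: "turing_machine \<Rightarrow> config \<Rightarrow> config \<Rightarrow> bool" for M where
  "(q, map head_symbol ts, q', as) \<in> transitions M \<Longrightarrow> tm_step M (q, ts) (q', map2 perform as ts)"

definition bit_symbol :: "bool \<Rightarrow> nat" where
  "bit_symbol b = (if b then 2 else 1)"

definition input_tape :: "bool list \<Rightarrow> tape" where
  "input_tape x = ((\<lambda>i. if 0 \<le> i \<and> i < int (length x) then bit_symbol (x ! nat i) else 0), 0)"

definition initial_config :: "turing_machine \<Rightarrow> bool list \<Rightarrow> config" where
  "initial_config M x =
     (start_state M, input_tape x # replicate (num_tapes M - 1) (input_tape []))"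

definition halted :: "turing_machine \<Rightarrow> config \<Rightarrow> bool" where
  "halted M c \<longleftrightarrow> (\<nexists>c'. tm_step M c c')"

text \<open>The output is the bit string that starts in cell \<open>0\<close> of the first tape and extends to
  the first blank.\<close>

definition has_output :: "config \<Rightarrow> bool list \<Rightarrow> bool" where
  "has_output c y \<longleftrightarrow>
     (\<forall>i<length y. fst (hd (snd c)) (int i) = bit_symbol (y ! i)) \<and>
     fst (hd (snd c)) (int (length y)) = 0"


section \<open>NP-completeness\<close>

definition polytime_computable :: "(bool list \<Rightarrow> bool list) \<Rightarrow> bool" where
  "polytime_computable f \<longleftrightarrow>
     (\<exists>M (p :: nat poly). wf_tm M \<and> deterministic M \<and>
       (\<forall>x. \<exists>t c. t \<le> poly p (length x) \<and> (tm_step M ^^ t) (initial_config M x) c \<and>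
          halted M c \<and> has_output c (f x)))"

definition accepts_within :: "turing_machine \<Rightarrow> bool list \<Rightarrow> nat \<Rightarrow> bool" where
  "accepts_within M x n \<longleftrightarrow>
     (\<exists>t\<le>n. \<exists>ts. (tm_step M ^^ t) (initial_config M x) (accept_state M, ts))"

text \<open>The time bound is imposed on some accepting computation only; the other
  computations need not even terminate.\<close>

definition NP :: "bool list set set" where
  "NP = {A. \<exists>M (p :: nat poly). wf_tm M \<and>
     (\<forall>x. x \<in> A \<longrightarrow> accepts_within M x (poly p (length x))) \<and>
     (\<forall>x n. accepts_within M x n \<longrightarrow> x \<in> A)}"

definition polytime_reducible :: "bool list set \<Rightarrow> bool list set \<Rightarrow> bool" where
  "polytime_reducible A B \<longleftrightarrow> (\<exists>f. polytime_computable f \<and> (\<forall>x. x \<in> A \<longleftrightarrow> f x \<in> B))"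

definition NP_hard :: "bool list set \<Rightarrow> bool" where
  "NP_hard B \<longleftrightarrow> (\<forall>A\<in>NP. polytime_reducible A B)"

definition NP_complete :: "bool list set \<Rightarrow> bool" where
  "NP_complete B \<longleftrightarrow> B \<in> NP \<and> NP_hard B"


section \<open>The decision problem as a language\<close>

text \<open>Binary representation, least significant bit first, no leading zeros.\<close>

fun binary :: "nat \<Rightarrow> bool list" where
  "binary k = (if k = 0 then [] else odd k # binary (k div 2))"

declare binary.simps [simp del]

text \<open>An instance consists of a graph with vertices \<open>0, \<dots>, n - 1\<close> and a number \<open>k\<close>; its code is
  \<open>n\<close> in unary, a separator, the adjacency matrix row by row, and \<open>k\<close> in binary. This code is injective.\<close>

definition encode_instance :: "nat graph \<Rightarrow> nat \<Rightarrow> bool list" where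
  "encode_instance G k =
     (let n = card (verts G) in
        replicate n True @ [False] @
        concat (map (\<lambda>i. map (\<lambda>j. {i, j} \<in> edges G) [0..<n]) [0..<n]) @
        binary k)"

text \<open>The restriction of the problem to a class \<open>\<C>\<close> of graphs. Strings that do not encode
  an instance with a graph from \<open>\<C>\<close> do not belong to the language.\<close>

definition connected_fvs_problem :: "(nat graph \<Rightarrow> bool) \<Rightarrow> bool list set" where
  "connected_fvs_problem \<C> =
     {encode_instance G k | G k.
        simple_graph G \<and> (\<exists>n. verts G = {..<n}) \<and> \<C> G \<and>
        (\<exists>S. connected_feedback_vertex_set G S \<and> card S \<le> k)}"

end

theory Submission
  imports Defs
begin

text \<open>\<^emph>\<open>Membership.\<close> A polynomial-time verifier only needs bounded arithmetic: a certificate consists of the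
  incidence matrix of a root graph, the feedback vertex set, a rank of the remaining vertices for which
  adjacent vertices have different ranks and every vertex has at most one neighbour of higher rank (such a
  rank exists exactly for forests), and distances with a unique local minimum within the set.

  \<^emph>\<open>Hardness.\<close> For a set \<open>S\<close> of edges of \<open>H\<close>, the graph \<open>L(H) - S\<close> is a forest only if the edges \<open>F\<close>
  outside of \<open>S\<close> have degree at most two everywhere. Attach one pendant edge to each vertex of a union of
  even cycles and two pendant edges to each vertex of a set of hubs, and join every cycle vertex to a hub. For
  an \<open>F\<close> of the maximal conceivable size all degrees are equal to two, so \<open>F\<close> contains all pendant edges, none of
  the joining edges, and every second edge of each cycle. The two choices on a cycle are the truth values
  of a variable. There is a hub for each clause and a root hub, and an occurrence of a literal is
  a pair of cycle vertices joined to the hub of the clause whose connection to the root hub through the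
  cycle survives in \<open>S\<close> exactly if the literal is true. So \<open>S\<close> is connected if and only if all clauses
  are satisfied. The clauses express, in the manner of Cook and Levin, that a nondeterministic machine accepts.\<close>

section \<open>Structured programs on Turing machines\<close>

text \<open>What makes the counting rigid is the weight of a pendant edge. In the degree sum over
  the vertices other than leaves it counts once, every other edge twice. The budget
  \<open>6 * V * C\<close> pays for all joining edges and half of the cycle edges; the edges that
  remain can be that numerous only if every pendant edge is among them. The degree bound is merely
  necessary for a forest, but in the converse direction the remaining edges form paths of at most
  three edges, so nothing else has to be excluded.

  Hardness concerns every language in NP, so the reduction starts from a machine and must itself be
  executed by one. This shapes the clauses: whether a literal occurs in a clause, and hence whether
  two vertices of the graph are adjacent, is decided by bounded arithmetic on indices and a finite
  table for the machine. One small language of expressions then serves both the reduction and the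
  verifier. Its values stay polynomial, so they can be kept in unary as head positions.\<close>

datatype com =
    Mv nat move
  | Wr nat nat
  | SKIP
  | Seq com com (infixr ";;" 60)
  | IfEq nat nat com com
  | Until nat nat com

text \<open>The third argument is the exact number of machine steps of the compiled program: a test
  costs one step, and so do the jump over the other branch and the jump back. Only four symbols can
  be written: the blank, the two bits and one mark.\<close>

inductive exec :: "com \<Rightarrow> tape list \<Rightarrow> nat \<Rightarrow> tape list \<Rightarrow> bool" where
  Mv: "j < length ts \<Longrightarrow> exec (Mv j d) ts 1 (ts[j := perform (head_symbol (ts ! j), d) (ts ! j)])"
| Wr: "j < length ts \<Longrightarrow> a < 4 \<Longrightarrow> exec (Wr j a) ts 1 (ts[j := perform (a, Stay) (ts ! j)])"
| SKIP: "exec SKIP ts 0 ts"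
| Seq: "exec c1 ts t ts1 \<Longrightarrow> exec c2 ts1 u ts2 \<Longrightarrow> exec (c1 ;; c2) ts (t + u) ts2"
| IfT: "j < length ts \<Longrightarrow> head_symbol (ts ! j) = a \<Longrightarrow> exec c1 ts t ts' \<Longrightarrow>
    exec (IfEq j a c1 c2) ts (t + 2) ts'"
| IfF: "j < length ts \<Longrightarrow> head_symbol (ts ! j) \<noteq> a \<Longrightarrow> exec c2 ts t ts' \<Longrightarrow>
    exec (IfEq j a c1 c2) ts (t + 1) ts'"
| UntilT: "j < length ts \<Longrightarrow> head_symbol (ts ! j) = a \<Longrightarrow> exec (Until j a c) ts 1 ts"
| UntilF: "j < length ts \<Longrightarrow> head_symbol (ts ! j) \<noteq> a \<Longrightarrow> exec c ts t ts1 \<Longrightarrow>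
    exec (Until j a c) ts1 u ts2 \<Longrightarrow> exec (Until j a c) ts (t + u + 2) ts2"

text \<open>A transition names the symbols read on all tapes, so a single instruction at control
  state \<open>q\<close> becomes one transition for every list of \<open>k\<close> symbols below
  4.\<close>

definition instr :: "nat \<Rightarrow> nat \<Rightarrow> (nat list \<Rightarrow> nat) \<Rightarrow> (nat list \<Rightarrow> action list) \<Rightarrow> transition set" where
  "instr k q tgt act = (\<lambda>rs. (q, rs, tgt rs, act rs)) ` {rs. set rs \<subseteq> {..<4} \<and> length rs = k}"

definition keep :: "nat list \<Rightarrow> action list" where
  "keep rs = map (\<lambda>r. (r, Stay)) rs"

fun code_size :: "com \<Rightarrow> nat" where
  "code_size (Mv j d) = 1"
| "code_size (Wr j a) = 1"
| "code_size SKIP = 0"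
| "code_size (c1 ;; c2) = code_size c1 + code_size c2"
| "code_size (IfEq j a c1 c2) = code_size c1 + code_size c2 + 2"
| "code_size (Until j a c) = code_size c + 2"

text \<open>The fragment for \<open>c\<close> occupies the states from \<open>q\<close> up to
  \<open>q + code_size c\<close>, exclusive, and is left by entering the latter. Sequential
  composition therefore needs no linking step.\<close>

fun code :: "nat \<Rightarrow> com \<Rightarrow> nat \<Rightarrow> transition set" where
  "code k (Mv j d) q = instr k q (\<lambda>_. q + 1) (\<lambda>rs. (keep rs)[j := (rs ! j, d)])"
| "code k (Wr j a) q = instr k q (\<lambda>_. q + 1) (\<lambda>rs. (keep rs)[j := (a, Stay)])"
| "code k SKIP q = {}"
| "code k (c1 ;; c2) q = code k c1 q \<union> code k c2 (q + code_size c1)"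
| "code k (IfEq j a c1 c2) q =
     instr k q (\<lambda>rs. if rs ! j = a then q + 1 else q + code_size c1 + 2) keep \<union>
     code k c1 (q + 1) \<union>
     instr k (q + 1 + code_size c1) (\<lambda>_. q + (code_size c1 + code_size c2 + 2)) keep \<union>
     code k c2 (q + code_size c1 + 2)"
| "code k (Until j a c) q =
     instr k q (\<lambda>rs. if rs ! j = a then q + (code_size c + 2) else q + 1) keep \<union>
     code k c (q + 1) \<union>
     instr k (q + 1 + code_size c) (\<lambda>_. q) keep"

definition tapes_ok :: "nat \<Rightarrow> tape list \<Rightarrow> bool" where
  "tapes_ok k ts \<longleftrightarrow> length ts = k \<and> (\<forall>tp\<in>set ts. \<forall>z. fst tp z < 4)"

lemma tapes_ok_update:
  "tapes_ok k ts \<Longrightarrow> (\<And>z. fst tp z < 4) \<Longrightarrow> tapes_ok k (ts[j := tp])"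
  unfolding tapes_ok_def by (auto dest!: subsetD[OF set_update_subset_insert])

lemma head_symbol_conv: "head_symbol tp = fst tp (snd tp)"
  by (cases tp) simp

lemma tm_step_instr:
  assumes "instr k q tgt act \<subseteq> transitions M" "tapes_ok k ts" "rs = map head_symbol ts"
  shows "tm_step M (q, ts) (tgt rs, map2 perform (act rs) ts)"
proof -
  have "set rs \<subseteq> {..<4}"
    using assms by (auto simp: tapes_ok_def head_symbol_conv)
  then have "(q, rs, tgt rs, act rs) \<in> instr k q tgt act"
    using assms unfolding instr_def tapes_ok_def by (intro image_eqI[OF refl]) simp
  then show ?thesis
    using assms by (auto intro: tm_step.intros)
qed

lemma perform_head [simp]: "perform (head_symbol tp, Stay) tp = tp"
  by (cases tp) simp

lemma map2_perform_keep [simp]: "map2 perform (keep (map head_symbol ts)) ts = ts"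
  by (rule nth_equalityI) (auto simp: keep_def)

lemma map2_perform_update:
  "j < length ts \<Longrightarrow>
   map2 perform ((keep (map head_symbol ts))[j := a]) ts = ts[j := perform a (ts ! j)]"
  by (rule nth_equalityI) (auto simp: keep_def nth_list_update)

lemma perform_bounded:
  "(\<And>z. fst tp z < 4) \<Longrightarrow> a < (4::nat) \<Longrightarrow> fst (perform (a, d) tp) z < 4"
  by (cases tp) auto

lemma exec_tapes_ok: "exec c ts t ts' \<Longrightarrow> tapes_ok k ts \<Longrightarrow> tapes_ok k ts'"
proof (induction rule: exec.induct)
  case (Mv j ts d)
  then show ?case
    by (intro tapes_ok_update perform_bounded) (auto simp: tapes_ok_def head_symbol_conv)
next
  case (Wr j ts a)
  then show ?case
    by (intro tapes_ok_update perform_bounded) (auto simp: tapes_ok_def)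
qed auto

lemma relpowp_one: "R x y \<Longrightarrow> ((R :: 'a \<Rightarrow> 'a \<Rightarrow> bool) ^^ 1) x y"
  by (simp only: relpowp_1)

lemma relpowp_prepend: "R x y \<Longrightarrow> (R ^^ n) y z \<Longrightarrow> (R ^^ Suc n) x z"
  by (metis relpowp_Suc_I2)

lemma relpowp_append: "(R ^^ m) x y \<Longrightarrow> (R ^^ n) y z \<Longrightarrow> (R ^^ (m + n)) x z"
  unfolding relpowp_add by auto

text \<open>The code only has to be contained in the transitions, so this also yields runs of larger
  and of nondeterministic machines. That other runs are impossible is a separate matter, see
  \<open>tm_step_restrict\<close>.\<close>

lemma exec_sound:
  "exec c ts t ts' \<Longrightarrow> tapes_ok k ts \<Longrightarrow> code k c q \<subseteq> transitions M \<Longrightarrow>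
   (tm_step M ^^ t) (q, ts) (q + code_size c, ts')"
proof (induction arbitrary: q rule: exec.induct)
  case (Mv j ts d)
  then have "j < length ts" by simp
  then have "tm_step M (q, ts) (q + 1, map2 perform ((keep (map head_symbol ts))[j := (map head_symbol ts ! j, d)]) ts)"
    using Mv tm_step_instr[of k q "\<lambda>_. q + 1" "\<lambda>rs. (keep rs)[j := (rs ! j, d)]" M ts] by simp
  then have "tm_step M (q, ts) (q + 1, ts[j := perform (head_symbol (ts ! j), d) (ts ! j)])"
    using Mv by (simp add: map2_perform_update)
  then show ?case unfolding code_size.simps by (rule relpowp_one)
next
  case (Wr j ts a)
  have "tm_step M (q, ts) (q + 1, map2 perform ((keep (map head_symbol ts))[j := (a, Stay)]) ts)"
    using Wr tm_step_instr[of k q "\<lambda>_. q + 1" "\<lambda>rs. (keep rs)[j := (a, Stay)]" M ts] by simp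
  then have "tm_step M (q, ts) (q + 1, ts[j := perform (a, Stay) (ts ! j)])"
    using Wr by (simp add: map2_perform_update)
  then show ?case unfolding code_size.simps by (rule relpowp_one)
next
  case (SKIP ts)
  then show ?case by simp
next
  case (Seq c1 ts t ts1 c2 u ts2)
  have "(tm_step M ^^ t) (q, ts) (q + code_size c1, ts1)"
    using Seq by auto
  moreover have "(tm_step M ^^ u) (q + code_size c1, ts1) (q + code_size c1 + code_size c2, ts2)"
    using Seq exec_tapes_ok by auto
  ultimately show ?case by (auto simp: add.assoc intro: relpowp_append)
next
  case (IfT j ts a c1 t ts' c2)
  have "tm_step M (q, ts) (q + 1, ts)"
    using IfT tm_step_instr[of k q "\<lambda>rs. if rs ! j = a then q + 1 else q + code_size c1 + 2" keep M ts]
    by simp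
  moreover have "(tm_step M ^^ t) (q + 1, ts) (q + 1 + code_size c1, ts')"
    using IfT.IH[of "q + 1"] IfT.prems by simp
  moreover have "tm_step M (q + 1 + code_size c1, ts') (q + (code_size c1 + code_size c2 + 2), ts')"
    using IfT tm_step_instr[of k "q + 1 + code_size c1" "\<lambda>_. q + (code_size c1 + code_size c2 + 2)" keep M ts']
      exec_tapes_ok[of c1 ts t ts' k] by simp
  ultimately have "(tm_step M ^^ (1 + (t + 1))) (q, ts) (q + (code_size c1 + code_size c2 + 2), ts')"
    by (meson relpowp_append relpowp_one)
  then show ?case by simp
next
  case (IfF j ts a c2 t ts' c1)
  have "tm_step M (q, ts) (q + code_size c1 + 2, ts)"
    using IfF tm_step_instr[of k q "\<lambda>rs. if rs ! j = a then q + 1 else q + code_size c1 + 2" keep M ts]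
    by simp
  moreover have "(tm_step M ^^ t) (q + code_size c1 + 2, ts) (q + code_size c1 + 2 + code_size c2, ts')"
    using IfF.IH[of "q + code_size c1 + 2"] IfF.prems by simp
  ultimately have "(tm_step M ^^ Suc t) (q, ts) (q + code_size c1 + 2 + code_size c2, ts')"
    by (rule relpowp_prepend)
  then show ?case by (simp add: algebra_simps)
next
  case (UntilT j ts a c)
  then have "tm_step M (q, ts) (q + (code_size c + 2), ts)"
    using tm_step_instr[of k q "\<lambda>rs. if rs ! j = a then q + (code_size c + 2) else q + 1" keep M ts]
    by simp
  then show ?case unfolding code_size.simps by (rule relpowp_one)
next
  case (UntilF j ts a c t ts1 u ts2)
  have "tm_step M (q, ts) (q + 1, ts)"
    using UntilF tm_step_instr[of k q "\<lambda>rs. if rs ! j = a then q + (code_size c + 2) else q + 1" keep M ts]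
    by simp
  moreover have "(tm_step M ^^ t) (q + 1, ts) (q + 1 + code_size c, ts1)"
    using UntilF.IH(1)[of "q + 1"] UntilF.prems by simp
  moreover have "tm_step M (q + 1 + code_size c, ts1) (q, ts1)"
    using UntilF tm_step_instr[of k "q + 1 + code_size c" "\<lambda>_. q" keep M ts1]
      exec_tapes_ok[of c ts t ts1 k] by simp
  moreover have "(tm_step M ^^ u) (q, ts1) (q + code_size (Until j a c), ts2)"
    using UntilF.IH(2)[of q] UntilF.prems exec_tapes_ok[OF UntilF.hyps(3)] by simp
  ultimately have "(tm_step M ^^ (1 + (t + (1 + u)))) (q, ts) (q + code_size (Until j a c), ts2)"
    by (meson relpowp_append relpowp_one)
  then show ?case by simp
qed

section \<open>Determinism of compiled programs\<close>

definition functional :: "transition set \<Rightarrow> bool" where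
  "functional D \<longleftrightarrow> (\<forall>q rs q1 as1 q2 as2. (q, rs, q1, as1) \<in> D \<longrightarrow> (q, rs, q2, as2) \<in> D \<longrightarrow>
     q1 = q2 \<and> as1 = as2)"

lemma functional_instr: "functional (instr k q tgt act)"
  unfolding functional_def instr_def by auto

lemma functional_Un:
  "functional A \<Longrightarrow> functional B \<Longrightarrow> fst ` A \<subseteq> X \<Longrightarrow> fst ` B \<subseteq> Y \<Longrightarrow> X \<inter> Y = {} \<Longrightarrow>
   functional (A \<union> B) \<and> fst ` (A \<union> B) \<subseteq> X \<union> Y"
  unfolding functional_def by (simp add: image_Un le_supI1 le_supI2) (metis IntI empty_iff fst_conv image_subset_iff)

lemma sources_instr: "fst ` instr k q tgt act \<subseteq> {q}"
  unfolding instr_def by auto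

text \<open>Disjoint intervals of source states make unions of fragments functional. The upper bound
  also shows that a machine halts once it has left its code.\<close>

lemma sources_code: "fst ` code k c q \<subseteq> {q..<q + code_size c}"
proof (induction c arbitrary: q)
  case (Seq c1 c2)
  show ?case using Seq.IH(1)[of q] Seq.IH(2)[of "q + code_size c1"] by fastforce
next
  case (IfEq j a c1 c2)
  show ?case using IfEq.IH(1)[of "q + 1"] IfEq.IH(2)[of "q + code_size c1 + 2"]
    by (simp add: image_Un) (intro conjI order_trans[OF sources_instr]; force)
next
  case (Until j a c)
  show ?case using Until.IH[of "q + 1"]
    by (simp add: image_Un) (intro conjI order_trans[OF sources_instr]; force)
qed (auto intro!: order_trans[OF sources_instr])

lemma functional_code: "functional (code k c q)"
proof (induction c arbitrary: q)
  case SKIP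
  show ?case by (simp add: functional_def)
next
  case (Seq c1 c2)
  have "functional (code k c1 q \<union> code k c2 (q + code_size c1))"
    by (rule functional_Un[OF Seq sources_code sources_code, THEN conjunct1]) auto
  then show ?case by simp
next
  case (IfEq j a c1 c2)
  have 1: "functional (instr k q x keep \<union> code k c1 (q + 1)) \<and>
      fst ` (instr k q x keep \<union> code k c1 (q + 1)) \<subseteq> {q} \<union> {q + 1..<q + 1 + code_size c1}" for x
    by (rule functional_Un[OF functional_instr IfEq(1) sources_instr sources_code]) auto
  have 2: "functional (instr k (q + 1 + code_size c1) y keep \<union> code k c2 (q + code_size c1 + 2)) \<and>
      fst ` (instr k (q + 1 + code_size c1) y keep \<union> code k c2 (q + code_size c1 + 2)) \<subseteq>
        {q + 1 + code_size c1} \<union> {q + code_size c1 + 2..<q + code_size c1 + 2 + code_size c2}" for y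
    by (rule functional_Un[OF functional_instr IfEq(2) sources_instr sources_code]) auto
  have "functional ((instr k q x keep \<union> code k c1 (q + 1)) \<union>
      (instr k (q + 1 + code_size c1) y keep \<union> code k c2 (q + code_size c1 + 2)))" for x y
    by (rule functional_Un[OF 1[THEN conjunct1] 2[THEN conjunct1] 1[THEN conjunct2] 2[THEN conjunct2], THEN conjunct1]) auto
  then show ?case unfolding code.simps Un_assoc .
next
  case (Until j a c)
  have 1: "functional (instr k q x keep \<union> code k c (q + 1)) \<and>
      fst ` (instr k q x keep \<union> code k c (q + 1)) \<subseteq> {q} \<union> {q + 1..<q + 1 + code_size c}" for x
    by (rule functional_Un[OF functional_instr Until sources_instr sources_code]) auto
  have "functional ((instr k q x keep \<union> code k c (q + 1)) \<union> instr k (q + 1 + code_size c) y keep)" for x y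
    by (rule functional_Un[OF 1[THEN conjunct1] functional_instr 1[THEN conjunct2] sources_instr, THEN conjunct1]) auto
  then show ?case unfolding code.simps .
qed (auto intro: functional_instr)

definition wf_transitions :: "nat \<Rightarrow> transition set \<Rightarrow> bool" where
  "wf_transitions k D \<longleftrightarrow> finite D \<and> (\<forall>(q, rs, q', as)\<in>D. length rs = k \<and> length as = k)"

lemma wf_transitions_Un: "wf_transitions k A \<Longrightarrow> wf_transitions k B \<Longrightarrow> wf_transitions k (A \<union> B)"
  unfolding wf_transitions_def by auto

lemma wf_transitions_instr:
  "(\<And>rs. length rs = k \<Longrightarrow> length (act rs) = k) \<Longrightarrow> wf_transitions k (instr k q tgt act)"
  unfolding wf_transitions_def instr_def using finite_lists_length_eq[of "{..<4::nat}" k] by auto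

lemma wf_transitions_code: "wf_transitions k (code k c q)"
proof (induction c arbitrary: q)
  case SKIP
  show ?case by (simp add: wf_transitions_def)
qed (auto intro!: wf_transitions_Un wf_transitions_instr simp: keep_def)

section \<open>Registers and arithmetic expressions\<close>

definition poly_fun :: "(nat \<Rightarrow> nat) \<Rightarrow> bool" where
  "poly_fun f \<longleftrightarrow> (\<exists>p. f = poly p)"

lemma poly_fun_const [intro]: "poly_fun (\<lambda>n. c)"
  unfolding poly_fun_def by (rule exI[of _ "[:c:]"]) auto

lemma poly_fun_ident [intro]: "poly_fun (\<lambda>n. n)"
  unfolding poly_fun_def by (rule exI[of _ "[:0, 1:]"]) auto

lemma poly_fun_add [intro]: assumes "poly_fun f" "poly_fun g" shows "poly_fun (\<lambda>n. f n + g n)"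
proof -
  obtain p q where "f = poly p" "g = poly q" using assms unfolding poly_fun_def by blast
  then show ?thesis unfolding poly_fun_def by (intro exI[of _ "p + q"]) (simp add: fun_eq_iff )
qed

lemma poly_fun_mult [intro]: assumes "poly_fun f" "poly_fun g" shows "poly_fun (\<lambda>n. f n * g n)"
proof -
  obtain p q where "f = poly p" "g = poly q" using assms unfolding poly_fun_def by blast
  then show ?thesis unfolding poly_fun_def by (intro exI[of _ "p * q"]) (simp add: fun_eq_iff )
qed

lemma poly_fun_compose: assumes "poly_fun f" "poly_fun g" shows "poly_fun (\<lambda>n. f (g n))"
proof -
  obtain p q where "f = poly p" "g = poly q" using assms unfolding poly_fun_def by blast
  then show ?thesis unfolding poly_fun_def by (intro exI[of _ "pcompose p q"]) (simp add: fun_eq_iff poly_pcompose)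
qed

text \<open>The coefficients are natural numbers, so no term decreases.\<close>

lemma poly_fun_mono: "poly_fun f \<Longrightarrow> m \<le> n \<Longrightarrow> f m \<le> f n"
proof -
  have "poly p m \<le> poly p n" if "m \<le> n" for p :: "nat poly"
    using that by (induction p) (auto intro: add_mono mult_mono)
  then show "poly_fun f \<Longrightarrow> m \<le> n \<Longrightarrow> f m \<le> f n"
    unfolding poly_fun_def by auto
qed

type_synonym regs = "nat \<Rightarrow> nat"

text \<open>A register is a tape with the mark \<open>3\<close> in cell \<open>0\<close>; its value is the position of the head. The input strings are
  stored behind the marks of two registers, which thereby also serve as pointers into them.\<close>

definition marked :: "bool list \<Rightarrow> int \<Rightarrow> nat" where
  "marked x i = (if i = 0 then 3 else if 0 < i \<and> i \<le> int (length x) then bit_symbol (x ! nat (i - 1)) else 0)"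

text \<open>Tape \<open>0\<close> is reserved for the output \<open>y\<close>, with its head on the
  first free cell; register \<open>j\<close> is tape \<open>Suc j\<close>.\<close>

definition reg_tapes :: "nat \<Rightarrow> (nat \<Rightarrow> bool list) \<Rightarrow> bool list \<Rightarrow> regs \<Rightarrow> tape list" where
  "reg_tapes K I y R =
     (fst (input_tape y), int (length y)) # map (\<lambda>j. (marked (I j), int (R j))) [0..<K]"

text \<open>\<open>T\<close> is only an upper bound, so that the times of branches and of loop
  rounds can be made uniform.\<close>

definition runs :: "nat \<Rightarrow> (nat \<Rightarrow> bool list) \<Rightarrow> com \<Rightarrow> bool list \<Rightarrow> regs \<Rightarrow> nat \<Rightarrow> bool list \<Rightarrow> regs \<Rightarrow> bool" where
  "runs K I c y R T y' R' \<longleftrightarrow> (\<exists>t\<le>T. exec c (reg_tapes K I y R) t (reg_tapes K I y' R'))"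

abbreviation inc :: "nat \<Rightarrow> com" where "inc j \<equiv> Mv (Suc j) Move_Right"
abbreviation dec :: "nat \<Rightarrow> com" where "dec j \<equiv> Mv (Suc j) Move_Left"
abbreviation loop :: "nat \<Rightarrow> com \<Rightarrow> com" where "loop j c \<equiv> Until (Suc j) 3 (dec j ;; c)"

lemma length_reg_tapes [simp]: "length (reg_tapes K I y R) = Suc K"
  by (simp add: reg_tapes_def)

lemma reg_tapes_Suc [simp]: "j < K \<Longrightarrow> reg_tapes K I y R ! Suc j = (marked (I j), int (R j))"
  by (simp add: reg_tapes_def)

lemma reg_tapes_0 [simp]: "reg_tapes K I y R ! 0 = (fst (input_tape y), int (length y))"
  by (simp add: reg_tapes_def)

lemma marked_less: "marked x i < 4"
  by (auto simp: marked_def bit_symbol_def)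

lemma marked_eq_3 [simp]: "marked x (int n) = 3 \<longleftrightarrow> n = 0"
  by (auto simp: marked_def bit_symbol_def)

lemma marked_0 [simp]: "marked x 0 = 3"
  by (simp add: marked_def)

lemma tapes_ok_reg_tapes: "tapes_ok (Suc K) (reg_tapes K I y R)"
  by (auto simp: tapes_ok_def reg_tapes_def marked_less input_tape_def bit_symbol_def)

lemma reg_tapes_update:
  "j < K \<Longrightarrow> (reg_tapes K I y R)[Suc j := (marked (I j), int n)] = reg_tapes K I y (R(j := n))"
  by (rule nth_equalityI) (auto simp: reg_tapes_def nth_list_update nth_Cons' simp del: upt_Suc)

lemma runs_mono: "runs K I c y R T y' R' \<Longrightarrow> T \<le> T' \<Longrightarrow> runs K I c y R T' y' R'"
  unfolding runs_def by (meson order_trans)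

lemma runs_Seq:
  "runs K I c1 y R T1 y1 R1 \<Longrightarrow> runs K I c2 y1 R1 T2 y2 R2 \<Longrightarrow> runs K I (c1 ;; c2) y R (T1 + T2) y2 R2"
  unfolding runs_def by (meson Seq add_mono)

lemma runs_SKIP: "runs K I SKIP y R 0 y R"
  unfolding runs_def using exec.SKIP by blast

lemma runs_inc:
  assumes "j < K" shows "runs K I (inc j) y R 1 y (R(j := Suc (R j)))"
proof -
  have "exec (inc j) (reg_tapes K I y R) 1 ((reg_tapes K I y R)[Suc j := (marked (I j), int (Suc (R j)))])"
    using assms exec.Mv[of "Suc j" "reg_tapes K I y R" Move_Right] by (simp add: add.commute)
  then show ?thesis unfolding runs_def reg_tapes_update[OF assms] by blast
qed

lemma runs_dec:
  assumes "j < K" "R j = Suc n" shows "runs K I (dec j) y R 1 y (R(j := n))"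
proof -
  have "exec (dec j) (reg_tapes K I y R) 1 ((reg_tapes K I y R)[Suc j := (marked (I j), int n)])"
    using assms exec.Mv[of "Suc j" "reg_tapes K I y R" Move_Left] by simp
  then show ?thesis unfolding runs_def reg_tapes_update[OF assms(1)] by blast
qed

lemma runs_IfEq:
  "j < K \<Longrightarrow> (marked (I j) (int (R j)) = a \<Longrightarrow> runs K I c1 y R T y' R') \<Longrightarrow>
   (marked (I j) (int (R j)) \<noteq> a \<Longrightarrow> runs K I c2 y R T y' R') \<Longrightarrow>
   runs K I (IfEq (Suc j) a c1 c2) y R (T + 2) y' R'"
proof (cases "marked (I j) (int (R j)) = a")
  case True
  assume *: "j < K" "marked (I j) (int (R j)) = a \<Longrightarrow> runs K I c1 y R T y' R'"
  then obtain t where t: "t \<le> T" "exec c1 (reg_tapes K I y R) t (reg_tapes K I y' R')"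
    using True unfolding runs_def by auto
  have "exec (IfEq (Suc j) a c1 c2) (reg_tapes K I y R) (t + 2) (reg_tapes K I y' R')"
    using * True by (intro exec.IfT t(2)) auto
  then show ?thesis unfolding runs_def using t(1) by (intro exI[of _ "t + 2"]) auto
next
  case False
  assume *: "j < K" "marked (I j) (int (R j)) \<noteq> a \<Longrightarrow> runs K I c2 y R T y' R'"
  then obtain t where t: "t \<le> T" "exec c2 (reg_tapes K I y R) t (reg_tapes K I y' R')"
    using False unfolding runs_def by auto
  have "exec (IfEq (Suc j) a c1 c2) (reg_tapes K I y R) (t + 1) (reg_tapes K I y' R')"
    using * False by (intro exec.IfF t(2)) auto
  then show ?thesis unfolding runs_def using t(1) by (intro exI[of _ "t + 1"]) auto
qed

text \<open>\<open>S m\<close> and \<open>Y m\<close> describe registers and output after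
  \<open>m\<close> rounds; the induction is on the number \<open>l\<close> of remaining rounds. The
  counter is decreased before the body, which therefore starts with \<open>n - Suc m\<close> in
  it.\<close>

lemma runs_loop_aux:
  assumes "j < K" "\<And>m. m \<le> n \<Longrightarrow> S m j = n - m"
    "\<And>m. m < n \<Longrightarrow> runs K I c (Y m) ((S m)(j := n - Suc m)) T (Y (Suc m)) (S (Suc m))"
  shows "l \<le> n \<Longrightarrow> runs K I (loop j c) (Y (n - l)) (S (n - l)) (l * (T + 3) + 1) (Y n) (S n)"
proof (induction l)
  case 0
  have "exec (loop j c) (reg_tapes K I (Y n) (S n)) 1 (reg_tapes K I (Y n) (S n))"
    using assms(1) assms(2)[of n] by (intro exec.UntilT) auto
  then show ?case unfolding runs_def by auto
next
  case (Suc l)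
  let ?m = "n - Suc l"
  have m: "Suc ?m = n - l" "?m < n" "S ?m j = Suc l" using Suc.prems assms(2)[of ?m] by auto
  have "runs K I (dec j) (Y ?m) (S ?m) 1 (Y ?m) ((S ?m)(j := n - Suc ?m))"
    using assms(1) m Suc.prems by (intro runs_dec) auto
  from runs_Seq[OF this assms(3)[OF m(2)]]
  obtain t where t: "t \<le> 1 + T"
    "exec (dec j ;; c) (reg_tapes K I (Y ?m) (S ?m)) t (reg_tapes K I (Y (n - l)) (S (n - l)))"
    unfolding runs_def m(1) by blast
  obtain u where u: "u \<le> l * (T + 3) + 1"
    "exec (loop j c) (reg_tapes K I (Y (n - l)) (S (n - l))) u (reg_tapes K I (Y n) (S n))"
    using Suc unfolding runs_def by auto
  have "exec (loop j c) (reg_tapes K I (Y ?m) (S ?m)) (t + u + 2) (reg_tapes K I (Y n) (S n))"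
    using assms(1) m(3) by (intro exec.UntilF[OF _ _ t(2) u(2)]) (auto simp del: of_nat_Suc)
  then show ?case unfolding runs_def using t(1) u(1) by (intro exI[of _ "t + u + 2"]) auto
qed

lemma runs_loop:
  assumes "j < K" "\<And>m. m \<le> n \<Longrightarrow> S m j = n - m"
    "\<And>m. m < n \<Longrightarrow> runs K I c (Y m) ((S m)(j := n - Suc m)) T (Y (Suc m)) (S (Suc m))"
    "S 0 = R" "Y 0 = y" "S n = R'" "Y n = y'"
  shows "runs K I (loop j c) y R (n * (T + 3) + 1) y' R'"
  using runs_loop_aux[OF assms(1-3), of n] assms(4-) by simp

lemma runs_clear:
  assumes "j < K" shows "runs K I (loop j SKIP) y R (R j * 3 + 1) y (R(j := 0))"
  using assms runs_loop[where S = "\<lambda>m. R(j := R j - m)" and n = "R j" and Y = "\<lambda>_. y" and T = 0]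
  by (auto simp: runs_SKIP)

lemma runs_move:
  assumes "j < K" "i < K" "i \<noteq> j"
  shows "runs K I (loop j (inc i)) y R (R j * 4 + 1) y (R(i := R i + R j, j := 0))"
proof -
  have "runs K I (loop j (inc i)) y R (R j * (1 + 3) + 1) y (R(i := R i + R j, j := 0))"
  proof (rule runs_loop[where S = "\<lambda>m. R(i := R i + m, j := R j - m)" and Y = "\<lambda>_. y"])
    fix m assume "m < R j"
    show "runs K I (inc i) y ((R(i := R i + m, j := R j - m))(j := R j - Suc m)) 1 y
      (R(i := R i + Suc m, j := R j - Suc m))"
      using runs_inc[OF assms(2), of I y "(R(i := R i + m, j := R j - m))(j := R j - Suc m)"] assms
      by (simp add: fun_upd_twist)
  qed (use assms in auto)
  then show ?thesis by simp
qed

text \<open>Reading a unary register by counting down destroys it. The value is transferred to two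
  registers at once, and moving the second one back restores the source.\<close>

lemma runs_copy:
  assumes "j < K" "i < K" "l < K" "i \<noteq> j" "l \<noteq> i" "l \<noteq> j" "R l = 0" "R i = 0"
  shows "runs K I (loop j (inc i ;; inc l) ;; loop l (inc j)) y R (R j * 9 + 2) y (R(i := R j))"
proof -
  have 1: "runs K I (loop j (inc i ;; inc l)) y R (R j * (1 + 1 + 3) + 1) y (R(i := R j, l := R j, j := 0))"
  proof (rule runs_loop[where S = "\<lambda>m. R(i := m, l := m, j := R j - m)" and Y = "\<lambda>_. y"])
    fix m assume "m < R j"
    let ?R = "(R(i := m, l := m, j := R j - m))(j := R j - Suc m)"
    have "runs K I (inc i ;; inc l) y ?R (1 + 1) y ((?R(i := Suc (?R i)))(l := Suc ((?R(i := Suc (?R i))) l)))"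
      by (rule runs_Seq[OF runs_inc runs_inc]) (use assms in auto)
    moreover have "(?R(i := Suc (?R i)))(l := Suc ((?R(i := Suc (?R i))) l)) =
        R(i := Suc m, l := Suc m, j := R j - Suc m)"
      using assms by (auto simp: fun_eq_iff)
    ultimately show "runs K I (inc i ;; inc l) y ?R (1 + 1) y (R(i := Suc m, l := Suc m, j := R j - Suc m))"
      by (simp only:)
  qed (use assms in \<open>auto simp: fun_eq_iff\<close>)
  let ?R = "R(i := R j, l := R j, j := 0)"
  have 2: "runs K I (loop l (inc j)) y ?R (?R l * 4 + 1) y (?R(j := ?R j + ?R l, l := 0))"
    using assms by (intro runs_move) auto
  have 3: "?R(j := ?R j + ?R l, l := 0) = R(i := R j)" using assms by (auto simp: fun_eq_iff)
  show ?thesis using runs_Seq[OF 1 2] assms unfolding 3 by (elim runs_mono) simp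
qed

text \<open>Register \<open>l\<close> counts down, and register \<open>s\<close> saves the value that the loop variable \<open>i\<close> had before.\<close>

definition for_com :: "nat \<Rightarrow> nat \<Rightarrow> nat \<Rightarrow> com \<Rightarrow> com" where
  "for_com i l s c = ((loop i (inc s) ;; loop l (c ;; inc i)) ;; loop i SKIP) ;; loop s (inc i)"

text \<open>\<open>S m\<close> describes the registers after \<open>m\<close> rounds apart from the
  three that the loop manages; these are overwritten explicitly in the assumption on the body. The
  loop variable counts up while \<open>l\<close> counts down.\<close>

lemma runs_for_com:
  assumes K: "i < K" "l < K" "s < K" "i \<noteq> l" "i \<noteq> s" "l \<noteq> s" and R: "R s = 0" "S 0 = R" "Y 0 = y"
    and body: "\<And>m. m < R l \<Longrightarrow> runs K I c (Y m) ((S m)(i := m, l := R l - Suc m, s := R i)) T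
      (Y (Suc m)) ((S (Suc m))(i := m, l := R l - Suc m, s := R i))"
  shows "runs K I (for_com i l s c) y R (R l * (T + 7) + R i * 8 + 4)
    (Y (R l)) ((S (R l))(i := R i, l := 0, s := 0))"
proof -
  let ?n = "R l"
  define P where "P m = (S m)(i := m, l := ?n - m, s := R i)" for m
  have "R(s := R s + R i, i := 0) = P 0" using K R by (auto simp: P_def fun_eq_iff)
  then have 1: "runs K I (loop i (inc s)) y R (R i * 4 + 1) y (P 0)"
    using runs_move[of i K s I y R] K by simp
  have 2: "runs K I (loop l (c ;; inc i)) y (P 0) (?n * ((T + 1) + 3) + 1) (Y ?n) (P ?n)"
  proof (rule runs_loop[where S = P and Y = Y])
    fix m assume m: "m < ?n"
    let ?Q = "(S (Suc m))(i := m, l := ?n - Suc m, s := R i)"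
    have "(P m)(l := ?n - Suc m) = (S m)(i := m, l := ?n - Suc m, s := R i)" "?Q(i := Suc (?Q i)) = P (Suc m)"
      using K by (auto simp: P_def fun_eq_iff)
    then show "runs K I (c ;; inc i) (Y m) ((P m)(l := ?n - Suc m)) (T + 1) (Y (Suc m)) (P (Suc m))"
      using runs_Seq[OF body[OF m] runs_inc[OF K(1)]] by (simp only:)
  qed (use K R in \<open>auto simp: P_def\<close>)
  have 3: "runs K I (loop i SKIP) (Y ?n) (P ?n) (?n * 3 + 1) (Y ?n) ((P ?n)(i := 0))"
    using runs_clear[of i K I "Y ?n" "P ?n"] K by (simp add: P_def)
  let ?Q = "(P ?n)(i := 0)"
  have "?Q s = R i" "?Q(i := ?Q i + ?Q s, s := 0) = (S ?n)(i := R i, l := 0, s := 0)"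
    using K by (auto simp: P_def fun_eq_iff)
  then have 4: "runs K I (loop s (inc i)) (Y ?n) ?Q (R i * 4 + 1) (Y ?n) ((S ?n)(i := R i, l := 0, s := 0))"
    using runs_move[of s K i I "Y ?n" ?Q] K by simp
  show ?thesis
    unfolding for_com_def
    by (rule runs_mono[OF runs_Seq[OF runs_Seq[OF runs_Seq[OF 1 2] 3] 4]]) (simp add: algebra_simps)
qed

text \<open>A bounded sum is the only iteration. It yields products, bounded quantifiers and
  cardinalities, and it keeps all values polynomial in the registers, as unary arithmetic requires.
  \<open>Bit 0\<close> reads the instance and \<open>Bit 1\<close> the certificate.\<close>

datatype exp =
    Const nat
  | Var nat
  | Add exp exp
  | Sub exp exp
  | Bit nat exp
  | Sum nat exp exp

fun eval :: "(nat \<Rightarrow> bool list) \<Rightarrow> exp \<Rightarrow> regs \<Rightarrow> nat" where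
  "eval I (Const c) R = c"
| "eval I (Var i) R = R i"
| "eval I (Add a b) R = eval I a R + eval I b R"
| "eval I (Sub a b) R = eval I a R - eval I b R"
| "eval I (Bit j a) R = (if eval I a R < length (I j) \<and> I j ! eval I a R then 1 else 0)"
| "eval I (Sum i a b) R = (\<Sum>z<eval I a R. eval I b (R(i := z)))"

fun fresh :: "exp \<Rightarrow> nat" where
  "fresh (Const c) = 0"
| "fresh (Var i) = Suc i"
| "fresh (Add a b) = max (fresh a) (fresh b)"
| "fresh (Sub a b) = max (fresh a) (fresh b)"
| "fresh (Bit j a) = fresh a"
| "fresh (Sum i a b) = max (Suc i) (max (fresh a) (fresh b))"

text \<open>Registers \<open>0\<close> and \<open>1\<close> point into the two input strings and
  rest on their marks between reads, so \<open>Sum\<close> must not bind them.\<close>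

fun ok_exp :: "exp \<Rightarrow> bool" where
  "ok_exp (Const c) = True"
| "ok_exp (Var i) = True"
| "ok_exp (Add a b) = (ok_exp a \<and> ok_exp b)"
| "ok_exp (Sub a b) = (ok_exp a \<and> ok_exp b)"
| "ok_exp (Bit j a) = (j < 2 \<and> ok_exp a)"
| "ok_exp (Sum i a b) = (2 \<le> i \<and> ok_exp a \<and> ok_exp b)"

definition wf_exp :: "nat \<Rightarrow> exp \<Rightarrow> bool" where
  "wf_exp v e \<longleftrightarrow> ok_exp e \<and> fresh e \<le> v"

fun width :: "exp \<Rightarrow> nat" where
  "width (Const c) = 1"
| "width (Var i) = 2"
| "width (Add a b) = width a + width b + 2"
| "width (Sub a b) = width a + width b + 2"
| "width (Bit j a) = width a + 1"
| "width (Sum i a b) = width a + width b + 4"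

text \<open>The value is left in register \<open>d\<close>, which is empty before; the registers
  above \<open>d\<close> are scratch space and empty again afterwards. \<open>Bit\<close> moves the
  pointer to the value plus one, because cell \<open>0\<close> holds the mark.\<close>

fun com_exp :: "exp \<Rightarrow> nat \<Rightarrow> com" where
  "com_exp (Const c) d = ((\<lambda>p. p ;; inc d) ^^ c) SKIP"
| "com_exp (Var i) d = (loop i (inc d ;; inc (Suc d)) ;; loop (Suc d) (inc i))"
| "com_exp (Add a b) d = (com_exp a d ;; com_exp b (d + 1)) ;; loop (d + 1) (inc d)"
| "com_exp (Sub a b) d =
     (com_exp a d ;; com_exp b (d + 1)) ;; loop (d + 1) (IfEq (Suc d) 3 SKIP (dec d))"
| "com_exp (Bit j a) d =
     (((com_exp a d ;; inc j) ;; loop d (inc j)) ;; IfEq (Suc j) 2 (inc d) SKIP) ;; loop j SKIP"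
| "com_exp (Sum i a b) d =
     (com_exp a (d + 1) ;; for_com i (d + 1) (d + 2) (com_exp b (d + 3) ;; loop (d + 3) (inc d)))"

lemma eval_cong_fresh: "(\<And>j. j < fresh e \<Longrightarrow> R j = R' j) \<Longrightarrow> eval I e R = eval I e R'"
proof (induction e arbitrary: R R')
  case (Sum i a b)
  have "eval I a R = eval I a R'" by (rule Sum.IH(1)) (use Sum.prems in auto)
  moreover have "eval I b (R(i := z)) = eval I b (R'(i := z))" for z
    by (rule Sum.IH(2)) (use Sum.prems in auto)
  ultimately show ?case by simp
next
  case (Add a b)
  have "eval I a R = eval I a R'" by (rule Add.IH(1)) (use Add.prems in auto)
  moreover have "eval I b R = eval I b R'" by (rule Add.IH(2)) (use Add.prems in auto)
  ultimately show ?case by simp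
next
  case (Sub a b)
  have "eval I a R = eval I a R'" by (rule Sub.IH(1)) (use Sub.prems in auto)
  moreover have "eval I b R = eval I b R'" by (rule Sub.IH(2)) (use Sub.prems in auto)
  ultimately show ?case by simp
next
  case (Bit j a)
  have "eval I a R = eval I a R'" by (rule Bit.IH) (use Bit.prems in auto)
  then show ?case by simp
qed auto

lemma eval_cong: "wf_exp v e \<Longrightarrow> (\<And>j. j < v \<Longrightarrow> R j = R' j) \<Longrightarrow> eval I e R = eval I e R'"
  by (rule eval_cong_fresh) (auto simp: wf_exp_def)

text \<open>One function bounds both the value and the running time, since the time of an enclosing
  loop depends on the values that it counts down.\<close>

definition exp_bound :: "nat \<Rightarrow> exp \<Rightarrow> (nat \<Rightarrow> nat) \<Rightarrow> bool" where
  "exp_bound v e f \<longleftrightarrow> (\<forall>K I d R y N. v \<le> d \<longrightarrow> d + width e \<le> K \<longrightarrow> 2 \<le> d \<longrightarrow> (\<forall>j\<ge>d. R j = 0) \<longrightarrow>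
     R 0 = 0 \<longrightarrow> R 1 = 0 \<longrightarrow> (\<forall>j<v. R j \<le> N) \<longrightarrow>
     eval I e R \<le> f N \<and> runs K I (com_exp e d) y R (f N) y (R(d := eval I e R)))"

lemma exp_boundD:
  assumes "exp_bound v e f" "v \<le> d" "d + width e \<le> K" "2 \<le> d" "\<And>j. d \<le> j \<Longrightarrow> R j = 0"
    "R 0 = 0" "R 1 = 0" "\<And>j. j < v \<Longrightarrow> R j \<le> N"
  shows "eval I e R \<le> f N \<and> runs K I (com_exp e d) y R (f N) y (R(d := eval I e R))"
  using assms unfolding exp_bound_def by blast

lemma exp_bound_pair:
  assumes "exp_bound v a f" "exp_bound v b g" "wf_exp v b" "v \<le> d" "d + width a + width b + 1 \<le> K" "2 \<le> d"
    "\<And>j. d \<le> j \<Longrightarrow> R j = 0" "R 0 = 0" "R 1 = 0" "\<And>j. j < v \<Longrightarrow> R j \<le> N"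
  shows "eval I a R \<le> f N \<and> eval I b R \<le> g N \<and>
    runs K I (com_exp a d ;; com_exp b (d + 1)) y R (f N + g N) y (R(d := eval I a R, d + 1 := eval I b R))"
proof -
  let ?R = "R(d := eval I a R)"
  have 1: "eval I a R \<le> f N \<and> runs K I (com_exp a d) y R (f N) y ?R"
    by (rule exp_boundD[OF assms(1)]) (use assms in auto)
  have 2: "eval I b ?R \<le> g N \<and> runs K I (com_exp b (d + 1)) y ?R (g N) y (?R(d + 1 := eval I b ?R))"
    by (rule exp_boundD[OF assms(2)]) (use assms in auto)
  have "eval I b ?R = eval I b R" using assms by (intro eval_cong[of v]) auto
  with 1 2 runs_Seq[OF 1[THEN conjunct2] 2[THEN conjunct2]] show ?thesis by simp
qed

lemma runs_exp: "wf_exp v e \<Longrightarrow> \<exists>f. poly_fun f \<and> exp_bound v e f"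
proof (induction e)
  case (Const c)
  have 1: "runs K I (((\<lambda>p. p ;; inc d) ^^ c) SKIP) y R c y (R(d := c))" if "d < K" "R d = 0" for K I d y R
  proof (induction c)
    case 0
    show ?case using that runs_SKIP by (simp add: fun_upd_idem)
  next
    case (Suc c)
    have "(R(d := c))(d := Suc ((R(d := c)) d)) = R(d := Suc c)" by simp
    then have "runs K I (inc d) y (R(d := c)) 1 y (R(d := Suc c))"
      using runs_inc[OF that(1), of I y "R(d := c)"] by (simp only:)
    from runs_Seq[OF Suc this] show ?case by (simp only: funpow.simps o_apply add_Suc_right Nat.add_0_right One_nat_def)
  qed
  have "exp_bound v (Const c) (\<lambda>_. c)"
    unfolding exp_bound_def by (simp add: 1)
  then show ?case by blast
next
  case (Var i)
  have "exp_bound v (Var i) (\<lambda>N. N * 9 + 2)"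
    unfolding exp_bound_def
  proof (intro allI impI conjI)
    fix K I d and R :: regs and y N
    assume *: "v \<le> d" "d + width (Var i) \<le> K" "2 \<le> d" "\<forall>j\<ge>d. R j = 0" "R 0 = 0" "R 1 = 0" "\<forall>j<v. R j \<le> N"
    then have "R i \<le> N" using Var by (simp add: wf_exp_def)
    then show "eval I (Var i) R \<le> N * 9 + 2" by simp
    have "runs K I (com_exp (Var i) d) y R (R i * 9 + 2) y (R(d := R i))"
      unfolding com_exp.simps by (rule runs_copy) (use * Var in \<open>auto simp: wf_exp_def\<close>)
    then show "runs K I (com_exp (Var i) d) y R (N * 9 + 2) y (R(d := eval I (Var i) R))"
      using \<open>R i \<le> N\<close> by (auto elim: runs_mono)
  qed
  then show ?case by blast
next
  case (Add a b)
  then obtain f g where f: "poly_fun f" "exp_bound v a f" and g: "poly_fun g" "exp_bound v b g"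
    by (auto simp: wf_exp_def)
  have "exp_bound v (Add a b) (\<lambda>N. f N + g N * 5 + 1)"
    unfolding exp_bound_def
  proof (intro allI impI)
    fix K I d and R :: regs and y N
    assume *: "v \<le> d" "d + width (Add a b) \<le> K" "2 \<le> d" "\<forall>j\<ge>d. R j = 0" "R 0 = 0" "R 1 = 0" "\<forall>j<v. R j \<le> N"
    let ?Q = "R(d := eval I a R, d + 1 := eval I b R)"
    have "eval I a R \<le> f N \<and> eval I b R \<le> g N \<and>
        runs K I (com_exp a d ;; com_exp b (d + 1)) y R (f N + g N) y ?Q"
      by (rule exp_bound_pair[OF f(2) g(2)]) (use * Add.prems in \<open>auto simp: wf_exp_def\<close>)
    then have a: "eval I a R \<le> f N" and b: "eval I b R \<le> g N"
      and ab: "runs K I (com_exp a d ;; com_exp b (d + 1)) y R (f N + g N) y ?Q" by auto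
    have c: "runs K I (loop (d + 1) (inc d)) y ?Q (?Q (d + 1) * 4 + 1) y (?Q(d := ?Q d + ?Q (d + 1), d + 1 := 0))"
      using * by (intro runs_move) auto
    have Q: "?Q(d := ?Q d + ?Q (d + 1), d + 1 := 0) = R(d := eval I (Add a b) R)"
      using * by (auto simp: fun_eq_iff)
    have "runs K I (com_exp (Add a b) d) y R (f N + g N * 5 + 1) y (R(d := eval I (Add a b) R))"
      unfolding com_exp.simps
      by (rule runs_mono[OF runs_Seq[OF ab c[unfolded Q]]]) (use b in auto)
    then show "eval I (Add a b) R \<le> f N + g N * 5 + 1 \<and>
        runs K I (com_exp (Add a b) d) y R (f N + g N * 5 + 1) y (R(d := eval I (Add a b) R))"
      using a b by auto
  qed
  moreover have "poly_fun (\<lambda>N. f N + g N * 5 + 1)"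
    by (intro poly_fun_add poly_fun_mult poly_fun_const f(1) g(1))
  ultimately show ?case by blast
next
  case (Sub a b)
  then obtain f g where f: "poly_fun f" "exp_bound v a f" and g: "poly_fun g" "exp_bound v b g"
    by (auto simp: wf_exp_def)
  have "exp_bound v (Sub a b) (\<lambda>N. f N + g N * 7 + 1)"
    unfolding exp_bound_def
  proof (intro allI impI)
    fix K I d and R :: regs and y N
    assume *: "v \<le> d" "d + width (Sub a b) \<le> K" "2 \<le> d" "\<forall>j\<ge>d. R j = 0" "R 0 = 0" "R 1 = 0" "\<forall>j<v. R j \<le> N"
    let ?Q = "R(d := eval I a R, d + 1 := eval I b R)"
    have "eval I a R \<le> f N \<and> eval I b R \<le> g N \<and>
        runs K I (com_exp a d ;; com_exp b (d + 1)) y R (f N + g N) y ?Q"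
      by (rule exp_bound_pair[OF f(2) g(2)]) (use * Sub.prems in \<open>auto simp: wf_exp_def\<close>)
    then have a: "eval I a R \<le> f N" and b: "eval I b R \<le> g N"
      and ab: "runs K I (com_exp a d ;; com_exp b (d + 1)) y R (f N + g N) y ?Q" by auto
    have c: "runs K I (loop (d + 1) (IfEq (Suc d) 3 SKIP (dec d))) y ?Q (eval I b R * ((1 + 2) + 3) + 1) y
        (R(d := eval I (Sub a b) R))"
    proof (rule runs_loop[where S = "\<lambda>m. R(d := eval I a R - m, d + 1 := eval I b R - m)" and Y = "\<lambda>_. y"])
      fix m assume m: "m < eval I b R"
      let ?P = "(R(d := eval I a R - m, d + 1 := eval I b R - m))(d + 1 := eval I b R - Suc m)"
      let ?P' = "R(d := eval I a R - Suc m, d + 1 := eval I b R - Suc m)"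
      show "runs K I (IfEq (Suc d) 3 SKIP (dec d)) y ?P (1 + 2) y ?P'"
      proof (rule runs_IfEq)
        assume "marked (I d) (int (?P d)) = 3"
        then have "?P = ?P'" by (auto simp: fun_eq_iff)
        then show "runs K I SKIP y ?P 1 y ?P'" using runs_mono[OF runs_SKIP] by auto
      next
        assume "marked (I d) (int (?P d)) \<noteq> 3"
        then have "?P d = Suc (eval I a R - Suc m)" by auto
        then have "runs K I (dec d) y ?P 1 y (?P(d := eval I a R - Suc m))"
          using * by (intro runs_dec) auto
        moreover have "?P(d := eval I a R - Suc m) = ?P'" by (auto simp: fun_eq_iff)
        ultimately show "runs K I (dec d) y ?P 1 y ?P'" by simp
      qed (use * in auto)
    qed (use * in \<open>auto simp: fun_eq_iff\<close>)
    have "runs K I (com_exp (Sub a b) d) y R (f N + g N * 7 + 1) y (R(d := eval I (Sub a b) R))"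
      unfolding com_exp.simps
      by (rule runs_mono[OF runs_Seq[OF ab c]]) (use b in auto)
    then show "eval I (Sub a b) R \<le> f N + g N * 7 + 1 \<and>
        runs K I (com_exp (Sub a b) d) y R (f N + g N * 7 + 1) y (R(d := eval I (Sub a b) R))"
      using a b by auto
  qed
  moreover have "poly_fun (\<lambda>N. f N + g N * 7 + 1)"
    by (intro poly_fun_add poly_fun_mult poly_fun_const f(1) g(1))
  ultimately show ?case by blast
next
  case (Bit j a)
  then obtain f where f: "poly_fun f" "exp_bound v a f" by (auto simp: wf_exp_def)
  have j: "j < 2" using Bit by (simp add: wf_exp_def)
  have "exp_bound v (Bit j a) (\<lambda>N. f N * 8 + 20)"
    unfolding exp_bound_def
  proof (intro allI impI)
    fix K I d and R :: regs and y N
    assume *: "v \<le> d" "d + width (Bit j a) \<le> K" "2 \<le> d" "\<forall>j\<ge>d. R j = 0" "R 0 = 0" "R 1 = 0" "\<forall>j<v. R j \<le> N"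
    have Rj: "R j = 0" using j * by (auto simp: less_2_cases_iff)
    have jd: "j < d" "j < K" "d < K" using j * by auto
    let ?a = "eval I a R" and ?r = "eval I (Bit j a) R"
    have "?a \<le> f N \<and>
        runs K I (com_exp a d) y R (f N) y (R(d := ?a))"
      by (rule exp_boundD[OF f(2)]) (use * in auto)
    then have a: "?a \<le> f N" "runs K I (com_exp a d) y R (f N) y (R(d := ?a))" by auto
    have b: "runs K I (inc j) y (R(d := ?a)) 1 y (R(d := ?a, j := 1))"
      using runs_inc[of j K I y "R(d := ?a)"] jd Rj by simp
    have c: "runs K I (loop d (inc j)) y (R(d := ?a, j := 1)) (?a * 4 + 1) y (R(d := 0, j := Suc ?a))"
      using runs_move[of d K j I y "R(d := ?a, j := 1)"] jd by (simp add: fun_upd_twist)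
    \<comment> \<open>Bit \<open>?a\<close> of the string lies in cell \<open>1 + ?a\<close>; the
      symbol \<open>2\<close> stands for \<open>True\<close>, and beyond the string there are
      blanks.\<close>
    have m: "marked (I j) (1 + int ?a) = 2 \<longleftrightarrow> ?a < length (I j) \<and> I j ! ?a"
      by (auto simp: marked_def bit_symbol_def)
    have d: "runs K I (IfEq (Suc j) 2 (inc d) SKIP) y (R(d := 0, j := Suc ?a)) (1 + 2) y (R(d := ?r, j := Suc ?a))"
    proof (rule runs_IfEq)
      assume "marked (I j) (int ((R(d := 0, j := Suc ?a)) j)) = 2"
      then show "runs K I (inc d) y (R(d := 0, j := Suc ?a)) 1 y (R(d := ?r, j := Suc ?a))"
        using runs_inc[of d K I y "R(d := 0, j := Suc ?a)"] jd m by (simp add: fun_upd_twist)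
    next
      assume "marked (I j) (int ((R(d := 0, j := Suc ?a)) j)) \<noteq> 2"
      then show "runs K I SKIP y (R(d := 0, j := Suc ?a)) 1 y (R(d := ?r, j := Suc ?a))"
        using m by (intro runs_mono[OF runs_SKIP[THEN back_subst[of "runs K I SKIP y _ 0 y"]]]) auto
    qed (use jd in auto)
    have e: "runs K I (loop j SKIP) y (R(d := ?r, j := Suc ?a)) (Suc ?a * 3 + 1) y (R(d := ?r))"
      using runs_clear[of j K I y "R(d := ?r, j := Suc ?a)"] jd Rj
      by (simp add: fun_upd_twist fun_upd_idem)
    have "runs K I (com_exp (Bit j a) d) y R (f N * 8 + 20) y (R(d := ?r))"
      unfolding com_exp.simps
      by (rule runs_mono[OF runs_Seq[OF runs_Seq[OF runs_Seq[OF runs_Seq[OF a(2) b] c] d] e]]) (use a(1) in auto)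
    then show "?r \<le> f N * 8 + 20 \<and> runs K I (com_exp (Bit j a) d) y R (f N * 8 + 20) y (R(d := ?r))"
      by auto
  qed
  moreover have "poly_fun (\<lambda>N. f N * 8 + 20)" by (intro poly_fun_add poly_fun_mult poly_fun_const f(1))
  ultimately show ?case by blast
next
  case (Sum i a b)
  then obtain f g where f: "poly_fun f" "exp_bound v a f" and g: "poly_fun g" "exp_bound v b g"
    by (auto simp: wf_exp_def)
  have i: "2 \<le> i" "i < v" and wf: "wf_exp v a" "wf_exp v b" using Sum.prems by (auto simp: wf_exp_def)
  \<comment> \<open>In the body the bound variable ranges below \<open>f N\<close>, so the registers
    are bounded by \<open>N + f N\<close> there, and polynomials are closed under this composition.
    The remaining terms pay for the loop itself.\<close>
  define h where "h N = f N * (g (N + f N) * 5 + 8) + f N * 4 + N * 8 + 10" for N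
  have "exp_bound v (Sum i a b) h"
    unfolding exp_bound_def
  proof (intro allI impI)
    fix K I d and R :: regs and y N
    assume *: "v \<le> d" "d + width (Sum i a b) \<le> K" "2 \<le> d" "\<forall>j\<ge>d. R j = 0" "R 0 = 0" "R 1 = 0" "\<forall>j<v. R j \<le> N"
    have K: "d < K" "d + 1 < K" "d + 2 < K" "d + 3 < K" "i < K" "i < d" using * i by auto
    have Ri: "R i \<le> N" using * i by auto
    let ?n = "eval I a R" and ?g = "g (N + f N)"
    define s where "s m = (\<Sum>z<m. eval I b (R(i := z)))" for m
    let ?R = "R(d + 1 := ?n)"
    have "?n \<le> f N \<and> runs K I (com_exp a (d + 1)) y R (f N) y ?R"
      by (rule exp_boundD[OF f(2)]) (use * in auto)
    then have a: "?n \<le> f N" "runs K I (com_exp a (d + 1)) y R (f N) y ?R" by auto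
    define S where "S m = R(d := s m, d + 1 := ?n)" for m
    have step: "eval I b (R(i := m)) \<le> ?g"
      "runs K I (com_exp b (d + 3) ;; loop (d + 3) (inc d)) y ((S m)(i := m, d + 1 := ?n - Suc m, d + 2 := R i))
        (?g * 5 + 1) y ((S (Suc m))(i := m, d + 1 := ?n - Suc m, d + 2 := R i))" if m: "m < ?n" for m
    proof -
      let ?P = "(S m)(i := m, d + 1 := ?n - Suc m, d + 2 := R i)"
      let ?e = "eval I b (R(i := m))"
      have "eval I b ?P \<le> ?g \<and> runs K I (com_exp b (d + 3)) y ?P ?g y (?P(d + 3 := eval I b ?P))"
        by (rule exp_boundD[OF g(2)]) (use * i m a(1) Ri in \<open>auto simp: S_def trans_le_add1\<close>)
      moreover have "eval I b ?P = ?e"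
        using * wf by (intro eval_cong[of v]) (auto simp: S_def)
      ultimately have 1: "?e \<le> ?g" "runs K I (com_exp b (d + 3)) y ?P ?g y (?P(d + 3 := ?e))" by auto
      let ?Q = "?P(d + 3 := ?e)"
      have "?Q(d := ?Q d + ?Q (d + 3), d + 3 := 0) = (S (Suc m))(i := m, d + 1 := ?n - Suc m, d + 2 := R i)"
        using K * by (auto simp: fun_eq_iff S_def s_def)
      then have "runs K I (loop (d + 3) (inc d)) y ?Q (?e * 4 + 1) y ((S (Suc m))(i := m, d + 1 := ?n - Suc m, d + 2 := R i))"
        using runs_move[of "d + 3" K d I y ?Q] K by simp
      from runs_Seq[OF 1(2) this] 1(1) show "?e \<le> ?g"
        "runs K I (com_exp b (d + 3) ;; loop (d + 3) (inc d)) y ?P (?g * 5 + 1) y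
          ((S (Suc m))(i := m, d + 1 := ?n - Suc m, d + 2 := R i))"
        by (auto elim!: runs_mono)
    qed
    have "runs K I (for_com i (d + 1) (d + 2) (com_exp b (d + 3) ;; loop (d + 3) (inc d))) y ?R
        (?R (d + 1) * ((?g * 5 + 1) + 7) + ?R i * 8 + 4) y ((S (?R (d + 1)))(i := ?R i, d + 1 := 0, d + 2 := 0))"
    proof (rule runs_for_com[where Y = "\<lambda>_. y"])
      have R': "?R (d + 1) = ?n" "?R i = R i" using K by auto
      show "runs K I (com_exp b (d + 3) ;; loop (d + 3) (inc d)) y ((S m)(i := m, d + 1 := ?R (d + 1) - Suc m, d + 2 := ?R i))
          (?g * 5 + 1) y ((S (Suc m))(i := m, d + 1 := ?R (d + 1) - Suc m, d + 2 := ?R i))" if "m < ?R (d + 1)" for m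
        using step(2)[of m] that unfolding R' by simp
      show "S 0 = ?R" using * by (auto simp: S_def s_def fun_eq_iff)
    qed (use K * in auto)
    moreover have "(S (?R (d + 1)))(i := ?R i, d + 1 := 0, d + 2 := 0) = R(d := eval I (Sum i a b) R)"
      using K * by (auto simp: fun_eq_iff S_def s_def)
    ultimately have b: "runs K I (for_com i (d + 1) (d + 2) (com_exp b (d + 3) ;; loop (d + 3) (inc d))) y ?R
        (?n * (?g * 5 + 8) + R i * 8 + 4) y (R(d := eval I (Sum i a b) R))"
      using K by (simp add: ac_simps)
    have n: "?n * (?g * 5 + 8) \<le> f N * (?g * 5 + 8)" using a(1) by (rule mult_le_mono1)
    have "(\<Sum>z<?n. eval I b (R(i := z))) \<le> ?n * ?g"
      using sum_bounded_above[of "{..<?n}" "\<lambda>z. eval I b (R(i := z))" ?g] step(1) by simp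
    also have "\<dots> \<le> ?n * (?g * 5 + 8)" by (rule mult_le_mono2) simp
    finally have "eval I (Sum i a b) R \<le> h N" using n unfolding h_def eval.simps by linarith
    moreover have "runs K I (com_exp (Sum i a b) d) y R (h N) y (R(d := eval I (Sum i a b) R))"
      unfolding com_exp.simps h_def by (rule runs_mono[OF runs_Seq[OF a(2) b]]) (use n Ri in linarith)
    ultimately show "eval I (Sum i a b) R \<le> h N \<and>
        runs K I (com_exp (Sum i a b) d) y R (h N) y (R(d := eval I (Sum i a b) R))" ..
  qed
  moreover have "poly_fun h"
  proof -
    have "poly_fun (\<lambda>N. g (N + f N))" by (intro poly_fun_compose[OF g(1)] poly_fun_add poly_fun_ident f(1))
    then show ?thesis unfolding h_def[abs_def] by (intro poly_fun_add poly_fun_mult poly_fun_const poly_fun_ident f(1))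
  qed
  ultimately show ?case by blast
qed

section \<open>Output programs and guessing\<close>

text \<open>An expression yields a number; a program yields a bit string of polynomial length by
  nested bounded loops. That is enough to print a graph whose adjacency is given by an
  expression.\<close>

datatype prog =
    Out exp
  | Then prog prog
  | For nat exp prog

fun out :: "(nat \<Rightarrow> bool list) \<Rightarrow> prog \<Rightarrow> regs \<Rightarrow> bool list" where
  "out I (Out e) R = [eval I e R \<noteq> 0]"
| "out I (Then p q) R = out I p R @ out I q R"
| "out I (For i a p) R = concat (map (\<lambda>z. out I p (R(i := z))) [0..<eval I a R])"

fun wf_prog :: "nat \<Rightarrow> prog \<Rightarrow> bool" where
  "wf_prog v (Out e) = wf_exp v e"
| "wf_prog v (Then p q) = (wf_prog v p \<and> wf_prog v q)"
| "wf_prog v (For i a p) = (2 \<le> i \<and> i < v \<and> wf_exp v a \<and> wf_prog v p)"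

fun prog_width :: "prog \<Rightarrow> nat" where
  "prog_width (Out e) = width e + 1"
| "prog_width (Then p q) = prog_width p + prog_width q"
| "prog_width (For i a p) = width a + prog_width p + 2"

fun com_prog :: "prog \<Rightarrow> nat \<Rightarrow> com" where
  "com_prog (Out e) d =
     ((com_exp e d ;; IfEq (Suc d) 3 (Wr 0 1 ;; Mv 0 Move_Right) (Wr 0 2 ;; Mv 0 Move_Right)) ;; loop d SKIP)"
| "com_prog (Then p q) d = (com_prog p d ;; com_prog q d)"
| "com_prog (For i a p) d = (com_exp a d ;; for_com i d (d + 1) (com_prog p (d + 2)))"

lemma out_cong: "wf_prog v p \<Longrightarrow> (\<And>j. j < v \<Longrightarrow> R j = R' j) \<Longrightarrow> out I p R = out I p R'"
proof (induction p arbitrary: R R')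
  case (Out e)
  have "eval I e R = eval I e R'" by (rule eval_cong) (use Out in auto)
  then show ?case by simp
next
  case (Then p q)
  have "out I p R = out I p R'" by (rule Then.IH(1)) (use Then.prems in auto)
  moreover have "out I q R = out I q R'" by (rule Then.IH(2)) (use Then.prems in auto)
  ultimately show ?case by simp
next
  case (For i a p)
  have "eval I a R = eval I a R'" by (rule eval_cong) (use For.prems in auto)
  moreover have "out I p (R(i := z)) = out I p (R'(i := z))" for z
    by (rule For.IH) (use For.prems in auto)
  ultimately show ?case by simp
qed

lemma input_tape_snoc:
  "(fst (input_tape y))(int (length y) := bit_symbol b) = fst (input_tape (y @ [b]))"
  by (auto simp: input_tape_def fun_eq_iff nth_append)

lemma runs_emit:
  assumes "a = bit_symbol b"
  shows "runs K I (Wr 0 a ;; Mv 0 Move_Right) y R 2 (y @ [b]) R"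
proof -
  let ?c = "fst (input_tape y)" and ?n = "int (length y)"
  let ?ts = "map (\<lambda>j. (marked (I j), int (R j))) [0..<K]"
  have 1: "exec (Wr 0 a) ((?c, ?n) # ?ts) 1 ((?c(?n := a), ?n) # ?ts)"
    using exec.Wr[of 0 "(?c, ?n) # ?ts" a] assms by (simp add: bit_symbol_def)
  have 2: "exec (Mv 0 Move_Right) ((?c(?n := a), ?n) # ?ts) 1 ((?c(?n := a), ?n + 1) # ?ts)"
    using exec.Mv[of 0 "(?c(?n := a), ?n) # ?ts" Move_Right] by simp
  have "exec (Wr 0 a ;; Mv 0 Move_Right) (reg_tapes K I y R) (1 + 1) (reg_tapes K I (y @ [b]) R)"
    using exec.Seq[OF 1 2] unfolding reg_tapes_def assms input_tape_snoc by (simp add: add.commute)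
  then show ?thesis unfolding runs_def by (intro exI[of _ "1 + 1"]) auto
qed

definition prog_bound :: "nat \<Rightarrow> prog \<Rightarrow> (nat \<Rightarrow> nat) \<Rightarrow> bool" where
  "prog_bound v p f \<longleftrightarrow> (\<forall>K I d R y N. v \<le> d \<longrightarrow> d + prog_width p \<le> K \<longrightarrow> 2 \<le> d \<longrightarrow> (\<forall>j\<ge>d. R j = 0) \<longrightarrow>
     R 0 = 0 \<longrightarrow> R 1 = 0 \<longrightarrow> (\<forall>j<v. R j \<le> N) \<longrightarrow>
     runs K I (com_prog p d) y R (f N) (y @ out I p R) R)"

lemma prog_boundD:
  assumes "prog_bound v p f" "v \<le> d" "d + prog_width p \<le> K" "2 \<le> d" "\<And>j. d \<le> j \<Longrightarrow> R j = 0"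
    "R 0 = 0" "R 1 = 0" "\<And>j. j < v \<Longrightarrow> R j \<le> N"
  shows "runs K I (com_prog p d) y R (f N) (y @ out I p R) R"
  using assms unfolding prog_bound_def by blast

lemma runs_prog: "wf_prog v p \<Longrightarrow> \<exists>f. poly_fun f \<and> prog_bound v p f"
proof (induction p)
  case (Out e)
  then obtain f where f: "poly_fun f" "exp_bound v e f" using runs_exp[of v e] by auto
  have "prog_bound v (Out e) (\<lambda>N. f N * 4 + 5)"
    unfolding prog_bound_def
  proof (intro allI impI)
    fix K I d and R :: regs and y N
    assume *: "v \<le> d" "d + prog_width (Out e) \<le> K" "2 \<le> d" "\<forall>j\<ge>d. R j = 0" "R 0 = 0" "R 1 = 0" "\<forall>j<v. R j \<le> N"
    have "eval I e R \<le> f N \<and> runs K I (com_exp e d) y R (f N) y (R(d := eval I e R))"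
      by (rule exp_boundD[OF f(2)]) (use * in auto)
    then have a: "eval I e R \<le> f N" "runs K I (com_exp e d) y R (f N) y (R(d := eval I e R))" by auto
    let ?R = "R(d := eval I e R)" and ?y = "y @ [eval I e R \<noteq> 0]"
    have b: "runs K I (IfEq (Suc d) 3 (Wr 0 1 ;; Mv 0 Move_Right) (Wr 0 2 ;; Mv 0 Move_Right)) y ?R (2 + 2) ?y ?R"
      by (rule runs_IfEq; (rule runs_emit)?) (use * in \<open>auto simp: bit_symbol_def\<close>)
    have c: "runs K I (loop d SKIP) ?y ?R (eval I e R * 3 + 1) ?y R"
      using runs_clear[of d K I ?y ?R] * by (simp add: fun_upd_idem)
    show "runs K I (com_prog (Out e) d) y R (f N * 4 + 5) (y @ out I (Out e) R) R"
      unfolding com_prog.simps out.simps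
      by (rule runs_mono[OF runs_Seq[OF runs_Seq[OF a(2) b] c]]) (use a(1) in auto)
  qed
  moreover have "poly_fun (\<lambda>N. f N * 4 + 5)" by (intro poly_fun_add poly_fun_mult poly_fun_const f(1))
  ultimately show ?case by blast
next
  case (Then p q)
  then obtain f g where f: "poly_fun f" "prog_bound v p f" and g: "poly_fun g" "prog_bound v q g" by auto
  have "prog_bound v (Then p q) (\<lambda>N. f N + g N)"
    unfolding prog_bound_def
  proof (intro allI impI)
    fix K I d and R :: regs and y N
    assume *: "v \<le> d" "d + prog_width (Then p q) \<le> K" "2 \<le> d" "\<forall>j\<ge>d. R j = 0" "R 0 = 0" "R 1 = 0" "\<forall>j<v. R j \<le> N"
    have a: "runs K I (com_prog p d) y R (f N) (y @ out I p R) R"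
      by (rule prog_boundD[OF f(2)]) (use * in auto)
    have b: "runs K I (com_prog q d) (y @ out I p R) R (g N) ((y @ out I p R) @ out I q R) R"
      by (rule prog_boundD[OF g(2)]) (use * in auto)
    show "runs K I (com_prog (Then p q) d) y R (f N + g N) (y @ out I (Then p q) R) R"
      using runs_Seq[OF a b] by simp
  qed
  moreover have "poly_fun (\<lambda>N. f N + g N)" by (intro poly_fun_add f(1) g(1))
  ultimately show ?case by blast
next
  case (For i a p)
  then obtain g where g: "poly_fun g" "prog_bound v p g" by auto
  obtain f where f: "poly_fun f" "exp_bound v a f" using runs_exp[of v a] For.prems by auto
  have i: "2 \<le> i" "i < v" and wf: "wf_exp v a" "wf_prog v p" using For.prems by auto
  define h where "h N = f N * (g (N + f N) + 7) + f N + N * 8 + 10" for N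
  have "prog_bound v (For i a p) h"
    unfolding prog_bound_def
  proof (intro allI impI)
    fix K I d and R :: regs and y N
    assume *: "v \<le> d" "d + prog_width (For i a p) \<le> K" "2 \<le> d" "\<forall>j\<ge>d. R j = 0" "R 0 = 0" "R 1 = 0" "\<forall>j<v. R j \<le> N"
    have K: "d < K" "d + 1 < K" "i < K" "i < d" using * i by auto
    have Ri: "R i \<le> N" using * i by auto
    let ?n = "eval I a R" and ?g = "g (N + f N)"
    have "?n \<le> f N \<and> runs K I (com_exp a d) y R (f N) y (R(d := ?n))"
      by (rule exp_boundD[OF f(2)]) (use * in auto)
    then have a: "?n \<le> f N" "runs K I (com_exp a d) y R (f N) y (R(d := ?n))" by auto
    let ?R = "R(d := ?n)"
    define Y where "Y m = y @ concat (map (\<lambda>z. out I p (R(i := z))) [0..<m])" for m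
    have "runs K I (for_com i d (d + 1) (com_prog p (d + 2))) y ?R
        (?R d * (?g + 7) + ?R i * 8 + 4) (Y (?R d)) (?R(i := ?R i, d := 0, d + 1 := 0))"
    proof (rule runs_for_com[where Y = Y and S = "\<lambda>_. ?R"])
      fix m assume m: "m < ?R d"
      let ?P = "?R(i := m, d := ?R d - Suc m, d + 1 := ?R i)"
      have "runs K I (com_prog p (d + 2)) (Y m) ?P ?g (Y m @ out I p ?P) ?P"
        by (rule prog_boundD[OF g(2)]) (use * i m a(1) Ri in \<open>auto simp: trans_le_add1\<close>)
      moreover have "out I p ?P = out I p (R(i := m))"
        using * wf by (intro out_cong[of v]) auto
      ultimately show "runs K I (com_prog p (d + 2)) (Y m) ?P ?g (Y (Suc m)) ?P" by (simp add: Y_def)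
    qed (use K * in \<open>auto simp: Y_def\<close>)
    moreover have "?R(i := ?R i, d := 0, d + 1 := 0) = R" using K * by (auto simp: fun_eq_iff)
    ultimately have b: "runs K I (for_com i d (d + 1) (com_prog p (d + 2))) y ?R
        (?n * (?g + 7) + R i * 8 + 4) (Y ?n) R"
      using K by simp
    have r: "Y ?n = y @ out I (For i a p) R" by (simp add: Y_def)
    have "?n * (?g + 7) \<le> f N * (?g + 7)" using a(1) by (rule mult_le_mono1)
    then show "runs K I (com_prog (For i a p) d) y R (h N) (y @ out I (For i a p) R) R"
      unfolding com_prog.simps r[symmetric] h_def by (intro runs_mono[OF runs_Seq[OF a(2) b]]) (use Ri in linarith)
  qed
  moreover have "poly_fun h"
  proof -
    have "poly_fun (\<lambda>N. g (N + f N))" by (intro poly_fun_compose[OF g(1)] poly_fun_add poly_fun_ident f(1))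
    then show ?thesis unfolding h_def[abs_def] by (intro poly_fun_add poly_fun_mult poly_fun_const poly_fun_ident f(1))
  qed
  ultimately show ?case by blast
qed

section \<open>Initialisation of the registers\<close>

definition inputs :: "bool list \<Rightarrow> bool list \<Rightarrow> nat \<Rightarrow> bool list" where
  "inputs x w = (\<lambda>_. [])(0 := x, 1 := w)"

definition env :: "bool list \<Rightarrow> bool list \<Rightarrow> regs" where
  "env x w = (\<lambda>_. 0)(2 := length x, 3 := length w)"

fun marks :: "nat \<Rightarrow> com" where
  "marks 0 = SKIP"
| "marks (Suc n) = (marks n ;; Wr (Suc n) 3)"

text \<open>Tape \<open>1\<close> is register \<open>0\<close>, which receives the input behind its
  mark; tape \<open>3\<close> is register \<open>2\<close>, which counts the length.\<close>

definition copy_loop :: com where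
  "copy_loop = Until 0 0 ((IfEq 0 2 (Wr 1 2) (Wr 1 1) ;; Mv 0 Move_Right) ;; (Mv 1 Move_Right ;; Mv 3 Move_Right))"

definition copy_input :: com where
  "copy_input = Mv 1 Move_Right ;; copy_loop"

text \<open>The input tape becomes the output tape, and an output ends at the first blank, so the
  input must be removed. The mark on tape \<open>1\<close> tells when all of it has been
  erased.\<close>

definition erase_input :: com where
  "erase_input = Mv 1 Move_Left ;; Until 1 3 ((Mv 0 Move_Left ;; Wr 0 0) ;; Mv 1 Move_Left)"

definition start_tapes :: "nat \<Rightarrow> (int \<Rightarrow> nat) \<Rightarrow> int \<Rightarrow> (int \<Rightarrow> nat) \<Rightarrow> int \<Rightarrow> int \<Rightarrow> tape list" where
  "start_tapes K c h c' h' r =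
     (c, h) # (c', h') # (marked [], 0) # (marked [], r) # replicate (K - 3) (marked [], 0)"

lemma marked_Nil: "marked [] = (\<lambda>_. 0)(0 := 3)"
  by (auto simp: marked_def fun_eq_iff)

lemma marked_upd_0 [simp]: "(marked x)(0 := 3) = marked x"
  by (auto simp: marked_def fun_eq_iff)

lemma input_tape_Nil: "input_tape [] = (\<lambda>_. 0, 0)"
  by (auto simp: input_tape_def)

lemma exec_marks:
  "n \<le> K \<Longrightarrow> exec (marks n) (tp # replicate K (input_tape [])) n
     (tp # replicate n (marked [], 0) @ replicate (K - n) (input_tape []))"
proof (induction n)
  case 0
  show ?case using exec.SKIP by simp
next
  case (Suc n)
  let ?ts = "tp # replicate n (marked [], 0) @ replicate (K - n) (input_tape [])"
  have "exec (Wr (Suc n) 3) ?ts 1 (?ts[Suc n := perform (3, Stay) (?ts ! Suc n)])"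
    using Suc.prems by (intro exec.Wr) auto
  moreover have "K - n = Suc (K - Suc n)" using Suc.prems by simp
  then have "?ts[Suc n := perform (3, Stay) (?ts ! Suc n)] =
      tp # replicate (Suc n) (marked [], 0) @ replicate (K - Suc n) (input_tape [])"
    by (simp add: nth_append list_update_append input_tape_Nil marked_Nil replicate_app_Cons_same)
  ultimately show ?case using exec.Seq[OF Suc.IH] Suc.prems by fastforce
qed

lemma marked_take_Suc:
  "m < length x \<Longrightarrow> (marked (take m x))(1 + int m := bit_symbol (x ! m)) = marked (take (Suc m) x)"
proof -
  assume m: "m < length x"
  have "nat (1 + int m) = Suc m" by simp
  then show ?thesis using m by (auto simp: marked_def fun_eq_iff)
qed

lemma input_tape_take_Suc:
  "m < length x \<Longrightarrow> (fst (input_tape (take (Suc m) x)))(int m := 0) = fst (input_tape (take m x))"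
  by (auto simp: input_tape_def fun_eq_iff)

lemma exec_copy_loop:
  assumes "m \<le> length x" "3 \<le> K"
  shows "\<exists>t\<le>m * 8 + 1. exec copy_loop
    (start_tapes K (fst (input_tape x)) (int (length x - m)) (marked (take (length x - m) x))
      (1 + int (length x - m)) (int (length x - m))) t
    (start_tapes K (fst (input_tape x)) (int (length x)) (marked x) (1 + int (length x)) (int (length x)))"
  using assms(1)
proof (induction m)
  case 0
  have "exec (Until 0 0 c) (start_tapes K (fst (input_tape x)) (int (length x)) c' h r) 1
    (start_tapes K (fst (input_tape x)) (int (length x)) c' h r)" for c c' h r
    by (rule exec.UntilT) (auto simp: start_tapes_def input_tape_def)
  then show ?case unfolding copy_loop_def by (intro exI[of _ 1]) simp
next
  case (Suc m)
  let ?l = "length x - Suc m"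
  let ?s = "\<lambda>h c' h' r. start_tapes K (fst (input_tape x)) h c' h' r"
  let ?b = "bit_symbol (x ! ?l)"
  have l: "?l < length x" "Suc ?l = length x - m" using Suc.prems by auto
  have "fst (input_tape x) (int l) = bit_symbol (x ! l)" if "l < length x" for l
    using that by (simp add: input_tape_def)
  from this[OF l(1)] have sym: "fst (input_tape x) (int ?l) = ?b" .
  let ?c = "marked (take ?l x)" and ?c' = "marked (take (Suc ?l) x)"
  have w: "exec (Wr 1 ?b) (?s (int ?l) ?c (1 + int ?l) (int ?l)) 1 (?s (int ?l) ?c' (1 + int ?l) (int ?l))"
    using exec.Wr[of 1 "?s (int ?l) ?c (1 + int ?l) (int ?l)" ?b] marked_take_Suc[OF l(1)]
    by (simp add: start_tapes_def bit_symbol_def)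
  have 1: "\<exists>t\<le>3. exec (IfEq 0 2 (Wr 1 2) (Wr 1 1)) (?s (int ?l) ?c (1 + int ?l) (int ?l)) t (?s (int ?l) ?c' (1 + int ?l) (int ?l))"
  proof (cases "x ! ?l")
    case True
    then have "exec (IfEq 0 2 (Wr 1 2) (Wr 1 1)) (?s (int ?l) ?c (1 + int ?l) (int ?l)) (1 + 2) (?s (int ?l) ?c' (1 + int ?l) (int ?l))"
      using w sym by (intro exec.IfT) (auto simp: bit_symbol_def start_tapes_def)
    then show ?thesis by (intro exI[of _ "1 + 2"]) auto
  next
    case False
    then have "exec (IfEq 0 2 (Wr 1 2) (Wr 1 1)) (?s (int ?l) ?c (1 + int ?l) (int ?l)) (1 + 1) (?s (int ?l) ?c' (1 + int ?l) (int ?l))"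
      using w sym by (intro exec.IfF) (auto simp: bit_symbol_def start_tapes_def)
    then show ?thesis by (intro exI[of _ "1 + 1"]) auto
  qed
  then obtain t where t: "t \<le> 3"
    "exec (IfEq 0 2 (Wr 1 2) (Wr 1 1)) (?s (int ?l) ?c (1 + int ?l) (int ?l)) t (?s (int ?l) ?c' (1 + int ?l) (int ?l))" by blast
  have 2: "exec (Mv 0 Move_Right) (?s h c h' r) 1 (?s (h + 1) c h' r)" for h c h' r
    using exec.Mv[of 0 "?s h c h' r" Move_Right] by (simp add: start_tapes_def)
  have 3: "exec (Mv 1 Move_Right) (?s h c h' r) 1 (?s h c (h' + 1) r)" for h c h' r
    using exec.Mv[of 1 "?s h c h' r" Move_Right] by (simp add: start_tapes_def)
  have 4: "exec (Mv 3 Move_Right) (?s h c h' r) 1 (?s h c h' (r + 1))" for h c h' r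
    using exec.Mv[of 3 "?s h c h' r" Move_Right] by (simp add: start_tapes_def numeral_3_eq_3)
  have e: "int ?l + 1 = int (length x - m)" "1 + int ?l + 1 = 1 + int (length x - m)"
    unfolding l(2)[symmetric] by auto
  from exec.Seq[OF exec.Seq[OF t(2) 2] exec.Seq[OF 3 4]]
  have body: "exec ((IfEq 0 2 (Wr 1 2) (Wr 1 1) ;; Mv 0 Move_Right) ;; (Mv 1 Move_Right ;; Mv 3 Move_Right))
     (?s (int ?l) ?c (1 + int ?l) (int ?l)) (t + 1 + (1 + 1))
     (?s (int (length x - m)) (marked (take (length x - m) x)) (1 + int (length x - m)) (int (length x - m)))"
    unfolding e l(2) .
  obtain u where u: "u \<le> m * 8 + 1" "exec copy_loop
     (?s (int (length x - m)) (marked (take (length x - m) x)) (1 + int (length x - m)) (int (length x - m))) u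
     (?s (int (length x)) (marked x) (1 + int (length x)) (int (length x)))"
    using Suc by auto
  have "exec copy_loop
     (?s (int ?l) ?c (1 + int ?l) (int ?l)) (t + 1 + (1 + 1) + u + 2)
     (?s (int (length x)) (marked x) (1 + int (length x)) (int (length x)))"
    unfolding copy_loop_def
    using sym by (intro exec.UntilF[OF _ _ body u(2)[unfolded copy_loop_def]]) (auto simp: start_tapes_def bit_symbol_def)
  then show ?case using t(1) u(1) by (intro exI[of _ "t + 1 + (1 + 1) + u + 2"]) auto
qed

lemma exec_erase_loop:
  assumes "m \<le> length x"
  shows "exec (Until 1 3 ((Mv 0 Move_Left ;; Wr 0 0) ;; Mv 1 Move_Left))
    (start_tapes K (fst (input_tape (take m x))) (int m) (marked x) (int m) r) (m * 5 + 1)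
    (start_tapes K (fst (input_tape [])) 0 (marked x) 0 r)"
  using assms
proof (induction m)
  case 0
  have "exec (Until 1 3 c) (start_tapes K c0 0 (marked x) 0 r) 1 (start_tapes K c0 0 (marked x) 0 r)" for c c0
    by (rule exec.UntilT) (auto simp: start_tapes_def)
  then show ?case by simp
next
  case (Suc m)
  let ?s = "\<lambda>c h h'. start_tapes K c h (marked x) h' r"
  let ?c = "fst (input_tape (take (Suc m) x))" and ?c' = "fst (input_tape (take m x))"
  have 1: "exec (Mv 0 Move_Left) (?s ?c (int (Suc m)) (int (Suc m))) 1 (?s ?c (int m) (int (Suc m)))"
    using exec.Mv[of 0 "?s ?c (int (Suc m)) (int (Suc m))" Move_Left] by (simp add: start_tapes_def)
  have 2: "exec (Wr 0 0) (?s ?c (int m) (int (Suc m))) 1 (?s ?c' (int m) (int (Suc m)))"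
    using exec.Wr[of 0 "?s ?c (int m) (int (Suc m))" 0] Suc.prems
      input_tape_take_Suc[of m x] by (simp add: start_tapes_def)
  have 3: "exec (Mv 1 Move_Left) (?s ?c' (int m) (int (Suc m))) 1 (?s ?c' (int m) (int m))"
    using exec.Mv[of 1 "?s ?c' (int m) (int (Suc m))" Move_Left] by (simp add: start_tapes_def)
  have "exec (Until 1 3 ((Mv 0 Move_Left ;; Wr 0 0) ;; Mv 1 Move_Left)) (?s ?c (int (Suc m)) (int (Suc m)))
      (1 + 1 + 1 + (m * 5 + 1) + 2) (?s (fst (input_tape [])) 0 0)"
    by (rule exec.UntilF[OF _ _ exec.Seq[OF exec.Seq[OF 1 2] 3] Suc.IH])
      (use Suc.prems in \<open>auto simp: start_tapes_def simp del: of_nat_Suc\<close>)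
  moreover have "1 + 1 + 1 + (m * 5 + 1) + 2 = Suc m * 5 + 1" by simp
  ultimately show ?case by (simp only:)
qed

definition init :: "nat \<Rightarrow> com" where
  "init K = (marks K ;; copy_input) ;; erase_input"

lemma exec_init:
  assumes "3 \<le> K"
  shows "\<exists>t\<le>length x * 13 + K + 4. exec (init K) (input_tape x # replicate K (input_tape [])) t
    (reg_tapes K (inputs x []) [] (env x []))"
proof -
  have 1: "exec (marks K) (input_tape x # replicate K (input_tape [])) K (input_tape x # replicate K (marked [], 0))"
    using exec_marks[of K K "input_tape x"] by simp
  obtain k where k: "K = Suc (Suc (Suc k))" by (rule that[of "K - 3"]) (use assms in simp)
  have 0: "input_tape x # replicate K (marked [], 0) = start_tapes K (fst (input_tape x)) 0 (marked []) 0 0"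
    by (simp add: start_tapes_def k input_tape_def)
  let ?c = "fst (input_tape x)" and ?n = "int (length x)"
  have 2: "exec (Mv 1 Move_Right) (start_tapes K ?c 0 (marked []) 0 0) 1 (start_tapes K ?c 0 (marked []) 1 0)"
    using exec.Mv[of 1 "start_tapes K ?c 0 (marked []) 0 0" Move_Right] by (simp add: start_tapes_def)
  obtain t where t: "t \<le> length x * 8 + 1" "exec copy_loop
     (start_tapes K ?c 0 (marked []) 1 0) t (start_tapes K ?c ?n (marked x) (1 + ?n) ?n)"
    using exec_copy_loop[OF order_refl assms, where x = x] by auto
  have 3: "exec (Mv 1 Move_Left) (start_tapes K ?c ?n (marked x) (1 + ?n) ?n) 1 (start_tapes K ?c ?n (marked x) ?n ?n)"
    using exec.Mv[of 1 "start_tapes K ?c ?n (marked x) (1 + ?n) ?n" Move_Left] by (simp add: start_tapes_def)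
  have 4: "exec (Until 1 3 ((Mv 0 Move_Left ;; Wr 0 0) ;; Mv 1 Move_Left)) (start_tapes K ?c ?n (marked x) ?n ?n)
     (length x * 5 + 1) (start_tapes K (fst (input_tape [])) 0 (marked x) 0 ?n)"
    using exec_erase_loop[OF order_refl, where x = x and K = K and r = ?n] by simp
  have 5: "start_tapes K (fst (input_tape [])) 0 (marked x) 0 ?n = reg_tapes K (inputs x []) [] (env x [])"
    by (rule nth_equalityI)
      (auto simp: start_tapes_def reg_tapes_def k inputs_def env_def nth_Cons' numeral_2_eq_2 numeral_3_eq_3 simp del: upt_Suc)
  have "exec (init K) (input_tape x # replicate K (input_tape [])) (K + (1 + t) + (1 + (length x * 5 + 1)))
    (reg_tapes K (inputs x []) [] (env x []))"
    unfolding init_def copy_input_def erase_input_def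
    by (rule exec.Seq[OF exec.Seq[OF 1[unfolded 0] exec.Seq[OF 2 t(2)]] exec.Seq[OF 3 4[unfolded 5]]])
  then show ?thesis using t(1) by (intro exI conjI) auto
qed

lemma tm_step_source: "tm_step M (q, ts) c \<Longrightarrow> q \<in> fst ` transitions M"
  by (auto elim!: tm_step.cases intro!: image_eqI[rotated])

theorem polytime_computable_out:
  assumes "wf_prog v p" "4 \<le> v"
  shows "polytime_computable (\<lambda>x. out (inputs x []) p (env x []))"
proof -
  obtain f where f: "poly_fun f" "prog_bound v p f" using runs_prog[OF assms(1)] by auto
  define K where "K = v + prog_width p"
  define c where "c = init K ;; com_prog p v"
  define M where "M = \<lparr>num_tapes = Suc K, start_state = 0, accept_state = 0, transitions = code (Suc K) c 0\<rparr>"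
  have "wf_tm M" using wf_transitions_code[of "Suc K" c 0]
    unfolding wf_tm_def M_def wf_transitions_def by auto
  moreover have "deterministic M" using functional_code[of "Suc K" c 0]
    unfolding deterministic_def M_def functional_def by simp
  moreover have "poly_fun (\<lambda>n. n * 13 + (K + 4) + f n)"
    using f(1) by (intro poly_fun_add poly_fun_mult poly_fun_const poly_fun_ident)
  then obtain q where q: "(\<lambda>n. n * 13 + (K + 4) + f n) = poly q" unfolding poly_fun_def by blast
  have "\<exists>t c. t \<le> poly q (length x) \<and> (tm_step M ^^ t) (initial_config M x) c \<and>
      halted M c \<and> has_output c (out (inputs x []) p (env x []))" for x
  proof -
    have "3 \<le> K" using assms K_def by simp
    then obtain t where t: "t \<le> length x * 13 + K + 4"
      "exec (init K) (input_tape x # replicate K (input_tape [])) t (reg_tapes K (inputs x []) [] (env x []))"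
      using exec_init by blast
    have "runs K (inputs x []) (com_prog p v) [] (env x []) (f (length x)) ([] @ out (inputs x []) p (env x [])) (env x [])"
      by (rule prog_boundD[OF f(2)]) (use assms in \<open>auto simp: K_def env_def\<close>)
    then obtain u where u: "u \<le> f (length x)" "exec (com_prog p v) (reg_tapes K (inputs x []) [] (env x [])) u
       (reg_tapes K (inputs x []) (out (inputs x []) p (env x [])) (env x []))"
      unfolding runs_def by auto
    have "tapes_ok (Suc K) (input_tape x # replicate K (input_tape []))"
      by (auto simp: tapes_ok_def input_tape_def bit_symbol_def)
    then have "(tm_step M ^^ (t + u)) (0, input_tape x # replicate K (input_tape []))
       (0 + code_size c, reg_tapes K (inputs x []) (out (inputs x []) p (env x [])) (env x []))"
      by (intro exec_sound[where k = "Suc K"]) (auto simp: c_def M_def intro: exec.Seq[OF t(2) u(2)])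
    moreover have "initial_config M x = (0, input_tape x # replicate K (input_tape []))"
      by (simp add: initial_config_def M_def)
    \<comment> \<open>The code occupies the states below \<open>code_size c\<close>, so none of its
      transitions starts in that state.\<close>
    moreover have "halted M (code_size c, ts)" for ts
      using sources_code[of "Suc K" c 0] tm_step_source[of M "code_size c" ts]
      unfolding halted_def M_def by fastforce
    moreover have "has_output (q, reg_tapes K I y R) y" for q I y R
      by (simp add: has_output_def reg_tapes_def input_tape_def)
    moreover have "t + u \<le> poly q (length x)"
      unfolding q[symmetric] using t(1) u(1) by simp
    ultimately show ?thesis
      by (intro exI[of _ "t + u"] exI[of _ "(code_size c, reg_tapes K (inputs x []) (out (inputs x []) p (env x [])) (env x []))"]) auto
  qed
  ultimately show ?thesis unfolding polytime_computable_def by blast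
qed

section \<open>Nondeterministic guessing of certificates\<close>

lemma relpowp_forced:
  fixes R R0 :: "'a \<Rightarrow> 'a \<Rightarrow> bool"
  assumes "\<And>x y z. R0 x y \<Longrightarrow> R x z \<Longrightarrow> z = y" "\<And>x y. R0 x y \<Longrightarrow> R x y" "\<And>z. \<not> R c z"
  shows "(R0 ^^ t) a b \<Longrightarrow> (R ^^ n) a c \<Longrightarrow> \<exists>m. (R ^^ m) b c"
proof (induction t arbitrary: a n)
  case 0
  then show ?case by auto
next
  case (Suc t)
  then obtain a' where a': "R0 a a'" "(R0 ^^ t) a' b" using relpowp_Suc_D2[OF Suc.prems(1)] by blast
  show ?case
  proof (cases n)
    case 0
    \<comment> \<open>The run cannot end before \<open>b\<close> is reached: \<open>c\<close> has no
      successor, whereas \<open>a\<close> has one.\<close>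
    then have "a = c" using Suc.prems(2) by simp
    then show ?thesis using assms(2,3) a'(1) by blast
  next
    case (Suc m)
    then obtain z where z: "R a z" "(R ^^ m) z c"
      using relpowp_Suc_D2[OF Suc.prems(2)[unfolded Suc]] by blast
    then have "z = a'" using assms(1) a'(1) by blast
    then show ?thesis using Suc.IH[OF a'(2)] z(2) by blast
  qed
qed

text \<open>In the source states of the deterministic fragment \<open>D\<close>, the machine has no
  transitions but those of \<open>D\<close>. With \<open>relpowp_forced\<close> it follows that an
  accepting run passes through the whole fragment.\<close>

lemma tm_step_restrict:
  assumes "functional D" "\<And>q rs q' as. (q, rs, q', as) \<in> transitions M \<Longrightarrow> q \<in> fst ` D \<Longrightarrow> (q, rs, q', as) \<in> D"
    "tm_step (M\<lparr>transitions := D\<rparr>) x y" "tm_step M x z"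
  shows "z = y"
proof -
  obtain q ts q1 as1 where 1: "x = (q, ts)" "y = (q1, map2 perform as1 ts)" "(q, map head_symbol ts, q1, as1) \<in> D"
    using assms(3) by (auto elim!: tm_step.cases)
  obtain q2 as2 where 2: "z = (q2, map2 perform as2 ts)" "(q, map head_symbol ts, q2, as2) \<in> transitions M"
    using assms(4) 1(1) by (auto elim!: tm_step.cases)
  have "(q, map head_symbol ts, q2, as2) \<in> D"
    using assms(2)[OF 2(2)] 1(3) by (metis fst_conv image_eqI)
  then show ?thesis using assms(1) 1 2 unfolding functional_def by blast
qed

lemma tm_step_mono: "D \<subseteq> transitions M \<Longrightarrow> tm_step (M\<lparr>transitions := D\<rparr>) x y \<Longrightarrow> tm_step M x y"
  by (auto elim!: tm_step.cases intro!: tm_step.intros)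

text \<open>Tape \<open>2\<close> is register \<open>1\<close>, which collects the certificate; tape
  \<open>4\<close> is register \<open>3\<close>, which counts its length.\<close>

definition guess_act :: "bool \<Rightarrow> nat list \<Rightarrow> action list" where
  "guess_act b rs = (keep rs)[2 := (bit_symbol b, Move_Right), 4 := (rs ! 4, Move_Right)]"

definition guess_code :: "nat \<Rightarrow> nat \<Rightarrow> transition set" where
  "guess_code k q = instr k q (\<lambda>_. q) (guess_act True) \<union> instr k q (\<lambda>_. q) (guess_act False) \<union>
     instr k q (\<lambda>_. q + 1) keep"

text \<open>During guessing, the head of register \<open>1\<close> stands on the first free cell
  behind the bits guessed so far; it returns to the mark before the evaluation.\<close>

definition guess_tapes :: "nat \<Rightarrow> bool list \<Rightarrow> bool list \<Rightarrow> tape list" where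
  "guess_tapes K x w = reg_tapes K (inputs x w) [] ((env x w)(1 := Suc (length w)))"

lemma marked_snoc: "(marked w)(1 + int (length w) := bit_symbol b) = marked (w @ [b])"
proof -
  have "nat (1 + int (length w)) = Suc (length w)" by simp
  then show ?thesis by (auto simp: marked_def fun_eq_iff nth_append)
qed

lemma guess_tapes_snoc:
  assumes "4 \<le> K"
  shows "map2 perform (guess_act b (map head_symbol (guess_tapes K x w))) (guess_tapes K x w) =
    guess_tapes K x (w @ [b])" (is "?l = ?r")
proof (rule nth_equalityI)
  show "length ?l = length ?r" by (simp add: guess_act_def keep_def guess_tapes_def)
  fix j assume j: "j < length ?l"
  then have jK: "j < Suc K" by (simp add: guess_act_def keep_def guess_tapes_def)
  show "?l ! j = ?r ! j"
  proof (cases j)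
    case 0
    then show ?thesis using jK assms
      by (simp add: guess_act_def keep_def guess_tapes_def nth_list_update)
  next
    case (Suc i)
    then have i: "i < K" using jK by simp
    show ?thesis
      using i assms unfolding Suc
      by (auto simp: guess_act_def keep_def guess_tapes_def nth_list_update inputs_def env_def marked_snoc eval_nat_numeral)
  qed
qed

lemma guess_step:
  assumes "4 \<le> K" "guess_code (Suc K) q \<subseteq> transitions M"
  shows "tm_step M (q, guess_tapes K x w) (q, guess_tapes K x (w @ [b]))"
    "tm_step M (q, guess_tapes K x w) (q + 1, guess_tapes K x w)"
proof -
  have ok: "tapes_ok (Suc K) (guess_tapes K x w)"
    unfolding guess_tapes_def by (rule tapes_ok_reg_tapes)
  have "instr (Suc K) q (\<lambda>_. q) (guess_act b) \<subseteq> transitions M"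
    using assms(2) unfolding guess_code_def by (cases b) auto
  from tm_step_instr[OF this ok refl]
  show "tm_step M (q, guess_tapes K x w) (q, guess_tapes K x (w @ [b]))"
    unfolding guess_tapes_snoc[OF assms(1)] .
  have "instr (Suc K) q (\<lambda>_. q + 1) keep \<subseteq> transitions M"
    using assms(2) unfolding guess_code_def by auto
  from tm_step_instr[OF this ok refl]
  show "tm_step M (q, guess_tapes K x w) (q + 1, guess_tapes K x w)" by simp
qed

lemma guess_steps:
  assumes "4 \<le> K" "guess_code (Suc K) q \<subseteq> transitions M"
  shows "(tm_step M ^^ length w) (q, guess_tapes K x []) (q, guess_tapes K x w)"
proof (induction w rule: rev_induct)
  case (snoc b w)
  then show ?case using guess_step(1)[OF assms, of x w b] by auto
qed simp

lemma guess_step_inv: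
  assumes "4 \<le> K" "\<And>rs q' as. (q, rs, q', as) \<in> transitions M \<Longrightarrow> (q, rs, q', as) \<in> guess_code (Suc K) q"
    "tm_step M (q, guess_tapes K x w) c"
  shows "(\<exists>b. c = (q, guess_tapes K x (w @ [b]))) \<or> c = (q + 1, guess_tapes K x w)"
proof -
  let ?ts = "guess_tapes K x w"
  obtain q' as where c: "c = (q', map2 perform as ?ts)" "(q, map head_symbol ?ts, q', as) \<in> transitions M"
    using assms(3) by (auto elim!: tm_step.cases)
  then have "(q, map head_symbol ?ts, q', as) \<in> guess_code (Suc K) q" using assms(2) by blast
  then have "(q' = q \<and> (\<exists>b. as = guess_act b (map head_symbol ?ts))) \<or> (q' = q + 1 \<and> as = keep (map head_symbol ?ts))"
    unfolding guess_code_def instr_def by auto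
  then show ?thesis unfolding c(1) using guess_tapes_snoc[OF assms(1)] by auto
qed

text \<open>State \<open>q\<close> is left only towards \<open>q + 1\<close>, and every other step
  there just extends the string. Runs that guess forever never reach \<open>c\<close>.\<close>

lemma guess_steps_inv:
  assumes "4 \<le> K" "\<And>rs q' as. (q, rs, q', as) \<in> transitions M \<Longrightarrow> (q, rs, q', as) \<in> guess_code (Suc K) q"
    "fst c \<noteq> q"
  shows "(tm_step M ^^ n) (q, guess_tapes K x w) c \<Longrightarrow> \<exists>w' m. (tm_step M ^^ m) (q + 1, guess_tapes K x w') c"
proof (induction n arbitrary: w)
  case 0
  then show ?case using assms(3) by auto
next
  case (Suc n)
  then obtain d where d: "tm_step M (q, guess_tapes K x w) d" "(tm_step M ^^ n) d c"
    using relpowp_Suc_D2[OF Suc.prems] by blast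
  from guess_step_inv[OF assms(1,2) d(1)] show ?case
    using d(2) Suc.IH by blast
qed

text \<open>\<open>q\<close> limits the certificates only where acceptance has to be shown.
  Arbitrarily long strings can be guessed as well, which is why \<open>sound\<close> is assumed for
  all \<open>w\<close>.\<close>

theorem NP_I:
  fixes q :: "nat \<Rightarrow> nat"
  assumes wf: "wf_exp v e" "4 \<le> v" and q: "poly_fun q"
    and complete: "\<And>x. x \<in> A \<Longrightarrow> \<exists>w. length w \<le> q (length x) \<and> eval (inputs x w) e (env x w) \<noteq> 0"
    and sound: "\<And>x w. eval (inputs x w) e (env x w) \<noteq> 0 \<Longrightarrow> x \<in> A"
  shows "A \<in> NP"
proof -
  obtain f where f: "poly_fun f" "exp_bound v e f" using runs_exp[OF wf(1)] by auto
  define K where "K = v + width e + 1"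
  have K: "3 \<le> K" "4 \<le> K" "v < K" using wf by (auto simp: K_def)
  define pre where "pre = init K ;; Mv 2 Move_Right"
  define post where "post = loop 1 SKIP ;; com_exp e v"
  define g where "g = code_size pre"
  define r where "r = g + 1 + code_size post"
  define D1 where "D1 = code (Suc K) pre 0"
  define D2 where "D2 = code (Suc K) post (g + 1)"
  \<comment> \<open>The result is in register \<open>v\<close>, that is, on tape
    \<open>Suc v\<close>; it is nonzero if and only if the head has left the mark. Only then is the
    accepting step from \<open>r\<close> possible.\<close>
  define F where "F = {t \<in> instr (Suc K) r (\<lambda>_. r + 1) keep. fst (snd t) ! Suc v \<noteq> 3}"
  define M where "M = \<lparr>num_tapes = Suc K, start_state = 0, accept_state = r + 1,
    transitions = D1 \<union> guess_code (Suc K) g \<union> D2 \<union> F\<rparr>"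
  have tr: "transitions M = D1 \<union> guess_code (Suc K) g \<union> D2 \<union> F" by (simp add: M_def)
  have src: "fst ` D1 \<subseteq> {0..<g}" "fst ` guess_code (Suc K) g \<subseteq> {g}" "fst ` D2 \<subseteq> {g + 1..<r}" "fst ` F \<subseteq> {r}"
    using sources_code[of "Suc K" pre 0] sources_code[of "Suc K" post "g + 1"] sources_instr[of "Suc K"]
    unfolding D1_def D2_def guess_code_def image_Un F_def g_def r_def by (auto simp: instr_def)
  have src': "\<And>q t. (q, t) \<in> D1 \<Longrightarrow> q < g" "\<And>q t. (q, t) \<in> guess_code (Suc K) g \<Longrightarrow> q = g"
    "\<And>q t. (q, t) \<in> D2 \<Longrightarrow> g < q \<and> q < r" "\<And>q t. (q, t) \<in> F \<Longrightarrow> q = r" "g < r"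
    using src by (force simp: r_def)+
  have "wf_transitions (Suc K) (instr (Suc K) r (\<lambda>_. r + 1) keep)"
    by (rule wf_transitions_instr) (simp add: keep_def)
  then have "wf_transitions (Suc K) F"
    unfolding wf_transitions_def F_def by auto
  moreover have "wf_transitions (Suc K) (guess_code (Suc K) g)"
    unfolding guess_code_def by (intro wf_transitions_Un wf_transitions_instr) (auto simp: guess_act_def keep_def)
  ultimately have "wf_transitions (Suc K) (transitions M)"
    unfolding tr D1_def D2_def by (intro wf_transitions_Un wf_transitions_code)
  then have "wf_tm M" unfolding wf_tm_def wf_transitions_def by (simp add: M_def)
  have init: "initial_config M x = (0, input_tape x # replicate K (input_tape []))" for x
    by (simp add: initial_config_def M_def)
  have run1: "\<exists>t\<le>length x * 13 + K + 5. (tm_step (M\<lparr>transitions := D1\<rparr>) ^^ t) (initial_config M x) (g, guess_tapes K x [])" for x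
  proof -
    obtain t where t: "t \<le> length x * 13 + K + 4"
      "exec (init K) (input_tape x # replicate K (input_tape [])) t (reg_tapes K (inputs x []) [] (env x []))"
      using exec_init K by blast
    have "runs K (inputs x []) (inc 1) [] (env x []) 1 [] ((env x [])(1 := Suc (env x [] 1)))"
      by (rule runs_inc) (use K in auto)
    then obtain u where u: "u \<le> 1" "exec (Mv 2 Move_Right) (reg_tapes K (inputs x []) [] (env x [])) u (guess_tapes K x [])"
      unfolding runs_def guess_tapes_def by (auto simp: env_def numeral_2_eq_2)
    have "tapes_ok (Suc K) (input_tape x # replicate K (input_tape []))"
      by (auto simp: tapes_ok_def input_tape_def bit_symbol_def)
    then have "(tm_step (M\<lparr>transitions := D1\<rparr>) ^^ (t + u)) (0, input_tape x # replicate K (input_tape []))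
       (0 + code_size pre, guess_tapes K x [])"
      by (intro exec_sound[where k = "Suc K"]) (auto simp: pre_def D1_def intro: exec.Seq[OF t(2) u(2)])
    then show ?thesis unfolding init g_def using t(1) u(1) by (intro exI[of _ "t + u"]) auto
  qed
  define h where "h n m = (Suc m * 3 + 1) + f (n + m)" for n m
  define result where "result x w = (env x w)(v := eval (inputs x w) e (env x w))" for x w
  have run2: "\<exists>t\<le>h (length x) (length w). (tm_step (M\<lparr>transitions := D2\<rparr>) ^^ t) (g + 1, guess_tapes K x w)
      (r, reg_tapes K (inputs x w) [] (result x w))" for x w
  proof -
    have a: "runs K (inputs x w) (loop 1 SKIP) [] ((env x w)(1 := Suc (length w))) (Suc (length w) * 3 + 1) [] (env x w)"
      using runs_clear[of 1 K "inputs x w" "[]" "(env x w)(1 := Suc (length w))"] K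
      by (simp add: fun_upd_idem env_def)
    have b: "eval (inputs x w) e (env x w) \<le> f (length x + length w) \<and>
      runs K (inputs x w) (com_exp e v) [] (env x w) (f (length x + length w)) [] (result x w)"
      unfolding result_def by (rule exp_boundD[OF f(2)]) (use wf in \<open>auto simp: K_def env_def\<close>)
    have "runs K (inputs x w) post [] ((env x w)(1 := Suc (length w))) (h (length x) (length w)) []
        (result x w)"
      unfolding post_def h_def by (rule runs_Seq[OF a b[THEN conjunct2]])
    then obtain t where t: "t \<le> h (length x) (length w)"
      "exec post (guess_tapes K x w) t (reg_tapes K (inputs x w) [] (result x w))"
      unfolding runs_def guess_tapes_def by blast
    have "(tm_step (M\<lparr>transitions := D2\<rparr>) ^^ t) (g + 1, guess_tapes K x w)
       (g + 1 + code_size post, reg_tapes K (inputs x w) [] (result x w))"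
      by (intro exec_sound[where k = "Suc K"] t(2)) (auto simp: D2_def guess_tapes_def tapes_ok_reg_tapes)
    then show ?thesis using t(1) unfolding r_def by blast
  qed
  have mono: "(tm_step M ^^ t) a b" if "(tm_step (M\<lparr>transitions := D\<rparr>) ^^ t) a b" "D \<subseteq> transitions M" for D t a b
    by (rule relpowp_mono[OF tm_step_mono[OF that(2)] that(1)])
  have acc: "accept_state M = r + 1" by (simp add: M_def)
  have accepts: "accepts_within M x (length x * 13 + K + 5 + length w + 1 + h (length x) (length w) + 1)"
    if w: "eval (inputs x w) e (env x w) \<noteq> 0" for x w
  proof -
    obtain t1 where t1: "t1 \<le> length x * 13 + K + 5" "(tm_step M ^^ t1) (initial_config M x) (g, guess_tapes K x [])"
      using run1[of x] mono[where D = D1] tr by blast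
    have gc: "guess_code (Suc K) g \<subseteq> transitions M" using tr by auto
    have 2: "(tm_step M ^^ length w) (g, guess_tapes K x []) (g, guess_tapes K x w)"
      by (rule guess_steps[OF K(2) gc])
    have 3: "(tm_step M ^^ 1) (g, guess_tapes K x w) (g + 1, guess_tapes K x w)"
      by (rule relpowp_one, rule guess_step(2)[OF K(2) gc])
    let ?ts = "reg_tapes K (inputs x w) [] (result x w)"
    obtain t2 where t2: "t2 \<le> h (length x) (length w)" "(tm_step M ^^ t2) (g + 1, guess_tapes K x w) (r, ?ts)"
      using run2[of x w] mono[where D = D2] tr by blast
    have "map head_symbol ?ts ! Suc v \<noteq> 3"
      using w K by (simp add: result_def)
    moreover have "set (map head_symbol ?ts) \<subseteq> {..<4}" "length (map head_symbol ?ts) = Suc K"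
      using tapes_ok_reg_tapes[of K "inputs x w" "[]" "result x w"] by (auto simp: tapes_ok_def head_symbol_conv)
    ultimately have "(r, map head_symbol ?ts, r + 1, keep (map head_symbol ?ts)) \<in> F"
      unfolding F_def instr_def by auto
    then have "tm_step M (r, ?ts) (r + 1, map2 perform (keep (map head_symbol ?ts)) ?ts)"
      unfolding tr by (intro tm_step.intros) (simp add: tr)
    then have 4: "(tm_step M ^^ 1) (r, ?ts) (r + 1, ?ts)" by (intro relpowp_one) simp
    have "(tm_step M ^^ (t1 + (length w + (1 + (t2 + 1))))) (initial_config M x) (r + 1, ?ts)"
      by (rule relpowp_append[OF t1(2) relpowp_append[OF 2 relpowp_append[OF 3 relpowp_append[OF t2(2) 4]]]])
    then show ?thesis
      unfolding accepts_within_def acc using t1(1) t2(1)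
      by (intro exI[of _ "t1 + (length w + (1 + (t2 + 1)))"] conjI exI[of _ ?ts]) linarith
  qed
  have "x \<in> A" if x: "accepts_within M x n" for x n
  proof -
    \<comment> \<open>An accepting run is forced through the initialisation, leaves the guessing
      state with some string, and is then forced through the evaluation of the expression on that
      string.\<close>
    obtain t ts where t: "(tm_step M ^^ t) (initial_config M x) (r + 1, ts)"
      using x unfolding accepts_within_def acc by blast
    have final: "\<not> tm_step M (r + 1, ts) c" for c
      using tm_step_source[of M "r + 1" ts c] unfolding tr using src'(5) by (auto dest!: src'(1-4))
    have restrict: "z = y" if "D = D1 \<or> D = D2" "tm_step (M\<lparr>transitions := D\<rparr>) a y" "tm_step M a z" for D a y z
    proof (rule tm_step_restrict[OF _ _ that(2,3)])
      show "functional D" using that(1) functional_code unfolding D1_def D2_def by auto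
      fix q rs q' as assume *: "(q, rs, q', as) \<in> transitions M" "q \<in> fst ` D"
      then have q: "D = D1 \<and> q < g \<or> D = D2 \<and> g < q \<and> q < r"
        using that(1) by (auto dest: src'(1-4))
      show "(q, rs, q', as) \<in> D"
        using *(1) q src'(5) unfolding tr by (auto dest: src'(1-4))
    qed
    obtain t1 where rn: "(tm_step (M\<lparr>transitions := D1\<rparr>) ^^ t1) (initial_config M x) (g, guess_tapes K x [])"
      using run1[of x] by blast
    have "\<exists>m. (tm_step M ^^ m) (g, guess_tapes K x []) (r + 1, ts)"
    proof (rule relpowp_forced[OF _ _ final rn t])
      fix a y z assume "tm_step (M\<lparr>transitions := D1\<rparr>) a y" "tm_step M a z"
      then show "z = y" using restrict[of D1 a y z] by blast
    next
      fix a y assume "tm_step (M\<lparr>transitions := D1\<rparr>) a y"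
      then show "tm_step M a y" using tm_step_mono[of D1 M] tr by blast
    qed
    then obtain m where m: "(tm_step M ^^ m) (g, guess_tapes K x []) (r + 1, ts)" by blast
    have "\<exists>w' m. (tm_step M ^^ m) (g + 1, guess_tapes K x w') (r + 1, ts)"
    proof (rule guess_steps_inv[OF K(2) _ _ m])
      fix rs q' as assume "(g, rs, q', as) \<in> transitions M"
      then show "(g, rs, q', as) \<in> guess_code (Suc K) g"
        using src'(5) unfolding tr by (auto dest: src'(1-4))
    qed (simp add: r_def)
    then obtain w m' where m': "(tm_step M ^^ m') (g + 1, guess_tapes K x w) (r + 1, ts)" by blast
    let ?ts = "reg_tapes K (inputs x w) [] (result x w)"
    obtain t2 where rn: "(tm_step (M\<lparr>transitions := D2\<rparr>) ^^ t2) (g + 1, guess_tapes K x w) (r, ?ts)"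
      using run2[of x w] by blast
    have "\<exists>l. (tm_step M ^^ l) (r, ?ts) (r + 1, ts)"
    proof (rule relpowp_forced[OF _ _ final rn m'])
      fix a y z assume "tm_step (M\<lparr>transitions := D2\<rparr>) a y" "tm_step M a z"
      then show "z = y" using restrict[of D2 a y z] by blast
    next
      fix a y assume "tm_step (M\<lparr>transitions := D2\<rparr>) a y"
      then show "tm_step M a y" using tm_step_mono[of D2 M] tr by blast
    qed
    then obtain l where l: "(tm_step M ^^ l) (r, ?ts) (r + 1, ts)" by blast
    then obtain l' where "l = Suc l'" by (cases l) auto
    then obtain c where "tm_step M (r, ?ts) c" using relpowp_Suc_D2[of l' "tm_step M"] l by blast
    then obtain q' as where "(r, map head_symbol ?ts, q', as) \<in> transitions M"
      by (auto elim!: tm_step.cases)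
    then have "(r, map head_symbol ?ts, q', as) \<in> F"
      using src'(5) unfolding tr by (auto dest: src'(1-4))
    then have "map head_symbol ?ts ! Suc v \<noteq> 3" unfolding F_def by auto
    then show "x \<in> A" using K sound by (auto simp: result_def split: if_splits)
  qed
  moreover have "\<exists>p :: nat poly. \<forall>x\<in>A. accepts_within M x (poly p (length x))"
  proof -
    define B where "B n = n * 13 + (K + 5) + q n + 1 + ((q n + 1) * 3 + 1 + f (n + q n)) + 1" for n
    have "poly_fun B"
      unfolding B_def[abs_def]
      by (intro poly_fun_add poly_fun_mult poly_fun_const poly_fun_ident q poly_fun_compose[OF f(1)])
    then obtain p where p: "B = poly p" unfolding poly_fun_def by blast
    have "accepts_within M x (poly p (length x))" if xA: "x \<in> A" for x
    proof -
      obtain w where w: "length w \<le> q (length x)" "eval (inputs x w) e (env x w) \<noteq> 0"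
        using complete[OF xA] by blast
      have "f (length x + length w) \<le> f (length x + q (length x))"
        by (rule poly_fun_mono[OF f(1)]) (use w in auto)
      then have "length x * 13 + K + 5 + length w + 1 + h (length x) (length w) + 1 \<le> B (length x)"
        unfolding B_def h_def using w(1) by simp
      then show ?thesis using accepts[OF w(2)] unfolding accepts_within_def p[symmetric] by (meson order_trans)
    qed
    then show ?thesis by blast
  qed
  ultimately show ?thesis unfolding NP_def using \<open>wf_tm M\<close> by blast
qed

section \<open>Derived expressions\<close>

lemma eval_fresh_upd [simp]: "fresh e \<le> i \<Longrightarrow> eval I e (R(i := z)) = eval I e R"
  by (rule eval_cong_fresh) auto

definition holds :: "(nat \<Rightarrow> bool list) \<Rightarrow> exp \<Rightarrow> regs \<Rightarrow> bool" where
  "holds I e R \<longleftrightarrow> eval I e R \<noteq> 0"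

text \<open>Any nonzero value counts as true. Hence conjunction is a product, disjunction a sum and
  existence a bounded sum. The \<open>4\<close> keeps the bound variable clear of the registers for
  the inputs and their lengths.\<close>

definition Times :: "exp \<Rightarrow> exp \<Rightarrow> exp" where "Times a b = Sum (fresh b + 4) a b"
definition Neg :: "exp \<Rightarrow> exp" where "Neg a = Sub (Const 1) a"
definition Truth :: "exp \<Rightarrow> exp" where "Truth a = Neg (Neg a)"
definition Lt :: "exp \<Rightarrow> exp \<Rightarrow> exp" where "Lt a b = Sub b a"
definition Leq :: "exp \<Rightarrow> exp \<Rightarrow> exp" where "Leq a b = Neg (Sub a b)"
definition Equ :: "exp \<Rightarrow> exp \<Rightarrow> exp" where "Equ a b = Neg (Add (Sub a b) (Sub b a))"
definition Conj :: "exp \<Rightarrow> exp \<Rightarrow> exp" where "Conj a b = Times a b"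
definition Disj :: "exp \<Rightarrow> exp \<Rightarrow> exp" where "Disj a b = Add a b"
definition Impl :: "exp \<Rightarrow> exp \<Rightarrow> exp" where "Impl a b = Disj (Neg a) b"
definition Exis :: "nat \<Rightarrow> exp \<Rightarrow> exp \<Rightarrow> exp" where "Exis i a b = Sum i a b"
definition Univ :: "nat \<Rightarrow> exp \<Rightarrow> exp \<Rightarrow> exp" where "Univ i a b = Neg (Exis i a (Neg b))"
definition Iff :: "exp \<Rightarrow> exp \<Rightarrow> exp" where "Iff a b = Equ (Truth a) (Truth b)"
definition Cond :: "exp \<Rightarrow> exp \<Rightarrow> exp \<Rightarrow> exp" where
  "Cond c a b = Add (Times (Truth c) a) (Times (Neg c) b)"
text \<open>The quotient counts the numbers \<open>z\<close> below \<open>a\<close> for which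
  \<open>(z + 1) * b\<close> is at most \<open>a\<close>. The factor \<open>Truth b\<close> enforces
  the convention that division by zero gives zero.\<close>

definition Quot :: "exp \<Rightarrow> exp \<Rightarrow> exp" where
  "Quot a b = (let i = fresh a + fresh b + 4 in
     Times (Truth b) (Sum i a (Leq (Times (Add (Var i) (Const 1)) b) a)))"
definition Rem :: "exp \<Rightarrow> exp \<Rightarrow> exp" where "Rem a b = Sub a (Times b (Quot a b))"

lemma eval_Times [simp]: "eval I (Times a b) R = eval I a R * eval I b R"
  by (simp add: Times_def)

lemma holds_Const [simp]: "holds I (Const c) R \<longleftrightarrow> c \<noteq> 0"
  by (simp add: holds_def)
lemma eval_Neg: "eval I (Neg a) R = of_bool (\<not> holds I a R)"
  by (auto simp: Neg_def holds_def)
lemma holds_Neg [simp]: "holds I (Neg a) R \<longleftrightarrow> \<not> holds I a R"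
  by (auto simp: Neg_def holds_def)
lemma eval_Truth [simp]: "eval I (Truth a) R = of_bool (holds I a R)"
  by (simp add: Truth_def eval_Neg)
lemma holds_Truth [simp]: "holds I (Truth a) R \<longleftrightarrow> holds I a R"
  by (simp add: Truth_def)
lemma holds_Lt [simp]: "holds I (Lt a b) R \<longleftrightarrow> eval I a R < eval I b R"
  by (auto simp: Lt_def holds_def)
lemma holds_Leq [simp]: "holds I (Leq a b) R \<longleftrightarrow> eval I a R \<le> eval I b R"
  by (simp add: Leq_def) (simp add: holds_def)
lemma holds_Equ [simp]: "holds I (Equ a b) R \<longleftrightarrow> eval I a R = eval I b R"
  by (simp add: Equ_def) (auto simp: holds_def)
lemma holds_Conj [simp]: "holds I (Conj a b) R \<longleftrightarrow> holds I a R \<and> holds I b R"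
  by (simp add: Conj_def holds_def)
lemma holds_Disj [simp]: "holds I (Disj a b) R \<longleftrightarrow> holds I a R \<or> holds I b R"
  by (simp add: Disj_def holds_def)
lemma holds_Impl [simp]: "holds I (Impl a b) R \<longleftrightarrow> (holds I a R \<longrightarrow> holds I b R)"
  by (simp add: Impl_def)
lemma holds_Iff [simp]: "holds I (Iff a b) R \<longleftrightarrow> (holds I a R \<longleftrightarrow> holds I b R)"
  by (simp add: Iff_def of_bool_eq_iff del: of_bool_eq_0_iff of_bool_eq_1_iff)
lemma holds_Exis [simp]: "holds I (Exis i a b) R \<longleftrightarrow> (\<exists>z<eval I a R. holds I b (R(i := z)))"
  by (auto simp: Exis_def holds_def)
lemma holds_Univ [simp]: "holds I (Univ i a b) R \<longleftrightarrow> (\<forall>z<eval I a R. holds I b (R(i := z)))"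
  by (simp add: Univ_def)
lemma holds_Bit [simp]: "holds I (Bit j a) R \<longleftrightarrow> eval I a R < length (I j) \<and> I j ! eval I a R"
  by (simp add: holds_def)
lemma eval_Cond [simp]: "eval I (Cond c a b) R = (if holds I c R then eval I a R else eval I b R)"
  by (simp add: Cond_def eval_Neg)
lemma holds_Cond [simp]: "holds I (Cond c a b) R = (if holds I c R then holds I a R else holds I b R)"
  by (simp add: holds_def)

lemma div_eq_card: "0 < b \<Longrightarrow> a div b = card {z. z < a \<and> (z + 1) * b \<le> (a::nat)}"
proof -
  assume b: "0 < b"
  have "z < a \<and> (z + 1) * b \<le> a \<longleftrightarrow> z < a div b" for z
  proof -
    have "(z + 1) * b \<le> a \<longleftrightarrow> z + 1 \<le> a div b"
      using less_eq_div_iff_mult_less_eq[OF b, of "z + 1" a] by simp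
    moreover have "z + 1 \<le> a div b \<Longrightarrow> z < a" using div_le_dividend[of a b] by linarith
    ultimately show ?thesis by auto
  qed
  then show ?thesis by simp
qed

lemma eval_Quot [simp]: "eval I (Quot a b) R = eval I a R div eval I b R"
proof (cases "eval I b R = 0")
  case True
  then show ?thesis by (simp add: Quot_def Let_def holds_def)
next
  case False
  have s: "eval I (Leq x y) R' = of_bool (eval I x R' \<le> eval I y R')" for x y R'
    by (simp add: Leq_def eval_Neg holds_def)
  have "(\<Sum>z<m. of_bool (P z)) = card {z. z < m \<and> P z}" for m :: nat and P
    by (simp add: sum.If_cases of_bool_def Int_def)
  then show ?thesis
    using False by (simp add: Quot_def Let_def holds_def s div_eq_card)
qed

lemma eval_Rem [simp]: "eval I (Rem a b) R = eval I a R mod eval I b R"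
  by (simp add: Rem_def minus_mult_div_eq_mod)

lemma ok_derived [simp]:
  "ok_exp (Times a b) = (ok_exp a \<and> ok_exp b)"
  "ok_exp (Neg a) = ok_exp a"
  "ok_exp (Truth a) = ok_exp a"
  "ok_exp (Lt a b) = (ok_exp a \<and> ok_exp b)"
  "ok_exp (Leq a b) = (ok_exp a \<and> ok_exp b)"
  "ok_exp (Equ a b) = (ok_exp a \<and> ok_exp b)"
  "ok_exp (Conj a b) = (ok_exp a \<and> ok_exp b)"
  "ok_exp (Disj a b) = (ok_exp a \<and> ok_exp b)"
  "ok_exp (Impl a b) = (ok_exp a \<and> ok_exp b)"
  "ok_exp (Iff a b) = (ok_exp a \<and> ok_exp b)"
  "ok_exp (Exis i a b) = (2 \<le> i \<and> ok_exp a \<and> ok_exp b)"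
  "ok_exp (Univ i a b) = (2 \<le> i \<and> ok_exp a \<and> ok_exp b)"
  "ok_exp (Cond c a b) = (ok_exp c \<and> ok_exp a \<and> ok_exp b)"
  "ok_exp (Quot a b) = (ok_exp a \<and> ok_exp b)"
  "ok_exp (Rem a b) = (ok_exp a \<and> ok_exp b)"
  by (auto simp: Times_def Neg_def Truth_def Lt_def Leq_def Equ_def Conj_def Disj_def Impl_def Iff_def
      Exis_def Univ_def Cond_def Quot_def Rem_def Let_def)

fun Poly :: "nat list \<Rightarrow> exp \<Rightarrow> exp" where
  "Poly [] a = Const 0"
| "Poly (c # cs) a = Add (Const c) (Times a (Poly cs a))"

lemma eval_Poly: "eval I (Poly (coeffs p) a) R = poly p (eval I a R)"
  by (induction p) (auto simp: cCons_def)

lemma ok_Poly [simp]: "ok_exp a \<Longrightarrow> ok_exp (Poly cs a)"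
  by (induction cs) auto

text \<open>Finite relations that come from a fixed machine enter the expressions as explicit
  lists.\<close>

definition Table :: "(nat \<times> nat) list \<Rightarrow> exp \<Rightarrow> exp \<Rightarrow> exp" where
  "Table ps a b = foldr (\<lambda>(p, q) e. Disj (Conj (Equ a (Const p)) (Equ b (Const q))) e) ps (Const 0)"

lemma holds_Table [simp]: "holds I (Table ps a b) R \<longleftrightarrow> (eval I a R, eval I b R) \<in> set ps"
  unfolding Table_def by (induction ps) auto

lemma ok_Table [simp]: "ok_exp a \<Longrightarrow> ok_exp b \<Longrightarrow> ok_exp (Table ps a b)"
  unfolding Table_def by (induction ps) auto

section \<open>Powers of two and binary numbers\<close>

definition is_pow2 :: "nat \<Rightarrow> bool" where
  "is_pow2 z \<longleftrightarrow> 0 < z \<and> (\<forall>a<z. \<forall>b<z + 1. (2 * a + 3) * b \<noteq> z)"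

text \<open>Exponentiation is not among the operations, so powers of two are recognised as the
  positive numbers without an odd divisor above one; \<open>2 * a + 3\<close> runs through these odd
  numbers. Halving an even number preserves the property.\<close>

lemma is_pow2_iff: "is_pow2 z \<longleftrightarrow> (\<exists>i. z = 2 ^ i)"
proof
  show "\<exists>i. z = 2 ^ i" if "is_pow2 z"
    using that
  proof (induction z rule: less_induct)
    case (less z)
    have z: "0 < z" "\<And>a b. a < z \<Longrightarrow> b \<le> z \<Longrightarrow> (2 * a + 3) * b \<noteq> z"
      using less.prems unfolding is_pow2_def by auto
    show ?case
    proof (cases "even z")
      case True
      then obtain y where y: "z = 2 * y" by blast
      have "is_pow2 y"
        unfolding is_pow2_def
      proof (intro conjI allI impI)
        show "0 < y" using z y by simp
        fix a b assume "a < y" "b < y + 1"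
        then have "(2 * a + 3) * (2 * b) \<noteq> z" using z(2)[of a "2 * b"] y by simp
        then show "(2 * a + 3) * b \<noteq> y" using y by auto
      qed
      then obtain i where "y = 2 ^ i" using less.IH[of y] z y by auto
      then show ?thesis using y by (intro exI[of _ "Suc i"]) simp
    next
      case False
      then obtain y where y: "z = 2 * y + 1" by (auto elim: oddE)
      show ?thesis
      proof (cases y)
        case 0
        then show ?thesis using y by (intro exI[of _ 0]) simp
      next
        case (Suc x)
        then show ?thesis using z(2)[of x 1] y by auto
      qed
    qed
  qed
next
  assume "\<exists>i. z = 2 ^ i"
  then obtain i where i: "z = 2 ^ i" by blast
  have "(2 * a + 3) * b \<noteq> z" for a b
  proof
    assume "(2 * a + 3) * b = z"
    then have "(2 * a + 3) dvd 2 ^ i" using i by (metis dvd_triv_left)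
    moreover have "coprime (2 * a + 3) (2 ^ i)" by simp
    ultimately have "2 * a + 3 = 1" by (metis coprime_absorb_left nat_dvd_1_iff_1)
    then show False by simp
  qed
  then show "is_pow2 z" using i unfolding is_pow2_def by auto
qed

definition Pow2 :: "exp \<Rightarrow> exp" where
  "Pow2 e = (let i = fresh e + 4 in
     Conj e (Univ i e (Univ (Suc i) (Add e (Const 1))
       (Neg (Equ (Times (Add (Times (Const 2) (Var i)) (Const 3)) (Var (Suc i))) e)))))"

lemma holds_Pow2 [simp]: "holds I (Pow2 e) R \<longleftrightarrow> is_pow2 (eval I e R)"
  by (auto simp: Pow2_def Let_def is_pow2_def) (auto simp: holds_def)

lemma ok_Pow2 [simp]: "ok_exp (Pow2 e) = ok_exp e"
  by (auto simp: Pow2_def Let_def)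

lemma sum_of_bool: "(\<Sum>z<m. of_bool (P z)) = card {z. z < (m::nat) \<and> P z}"
  by (simp add: sum.If_cases of_bool_def Int_def)

lemma filter_pow2_upt: "filter is_pow2 [0..<2 ^ l] = map (\<lambda>i. 2 ^ i) [0..<l]"
proof (rule sorted_distinct_set_unique)
  show "sorted (map (\<lambda>i. 2 ^ i :: nat) [0..<l])"
    by (auto simp: sorted_iff_nth_mono intro: power_increasing)
  show "distinct (map (\<lambda>i. 2 ^ i :: nat) [0..<l])"
    by (auto simp: distinct_map inj_on_def)
  show "set (filter is_pow2 [0..<2 ^ l]) = set (map (\<lambda>i. 2 ^ i) [0..<l])"
    by (auto simp: is_pow2_iff)
qed (auto intro: sorted_wrt_filter)

lemma binary_eq_map: "k < 2 ^ l \<Longrightarrow> (l = 0 \<or> 2 ^ (l - 1) \<le> k) \<Longrightarrow> binary k = map (\<lambda>i. odd (k div 2 ^ i)) [0..<l]"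
proof (induction l arbitrary: k)
  case 0
  then show ?case by (simp add: binary.simps)
next
  case (Suc l)
  have "binary (k div 2) = map (\<lambda>i. odd (k div 2 div 2 ^ i)) [0..<l]"
  proof (rule Suc.IH)
    show "k div 2 < 2 ^ l" using Suc.prems by auto
    show "l = 0 \<or> 2 ^ (l - 1) \<le> k div 2"
    proof (cases l)
      case l: (Suc m)
      then have "2 ^ m * 2 \<le> k" using Suc.prems by (auto simp: mult.commute)
      then show ?thesis using l by (simp add: less_eq_div_iff_mult_less_eq)
    qed simp
  qed
  moreover have "0 < k" using Suc.prems by (auto intro: gr0I)
  moreover have "[0..<Suc l] = 0 # map Suc [0..<l]" by (simp add: map_Suc_upt upt_conv_Cons)
  ultimately show ?case
    by (subst binary.simps) (simp add: div_mult2_eq o_def del: upt_Suc)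
qed

lemma bit_length: "\<exists>l. k < 2 ^ l \<and> (l = 0 \<or> 2 ^ (l - 1) \<le> (k::nat))"
proof -
  define l where "l = (LEAST l. k < 2 ^ l)"
  have "k < 2 ^ l" unfolding l_def by (rule LeastI[of _ k]) (rule less_exp)
  moreover have "2 ^ (l - 1) \<le> k" if "l \<noteq> 0"
    using not_less_Least[of "l - 1" "\<lambda>l. k < 2 ^ l"] that unfolding l_def[symmetric] by auto
  ultimately show ?thesis by (intro exI[of _ l] conjI) (auto simp del: power.simps)
qed

text \<open>The powers of two up to \<open>k\<close>, in increasing order, are the place values of
  \<open>k\<close> without leading zeros. A loop over all numbers up to \<open>k\<close> can
  therefore print the digits.\<close>

lemma binary_eq_filter: "binary k = map (\<lambda>y. odd (k div y)) (filter is_pow2 [0..<Suc k])"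
proof -
  obtain l where l: "k < 2 ^ l" "l = 0 \<or> 2 ^ (l - 1) \<le> k" using bit_length by blast
  have "filter is_pow2 [0..<Suc k] = filter is_pow2 [0..<2 ^ l]"
  proof (rule sorted_distinct_set_unique)
    have "y \<le> k" if "is_pow2 y" "y < 2 ^ l" for y
    proof -
      from that(1) obtain i where i: "y = 2 ^ i" unfolding is_pow2_iff by blast
      then have "i < l" using that(2) by simp
      then have "y \<le> 2 ^ (l - 1)" unfolding i by (intro power_increasing) auto
      then show ?thesis using l(2) \<open>i < l\<close> by auto
    qed
    then show "set (filter is_pow2 [0..<Suc k]) = set (filter is_pow2 [0..<2 ^ l])"
      using l(1) by (auto simp: less_Suc_eq_le simp del: upt_Suc)
  qed (auto intro: sorted_wrt_filter simp del: upt_Suc)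
  then show ?thesis
    unfolding binary_eq_map[OF l] filter_pow2_upt by simp
qed

text \<open>The inner loop has zero or one round and acts as a conditional. Counting up to the value
  of \<open>e\<close> is affordable because values are polynomial.\<close>

definition out_binary :: "nat \<Rightarrow> exp \<Rightarrow> prog" where
  "out_binary i e = For i (Add e (Const 1))
     (For (Suc i) (Truth (Pow2 (Var i))) (Out (Rem (Quot e (Var i)) (Const 2))))"

lemma out_binary: "fresh e \<le> i \<Longrightarrow> out I (out_binary i e) R = binary (eval I e R)"
proof -
  assume i: "fresh e \<le> i"
  have "concat (map (\<lambda>z. if P z then [f z] else []) xs) = map f (filter P xs)" for P f and xs :: "nat list"
    by (induction xs) auto
  then show ?thesis
    using i unfolding binary_eq_filter out_binary_def
    by (simp add: odd_iff_mod_2_eq_one of_bool_def if_distrib upt_rec[of 0 "Suc 0"] cong: if_cong del: upt_Suc)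
qed

fun ok_prog :: "prog \<Rightarrow> bool" where
  "ok_prog (Out e) = ok_exp e"
| "ok_prog (Then p q) = (ok_prog p \<and> ok_prog q)"
| "ok_prog (For i a p) = (2 \<le> i \<and> ok_exp a \<and> ok_prog p)"

lemma wf_exp_mono: "wf_exp v e \<Longrightarrow> v \<le> v' \<Longrightarrow> wf_exp v' e"
  by (simp add: wf_exp_def)

lemma wf_prog_mono: "wf_prog v p \<Longrightarrow> v \<le> v' \<Longrightarrow> wf_prog v' p"
  by (induction p) (auto intro: wf_exp_mono)

lemma wf_prog_ok: "ok_prog p \<Longrightarrow> \<exists>v\<ge>4. wf_prog v p"
proof (induction p)
  case (Out e)
  then show ?case by (intro exI[of _ "fresh e + 4"]) (simp add: wf_exp_def)
next
  case (Then p q)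
  then obtain v w where "4 \<le> v" "wf_prog v p" "wf_prog w q" by auto
  then show ?case by (intro exI[of _ "max v w"]) (auto intro: wf_prog_mono)
next
  case (For i a p)
  then obtain v where v: "4 \<le> v" "wf_prog v p" by auto
  have "wf_prog (max v (max (Suc i) (fresh a))) (For i a p)"
    using For.prems v by (auto intro: wf_prog_mono simp: wf_exp_def)
  then show ?case using v(1) by (intro exI[of _ "max v (max (Suc i) (fresh a))"]) simp
qed

section \<open>Forests and line graphs\<close>

lemma delete_verts_edge:
  "{u, v} \<in> edges (delete_verts G S) \<longleftrightarrow> {u, v} \<in> edges G \<and> u \<in> verts G - S \<and> v \<in> verts G - S"
  by (auto simp: delete_verts_def induced_subgraph_def)

text \<open>On a cycle, a vertex of least rank would have two distinct neighbours of higher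
  rank.\<close>

lemma forest_rank:
  fixes r :: "'a \<Rightarrow> nat"
  assumes neq: "\<And>u v. {u, v} \<in> edges G \<Longrightarrow> r u \<noteq> r v"
    and unique: "\<And>u v w. {u, v} \<in> edges G \<Longrightarrow> {u, w} \<in> edges G \<Longrightarrow> r u < r v \<Longrightarrow> r u < r w \<Longrightarrow> v = w"
  shows "forest G"
  unfolding forest_def
proof
  assume "\<exists>xs. is_cycle G xs"
  then obtain xs where xs: "length xs \<ge> 3" "distinct xs"
    "\<And>i. i < length xs \<Longrightarrow> {xs ! i, xs ! (Suc i mod length xs)} \<in> edges G"
    unfolding is_cycle_def by auto
  let ?n = "length xs"
  have "0 < ?n" using xs(1) by linarith
  define i where "i = (ARG_MIN (\<lambda>i. r (xs ! i)) i. i < ?n)"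
  have i: "i < ?n" and least: "\<And>j. j < ?n \<Longrightarrow> r (xs ! i) \<le> r (xs ! j)"
    using arg_min_natI[of "\<lambda>i. i < ?n" 0 "\<lambda>i. r (xs ! i)"] arg_min_nat_le[of "\<lambda>i. i < ?n" _ "\<lambda>i. r (xs ! i)"] \<open>0 < ?n\<close>
    unfolding i_def by blast+
  let ?b = "Suc i mod ?n" and ?a = "(if i = 0 then ?n - 1 else i - 1)"
  have bounds: "?a < ?n" "?b < ?n" and a: "Suc ?a mod ?n = i" using i xs(1) \<open>0 < ?n\<close> by (auto intro: mod_less_divisor)
  have "{xs ! i, xs ! ?b} \<in> edges G" using xs(3)[OF i] .
  moreover have "{xs ! i, xs ! ?a} \<in> edges G" using xs(3)[OF bounds(1)] unfolding a by (simp add: insert_commute)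
  ultimately have "xs ! ?b = xs ! ?a"
    using least[OF bounds(1)] least[OF bounds(2)] neq by (intro unique) (auto simp: le_less)
  then have "?b = ?a" using xs(2) bounds nth_eq_iff_index_eq by blast
  then show False using i xs(1) by (cases "Suc i = ?n") (auto split: if_splits)
qed

lemma line_graph_edge: "{e, f} \<in> edges (line_graph H) \<longleftrightarrow> e \<in> edges H \<and> f \<in> edges H \<and> e \<noteq> f \<and> e \<inter> f \<noteq> {}"
  by (auto simp: line_graph_def doubleton_eq_iff)

text \<open>The values of \<open>ends\<close> are the edges of a root graph and their end-points its
  vertices. Injectivity excludes parallel edges.\<close>

lemma is_line_graphI:
  fixes ends :: "'a \<Rightarrow> nat set"
  assumes "finite (verts G)" "inj_on ends (verts G)" "\<And>v. v \<in> verts G \<Longrightarrow> card (ends v) = 2"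
    "\<And>u v. u \<in> verts G \<Longrightarrow> v \<in> verts G \<Longrightarrow> {u, v} \<in> edges G \<longleftrightarrow> u \<noteq> v \<and> ends u \<inter> ends v \<noteq> {}"
  shows "is_line_graph G"
proof -
  define H where "H = (\<Union> (ends ` verts G), ends ` verts G)"
  have "finite (ends v)" if "v \<in> verts G" for v using assms(3)[OF that] card_ge_0_finite by force
  then have "simple_graph H" using assms(1,3) by (auto simp: simple_graph_def H_def)
  moreover have "graph_isomorphic G (line_graph H)"
    unfolding graph_isomorphic_def
  proof (intro exI conjI ballI)
    show "bij_betw ends (verts G) (verts (line_graph H))"
      using assms(2) by (simp add: bij_betw_def line_graph_def H_def)
    fix u v assume uv: "u \<in> verts G" "v \<in> verts G"
    then show "{u, v} \<in> edges G \<longleftrightarrow> {ends u, ends v} \<in> edges (line_graph H)"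
      unfolding line_graph_edge assms(4)[OF uv] using inj_on_eq_iff[OF assms(2) uv] by (auto simp: H_def)
  qed
  ultimately show ?thesis unfolding is_line_graph_def by blast
qed

lemma reach_sym:
  "(\<lambda>x y. {x, y} \<in> E)\<^sup>*\<^sup>* u v \<Longrightarrow> (\<lambda>x y. {x, y} \<in> E)\<^sup>*\<^sup>* v u"
proof (induction rule: rtranclp_induct)
  case (step y z)
  then have "{z, y} \<in> E" by (simp add: insert_commute)
  then show ?case using step.IH by (rule converse_rtranclp_into_rtranclp)
qed simp

text \<open>All neighbours of the first vertex of a longest path lie on the path. One beyond the
  second vertex would close a cycle, so at most one neighbour remains.\<close>

lemma ex_leaf:
  fixes G :: "'a graph"
  assumes "finite V" "V \<noteq> {}" "\<And>u v. {u, v} \<in> edges G \<Longrightarrow> u \<in> V \<and> u \<noteq> v" "forest G"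
  shows "\<exists>v\<in>V. \<forall>a b. {v, a} \<in> edges G \<longrightarrow> {v, b} \<in> edges G \<longrightarrow> a = b"
proof -
  define path where "path xs \<longleftrightarrow> xs \<noteq> [] \<and> distinct xs \<and> set xs \<subseteq> V \<and>
    (\<forall>i. Suc i < length xs \<longrightarrow> {xs ! i, xs ! Suc i} \<in> edges G)" for xs
  obtain v0 where "v0 \<in> V" using assms(2) by blast
  then have "path [v0]" by (simp add: path_def)
  moreover have "length xs < Suc (card V)" if "path xs" for xs
    using that card_mono[OF assms(1), of "set xs"] distinct_card[of xs] by (auto simp: path_def)
  ultimately obtain xs where xs: "path xs" and longest: "\<And>ys. path ys \<Longrightarrow> length ys \<le> length xs"
    using ex_has_greatest_nat[of path "[v0]" length "Suc (card V)"] by (auto simp: less_imp_le)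
  have ne: "xs \<noteq> []" "distinct xs" "set xs \<subseteq> V" using xs by (auto simp: path_def)
  have sym: "{u, v} \<in> edges G \<longleftrightarrow> {v, u} \<in> edges G" for u v by (simp add: insert_commute)
  have nb: "\<exists>i. 0 < i \<and> i < length xs \<and> xs ! i = a" if a: "{xs ! 0, a} \<in> edges G" for a
  proof -
    have "a \<in> V" "a \<noteq> xs ! 0" using assms(3)[of a "xs ! 0"] a sym by auto
    have "a \<in> set xs"
    proof (rule ccontr)
      assume "a \<notin> set xs"
      have "{(a # xs) ! i, (a # xs) ! Suc i} \<in> edges G" if "Suc i < length (a # xs)" for i
        using that xs a sym by (cases i) (auto simp: path_def)
      then have "path (a # xs)" using \<open>a \<notin> set xs\<close> \<open>a \<in> V\<close> ne by (auto simp: path_def)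
      then show False using longest by fastforce
    qed
    then obtain i where "i < length xs" "xs ! i = a" by (auto simp: in_set_conv_nth)
    then show ?thesis using \<open>a \<noteq> xs ! 0\<close> by (intro exI[of _ i]) (auto intro: gr0I)
  qed
  \<comment> \<open>The index \<open>i\<close> ensures \<open>j \<ge> 2\<close>, as a cycle needs
    three vertices.\<close>
  have False if "0 < i" "i < j" "j < length xs" "{xs ! 0, xs ! j} \<in> edges G" for i j
  proof -
    have lt: "length (take (Suc j) xs) = Suc j" using that(3) by simp
    have "is_cycle G (take (Suc j) xs)"
      unfolding is_cycle_def
    proof (intro conjI allI impI)
      fix l assume "l < length (take (Suc j) xs)"
      then have l: "l \<le> j" using that by simp
      show "{take (Suc j) xs ! l, take (Suc j) xs ! (Suc l mod length (take (Suc j) xs))} \<in> edges G"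
      proof (cases "l = j")
        case True
        then show ?thesis using that sym unfolding lt by simp
      next
        case False
        then have "Suc l mod Suc j = Suc l" using l by simp
        then show ?thesis using False l that xs unfolding lt by (simp add: path_def)
      qed
    qed (use that ne in auto)
    then show False using assms(4) by (simp add: forest_def)
  qed
  then have "i = j" if "0 < i" "0 < j" "i < length xs" "j < length xs" "{xs ! 0, xs ! i} \<in> edges G" "{xs ! 0, xs ! j} \<in> edges G" for i j
    using that by (metis linorder_neqE_nat)
  then have "a = b" if "{xs ! 0, a} \<in> edges G" "{xs ! 0, b} \<in> edges G" for a b
    using nb that by metis
  moreover have "xs ! 0 \<in> V" using ne by (cases xs) auto
  ultimately show ?thesis by blast
qed

lemma forest_subgraph: "edges H \<subseteq> edges G \<Longrightarrow> forest G \<Longrightarrow> forest H"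
  unfolding forest_def is_cycle_def by blast

text \<open>The rank is the order in which leaves are removed one after the other: the leaf gets
  rank zero, everything left is raised above it, and a leaf has at most one neighbour.\<close>

lemma forest_ex_rank:
  fixes G :: "'a graph"
  assumes "finite V" "\<And>u v. {u, v} \<in> edges G \<Longrightarrow> u \<in> V \<and> u \<noteq> v" "forest G"
  shows "\<exists>r :: 'a \<Rightarrow> nat. (\<forall>u v. {u, v} \<in> edges G \<longrightarrow> r u \<noteq> r v) \<and>
    (\<forall>u v w. {u, v} \<in> edges G \<longrightarrow> {u, w} \<in> edges G \<longrightarrow> r u < r v \<longrightarrow> r u < r w \<longrightarrow> v = w)"
  using assms
proof (induction V arbitrary: G rule: finite_psubset_induct)
  case (psubset V)
  show ?case
  proof (cases "V = {}")
    case True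
    then have "{u, v} \<notin> edges G" for u v using psubset.prems(1) by blast
    then show ?thesis by blast
  next
    case False
    then obtain l where l: "l \<in> V" "\<And>a b. {l, a} \<in> edges G \<Longrightarrow> {l, b} \<in> edges G \<Longrightarrow> a = b"
      using ex_leaf[OF psubset.hyps(1) False psubset.prems] by blast
    define G' where "G' = (verts G, {e \<in> edges G. l \<notin> e})"
    have "forest G'" by (rule forest_subgraph[OF _ psubset.prems(2)]) (auto simp: G'_def)
    moreover have "u \<in> V - {l} \<and> u \<noteq> v" if "{u, v} \<in> edges G'" for u v
      using that psubset.prems(1)[of u v] by (auto simp: G'_def)
    moreover have "V - {l} \<subset> V" using l(1) by auto
    ultimately obtain r :: "'a \<Rightarrow> nat" where r: "\<And>u v. {u, v} \<in> edges G' \<Longrightarrow> r u \<noteq> r v"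
      "\<And>u v w. {u, v} \<in> edges G' \<Longrightarrow> {u, w} \<in> edges G' \<Longrightarrow> r u < r v \<Longrightarrow> r u < r w \<Longrightarrow> v = w"
      using psubset.IH[of "V - {l}" G'] by metis
    define r' where "r' v = (if v = l then 0 else Suc (r v))" for v
    have G': "{u, v} \<in> edges G' \<longleftrightarrow> {u, v} \<in> edges G \<and> u \<noteq> l \<and> v \<noteq> l" for u v by (auto simp: G'_def)
    have "r' u \<noteq> r' v" if "{u, v} \<in> edges G" for u v
      using that psubset.prems(1)[of u v] r(1)[of u v] G' by (auto simp: r'_def)
    moreover have "v = w" if "{u, v} \<in> edges G" "{u, w} \<in> edges G" "r' u < r' v" "r' u < r' w" for u v w
      using that l(2)[of v w] r(2)[of u v w] G' by (auto simp: r'_def split: if_splits)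
    ultimately show ?thesis by blast
  qed
qed


section \<open>Satisfiability as connected feedback vertex set\<close>

locale gadget_defs =
  fixes V C :: nat and pos neg :: "nat \<Rightarrow> nat \<Rightarrow> bool"
begin

definition len :: nat where "len = 4 * C"
definition cyc :: nat where "cyc = len * V"

text \<open>Vertex \<open>s = (i * C + j) * 4 + r\<close> of the cycles belongs to variable \<open>i\<close> and clause \<open>j\<close>, and cycle edge \<open>s\<close> leads to
  \<open>nxt s\<close>. The edges with even \<open>s\<close> belong to the solution if and only if the variable is true. Hence a positive
  occurrence is the pair \<open>r = 1, 2\<close>, which is joined by an odd edge, and a negative occurrence is the
  pair \<open>r = 0, 1\<close>; hub \<open>j + 1\<close> is the hub of the clause and hub \<open>0\<close> the root.\<close>

definition hub :: "nat \<Rightarrow> nat" where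
  "hub s = (let i = s div len; j = s div 4 mod C; r = s mod 4 in
     if r = 0 \<and> neg i j \<or> r = 1 \<and> (pos i j \<or> neg i j) \<or> r = 2 \<and> pos i j then j + 1 else 0)"
text \<open>Each variable has its own cycle of length \<open>len\<close>; the successor wraps around
  inside the block of its variable.\<close>

definition nxt :: "nat \<Rightarrow> nat" where "nxt s = s - s mod len + Suc s mod len"
definition size :: nat where "size = 3 * cyc + 2 * (C + 1)"
text \<open>The edges of the root graph are numbered by type: cycle edges below \<open>cyc\<close>,
  then a joining edge for each cycle vertex, then a pendant edge for each cycle vertex, and from
  \<open>3 * cyc\<close> on two pendant edges for each hub. The hubs are the vertices from
  \<open>cyc\<close> to \<open>cyc + C\<close>. Adding \<open>e\<close> in \<open>end2\<close> gives
  each pendant edge a leaf of its own.\<close>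

definition end1 :: "nat \<Rightarrow> nat" where
  "end1 e = (if e < cyc then e else if e < 2 * cyc then e - cyc else if e < 3 * cyc then e - 2 * cyc
     else cyc + (e - 3 * cyc) div 2)"
definition end2 :: "nat \<Rightarrow> nat" where
  "end2 e = (if e < cyc then nxt e else if e < 2 * cyc then cyc + hub (e - cyc) else cyc + C + 1 + e)"
definition ends :: "nat \<Rightarrow> nat set" where "ends e = {end1 e, end2 e}"
definition adj :: "nat \<Rightarrow> nat \<Rightarrow> bool" where
  "adj e f \<longleftrightarrow> e \<noteq> f \<and> (end1 e = end1 f \<or> end1 e = end2 f \<or> end2 e = end1 f \<or> end2 e = end2 f)"
definition graph :: "nat graph" where
  "graph = ({..<size}, {{e, f} | e f. e < size \<and> f < size \<and> adj e f})"

text \<open>A clause without literals counts as true, since no joining edge leads to its hub.\<close>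

definition satisfied_by :: "(nat \<Rightarrow> bool) \<Rightarrow> bool" where
  "satisfied_by a \<longleftrightarrow> (\<forall>j<C. (\<exists>i<V. pos i j \<or> neg i j) \<longrightarrow> (\<exists>i<V. pos i j \<and> a i \<or> neg i j \<and> \<not> a i))"

end

locale gadget = gadget_defs +
  assumes V_pos: "0 < V" and C_pos: "0 < C"
begin

lemma len_ge: "4 \<le> len" using C_pos by (simp add: len_def)

lemma nxt_div [simp]: "nxt s div len = s div len"
proof -
  have "nxt s = s div len * len + Suc s mod len" unfolding nxt_def by (simp add: minus_mod_eq_div_mult)
  then show ?thesis using len_ge by simp
qed

lemma nxt_mod: "nxt s mod len = Suc s mod len"
proof -
  have "nxt s = s div len * len + Suc s mod len" unfolding nxt_def by (simp add: minus_mod_eq_div_mult)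
  then show ?thesis by simp
qed

lemma less_cyc_iff: "s < cyc \<longleftrightarrow> s div len < V"
  using len_ge by (simp add: cyc_def div_less_iff_less_mult mult.commute)

lemma nxt_less: "s < cyc \<Longrightarrow> nxt s < cyc"
  by (simp add: less_cyc_iff)

lemma mod_dvd_len: "d dvd len \<Longrightarrow> nxt s mod d = Suc s mod d"
  by (metis mod_mod_cancel nxt_mod)

lemma nxt_mod_4: "nxt s mod 4 = Suc s mod 4"
  by (rule mod_dvd_len) (simp add: len_def)

lemma even_nxt [simp]: "even (nxt s) \<longleftrightarrow> odd s"
  using mod_dvd_len[of 2 s] by (simp add: len_def even_iff_mod_2_eq_zero) presburger

lemma nxt_neq: "nxt s \<noteq> s"
  using even_nxt[of s] by metis

lemma nxt_inj: "nxt s = nxt t \<Longrightarrow> s = t"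
proof -
  assume eq: "nxt s = nxt t"
  have "s div len = t div len" using nxt_div[of s] nxt_div[of t] eq by simp
  moreover have "Suc s mod len = Suc t mod len" using nxt_mod[of s] nxt_mod[of t] eq by simp
  then have "s mod len = t mod len"
    using len_ge by (auto simp: mod_Suc split: if_splits)
  ultimately show "s = t" by (metis div_mult_mod_eq)
qed

lemma nxt_Suc: "Suc s mod len \<noteq> 0 \<Longrightarrow> nxt s = Suc s"
  unfolding nxt_def by (auto simp: mod_Suc mod_less_eq_dividend split: if_splits)

text \<open>The cycle length is a multiple of 4, so wrapping around happens only behind a vertex
  with remainder 3, which never belongs to an occurrence of a literal.\<close>

lemma nxt_Suc': "s mod 4 \<noteq> 3 \<Longrightarrow> nxt s = Suc s"
proof (rule nxt_Suc)
  assume "s mod 4 \<noteq> 3"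
  then have "Suc s mod 4 \<noteq> 0" by presburger
  then show "Suc s mod len \<noteq> 0" by (auto simp: len_def mod_mult2_eq)
qed

lemma nxt_nxt: "nxt (nxt s) \<noteq> s"
proof
  assume "nxt (nxt s) = s"
  then have "Suc (Suc s) mod 4 = s mod 4"
    using nxt_mod_4[of "nxt s"] nxt_mod_4[of s] by (metis mod_Suc_eq)
  then show False by presburger
qed

lemma nxt_surj: assumes "s < cyc" shows "\<exists>t<cyc. nxt t = s"
proof -
  have "nxt ` {..<cyc} = {..<cyc}"
    by (rule endo_inj_surj) (auto intro: nxt_less inj_onI nxt_inj)
  then have "s \<in> nxt ` {..<cyc}" using assms by simp
  then show ?thesis by auto
qed

lemma hub_less: "hub s < C + 1"
  using C_pos by (auto simp: hub_def Let_def)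

lemma hub_3: "s mod 4 = 3 \<Longrightarrow> hub s = 0"
  by (auto simp: hub_def Let_def)

lemma end1_less: "e < size \<Longrightarrow> end1 e < cyc + C + 1"
  by (auto simp: end1_def size_def less_mult_imp_div_less)

lemma ends_neq: "e < size \<Longrightarrow> end1 e \<noteq> end2 e"
  using nxt_neq[of e] by (auto simp: end1_def end2_def size_def)

text \<open>Cycle, joining and pendant edges are told apart by their second ends. Two different
  cycle edges with the same ends would form a cycle of length two, which \<open>nxt_nxt\<close>
  excludes.\<close>

lemma ends_inj: assumes "e < size" "f < size" "ends e = ends f" shows "e = f"
proof -
  have eq: "end1 e = end1 f \<and> end2 e = end2 f \<or> end1 e = end2 f \<and> end2 e = end1 f"
    using assms(3) by (auto simp: ends_def doubleton_eq_iff)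
  consider "e < cyc" | "cyc \<le> e" "e < 2 * cyc" | "2 * cyc \<le> e" by linarith
  then show ?thesis
  proof cases
    case 1
    then have "end1 e = e" "end2 e = nxt e" "nxt e < cyc" by (auto simp: end1_def end2_def nxt_less)
    moreover have "f < cyc"
    proof (rule ccontr)
      assume "\<not> f < cyc"
      then have "cyc \<le> end2 f" by (auto simp: end2_def)
      then show False using eq 1 calculation by auto
    qed
    ultimately show ?thesis using eq nxt_nxt[of e] nxt_nxt[of f] by (auto simp: end1_def end2_def)
  next
    case 2
    then have e: "end1 e = e - cyc" "end2 e = cyc + hub (e - cyc)" by (auto simp: end1_def end2_def)
    have "cyc \<le> f" using eq e 2 nxt_less[of f] by (auto simp: end1_def end2_def split: if_splits)
    moreover have "f < 2 * cyc"
    proof (rule ccontr)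
      assume "\<not> f < 2 * cyc"
      then have "end2 f \<ge> cyc + C + 1" by (auto simp: end2_def)
      then show False using eq e 2 hub_less[of "e - cyc"] by auto
    qed
    ultimately have "end1 f = f - cyc" "end2 f = cyc + hub (f - cyc)" by (auto simp: end1_def end2_def)
    then show ?thesis using eq e 2 \<open>cyc \<le> f\<close> \<open>f < 2 * cyc\<close> by auto
  next
    case 3
    then have e: "end2 e = cyc + C + 1 + e" by (auto simp: end2_def)
    then have "end2 f = end2 e" using eq end1_less[OF assms(2)] by auto
    then have "2 * cyc \<le> f"
      using e hub_less[of "f - cyc"] nxt_less[of f] 3 by (auto simp: end2_def split: if_splits)
    then show ?thesis using \<open>end2 f = end2 e\<close> e by (auto simp: end2_def)
  qed
qed

lemma adj_iff: "e < size \<Longrightarrow> f < size \<Longrightarrow> adj e f \<longleftrightarrow> e \<noteq> f \<and> ends e \<inter> ends f \<noteq> {}"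
  by (auto simp: adj_def ends_def)

lemma adj_sym: "adj e f \<longleftrightarrow> adj f e"
  by (auto simp: adj_def)

lemma graph_edge: "{e, f} \<in> edges graph \<longleftrightarrow> e < size \<and> f < size \<and> adj e f"
  by (auto simp: graph_def doubleton_eq_iff adj_sym)

lemma graph_verts: "verts graph = {..<size}"
  by (simp add: graph_def)

lemma simple_graph: "simple_graph graph"
  by (auto simp: simple_graph_def graph_def card_2_iff adj_def)

lemma line_graph: "is_line_graph graph"
proof (rule is_line_graphI[of graph ends])
  fix e assume "e \<in> verts graph"
  then show "card (ends e) = 2" using ends_neq[of e] by (simp add: ends_def graph_verts)
next
  fix e f assume "e \<in> verts graph" "f \<in> verts graph"
  then show "{e, f} \<in> edges graph \<longleftrightarrow> e \<noteq> f \<and> ends e \<inter> ends f \<noteq> {}"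
    by (simp add: graph_edge graph_verts adj_iff)
qed (auto simp: graph_verts inj_on_def intro: ends_inj)

lemma cyc_3: "3 < cyc" "hub 3 = 0"
  using V_pos len_ge mult_le_mono[of 4 len 1 V] by (auto simp: cyc_def intro: hub_3)

lemma hub_index:
  assumes "i < V" "j < C" "r < 4"
  defines "s \<equiv> (i * C + j) * 4 + r"
  shows "s < cyc" "s div len = i" "s div 4 mod C = j" "s mod 4 = r"
proof -
  have "(x * 4 + r) div 4 = x" "(x * 4 + r) mod 4 = r" for x using assms(3) by auto
  then have r: "s div 4 = i * C + j" "s mod 4 = r" unfolding s_def by blast+
  then show j: "s div 4 mod C = j" "s mod 4 = r" using assms by auto
  have "s div len = s div 4 div C" by (simp add: len_def div_mult2_eq)
  then show i: "s div len = i" using r assms by simp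
  then show "s < cyc" using assms by (simp add: less_cyc_iff)
qed

section \<open>From a satisfying assignment to a connected feedback vertex set\<close>

context
  fixes a :: "nat \<Rightarrow> bool"
  assumes sat: "satisfied_by a"
begin

definition sol :: "nat set" where
  "sol = {e. e < cyc \<and> (even e \<longleftrightarrow> a (e div len))} \<union> {cyc..<2 * cyc}"

lemma S_size: "sol \<subseteq> {..<size}"
  by (auto simp: sol_def size_def)

text \<open>At most one of the cycle edges \<open>2 * m\<close> and \<open>2 * m + 1\<close> is
  chosen, since they belong to the same variable and differ in parity. So the cycles contribute at
  most \<open>cyc div 2\<close>, and the joining edges contribute \<open>cyc\<close>.\<close>

lemma card_S: "card sol \<le> 6 * V * C"
proof -
  let ?A = "{e. e < cyc \<and> (even e \<longleftrightarrow> a (e div len))}"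
  have "inj_on (\<lambda>e. e div 2) ?A"
  proof (rule inj_onI)
    fix x y assume *: "x \<in> ?A" "y \<in> ?A" "x div 2 = y div 2"
    have d: "z div len = z div 2 div (2 * C)" for z
      by (simp add: len_def div_mult2_eq[symmetric])
    have "x div len = y div len" unfolding d *(3) ..
    then have "even x \<longleftrightarrow> even y" using * by auto
    then show "x = y" using *(3) by presburger
  qed
  moreover have "(\<lambda>e. e div 2) ` ?A \<subseteq> {..<cyc div 2}"
  proof
    fix y assume "y \<in> (\<lambda>e. e div 2) ` ?A"
    then obtain e where "y = e div 2" "e < cyc" by auto
    moreover have "even cyc" by (simp add: cyc_def len_def)
    ultimately have "y < cyc div 2" by presburger
    then show "y \<in> {..<cyc div 2}" by simp
  qed
  ultimately have "card ?A \<le> cyc div 2"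
    using card_inj_on_le[of "\<lambda>e. e div 2" ?A "{..<cyc div 2}"] by simp
  moreover have "card sol \<le> card ?A + card {cyc..<2 * cyc}"
    unfolding sol_def by (rule card_Un_le)
  moreover have "cyc div 2 + cyc = 6 * V * C" by (simp add: cyc_def len_def)
  ultimately show ?thesis by simp
qed

abbreviation reach where "reach \<equiv> (\<lambda>x y. {x, y} \<in> edges (induced_subgraph graph sol))\<^sup>*\<^sup>*"

lemma reach_adj: "e \<in> sol \<Longrightarrow> f \<in> sol \<Longrightarrow> adj e f \<or> e = f \<Longrightarrow> reach e f"
proof (cases "e = f")
  case False
  assume "e \<in> sol" "f \<in> sol" "adj e f \<or> e = f"
  then have "{e, f} \<in> edges (induced_subgraph graph sol)"
    using S_size False graph_edge[of e f] by (auto simp: induced_subgraph_def)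
  then show ?thesis by (rule r_into_rtranclp)
qed simp

lemma reach_hub: "s < cyc \<Longrightarrow> t < cyc \<Longrightarrow> hub s = hub t \<Longrightarrow> reach (cyc + s) (cyc + t)"
  by (rule reach_adj) (auto simp: sol_def adj_def end2_def)

text \<open>A chosen cycle edge links the joining edges at its two ends, and hence the hubs to which
  they lead.\<close>

lemma reach_cyc:
  assumes "e < cyc" "even e \<longleftrightarrow> a (e div len)"
  shows "reach (cyc + e) e" "reach e (cyc + nxt e)"
proof -
  have "cyc + e \<in> sol" "e \<in> sol" "cyc + nxt e \<in> sol" "adj (cyc + e) e" "adj e (cyc + nxt e)"
    using assms nxt_less[of e] by (auto simp: sol_def adj_def end1_def end2_def)
  then show "reach (cyc + e) e" "reach e (cyc + nxt e)"
    using reach_adj[of "cyc + e" e] reach_adj[of e "cyc + nxt e"] by blast+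
qed

text \<open>Vertex 3 is joined to the root, so \<open>cyc + 3\<close> is a fixed edge there. Joining
  edges at one hub are pairwise adjacent; thus it suffices that one chosen cycle edge of a true
  literal connects the clause hub with the root.\<close>

lemma reach_root: "s < cyc \<Longrightarrow> reach (cyc + s) (cyc + 3)"
proof (cases "hub s")
  case 0
  assume "s < cyc"
  then show ?thesis using 0 cyc_3 by (intro reach_hub) auto
next
  case (Suc j)
  assume s: "s < cyc"
  have j: "j < C" using hub_less[of s] Suc by simp
  have "j = s div 4 mod C" "pos (s div len) j \<or> neg (s div len) j"
    using Suc by (auto simp: hub_def Let_def split: if_splits)
  moreover have "s div len < V" using s less_cyc_iff by simp
  ultimately obtain i where i: "i < V" "pos i j \<and> a i \<or> neg i j \<and> \<not> a i"
    using sat j unfolding satisfied_by_def by meson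
  have "\<exists>t<cyc. hub t = Suc j \<and> reach (cyc + t) (cyc + 3)"
  proof (cases "pos i j \<and> a i")
    case True
    \<comment> \<open>The even edge behind the pair \<open>r = 1, 2\<close> leads to a vertex with
      remainder 3, which is joined to the root.\<close>
    let ?t = "(i * C + j) * 4 + 2"
    have t: "?t < cyc" "?t div len = i" "?t div 4 mod C = j" "?t mod 4 = 2"
      using hub_index[OF i(1) j, of 2] by auto
    have h: "hub ?t = Suc j" using True t by (simp add: hub_def Let_def)
    have "even ?t \<longleftrightarrow> a (?t div len)" unfolding t(2) using True by simp
    note reach_cyc[OF t(1) this]
    moreover have "hub (nxt ?t) = 0" using nxt_mod_4[of ?t] t(4) by (intro hub_3) presburger
    then have "reach (cyc + nxt ?t) (cyc + 3)" using cyc_3 t(1) nxt_less by (intro reach_hub) auto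
    ultimately show ?thesis using t(1) h by (blast intro: rtranclp_trans)
  next
    case False
    \<comment> \<open>For a negative literal, the odd edge in front of the pair
      \<open>r = 0, 1\<close> comes from a vertex with remainder 3. It may be the edge that closes
      the cycle, so the predecessor is taken from \<open>nxt_surj\<close>.\<close>
    let ?t = "(i * C + j) * 4 + 0"
    have t: "?t < cyc" "?t div len = i" "?t div 4 mod C = j" "?t mod 4 = 0"
      using hub_index[OF i(1) j, of 0] by auto
    have n: "neg i j" "\<not> a i" using False i(2) by blast+
    have h: "hub ?t = Suc j" using n(1) t by (simp add: hub_def Let_def)
    obtain u where u: "u < cyc" "nxt u = ?t" using nxt_surj[OF t(1)] by blast
    have m: "u mod 4 = 3" using nxt_mod_4[of u] t(4) unfolding u(2) by presburger
    have "u div len = i" using nxt_div[of u] t(2) unfolding u(2) by simp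
    moreover have "odd u" using m by presburger
    ultimately have "even u \<longleftrightarrow> a (u div len)" using False i by auto
    from reach_cyc[OF u(1) this] have "reach (cyc + u) u" "reach u (cyc + ?t)" unfolding u(2) by blast+
    moreover have "reach (cyc + 3) (cyc + u)" using cyc_3 u(1) hub_3[OF m] by (intro reach_hub) auto
    ultimately have "reach (cyc + 3) (cyc + ?t)" by (blast intro: rtranclp_trans)
    from reach_sym[OF this] show ?thesis using t(1) h by blast
  qed
  then obtain t where t: "t < cyc" "hub t = Suc j" "reach (cyc + t) (cyc + 3)" by blast
  then have "reach (cyc + s) (cyc + t)" using s Suc by (intro reach_hub) auto
  then show ?thesis using t(3) by (rule rtranclp_trans)
qed

lemma connected_S: "connected_graph (induced_subgraph graph sol)"
proof -
  have root: "reach e (cyc + 3)" if "e \<in> sol" for e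
  proof (cases "e < cyc")
    case True
    then have "reach (cyc + e) e" using that by (intro reach_cyc) (auto simp: sol_def)
    from rtranclp_trans[OF reach_sym[OF this] reach_root[OF True]] show ?thesis .
  next
    case False
    then show ?thesis using that reach_root[of "e - cyc"] by (auto simp: sol_def)
  qed
  then show ?thesis
    unfolding connected_graph_def
  proof (intro ballI)
    fix u v assume "u \<in> verts (induced_subgraph graph sol)" "v \<in> verts (induced_subgraph graph sol)"
    then have "u \<in> sol" "v \<in> sol" by (auto simp: induced_subgraph_def)
    from rtranclp_trans[OF root[OF this(1)] reach_sym[OF root[OF this(2)]]]
    show "reach u v" .
  qed
qed

text \<open>The remaining edges form paths: each remaining cycle edge with the pendant edges at its
  two ends, and the two pendant edges of each hub. The cycle edge is the top of its path; the two
  edges at a hub differ in parity.\<close>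

definition rank :: "nat \<Rightarrow> nat" where
  "rank e = (if e < cyc then 2 else if e < 3 * cyc then 0 else (e - 3 * cyc) mod 2)"

lemma forest_S: "forest (delete_verts graph sol)"
proof (rule forest_rank[where r = rank])
  have F: "(e < cyc \<and> (even e \<longleftrightarrow> \<not> a (e div len))) \<or> (2 * cyc \<le> e \<and> e < size)"
    if "e < size" "e \<notin> sol" for e
    using that by (auto simp: sol_def)
  \<comment> \<open>The cycle edges outside of \<open>sol\<close> all have the same parity on the
    cycle of one variable, so no two of them are consecutive.\<close>
  have cc: False if "adj e f" "e < cyc" "f < cyc" "even e \<longleftrightarrow> \<not> a (e div len)" "even f \<longleftrightarrow> \<not> a (f div len)" for e f
  proof -
    have "e = nxt f \<or> f = nxt e"
      using that(1-3) nxt_inj[of e f] unfolding adj_def end1_def end2_def by auto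
    then show False using that(4,5) nxt_div[of e] nxt_div[of f] even_nxt[of e] even_nxt[of f] by metis
  qed
  have adjD: "(e < cyc \<or> f < cyc \<or> (3 * cyc \<le> e \<and> 3 * cyc \<le> f \<and> rank e \<noteq> rank f))"
    if "adj e f" "2 * cyc \<le> e" "2 * cyc \<le> f" "e < size" "f < size" for e f
  proof -
    have "end1 e < cyc + C + 1" "end1 f < cyc + C + 1" using that end1_less by auto
    moreover have "end2 e = cyc + C + 1 + e" "end2 f = cyc + C + 1 + f" using that by (auto simp: end2_def)
    ultimately have "end1 e = end1 f" "e \<noteq> f" using that(1) by (auto simp: adj_def)
    then have *: "3 * cyc \<le> e \<and> 3 * cyc \<le> f \<and> (e - 3 * cyc) div 2 = (f - 3 * cyc) div 2"
      using that(2,3) by (auto simp: end1_def split: if_splits)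
    have "x = y" if "x div 2 = y div 2" "x mod 2 = y mod 2" for x y :: nat
      using that by (metis div_mult_mod_eq)
    moreover have "e - 3 * cyc \<noteq> f - 3 * cyc" using * \<open>e \<noteq> f\<close> by linarith
    ultimately have "(e - 3 * cyc) mod 2 \<noteq> (f - 3 * cyc) mod 2" using * by blast
    moreover have "rank x = (x - 3 * cyc) mod 2" if "3 * cyc \<le> x" for x
      using that by (auto simp: rank_def)
    ultimately show ?thesis using * by simp
  qed
  have nb: "f = end1 e \<or> nxt f = end1 e" if "adj e f" "2 * cyc \<le> e" "f < cyc" "e < size" for e f
  proof -
    have "end2 e = cyc + C + 1 + e" "nxt f < cyc" "end1 f = f" "end2 f = nxt f"
      using that by (auto simp: end1_def end2_def nxt_less)
    then show ?thesis using that(1,3) unfolding adj_def by auto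
  qed
  fix u v assume uv: "{u, v} \<in> edges (delete_verts graph sol)"
  then have uv': "adj u v" "u < size" "v < size" "u \<notin> sol" "v \<notin> sol"
    by (auto simp: delete_verts_edge graph_edge graph_verts)
  show "rank u \<noteq> rank v"
  proof (cases "u < cyc \<or> v < cyc")
    case True
    then show ?thesis
      using F[of u] F[of v] cc[of u v] uv' by (auto simp: rank_def)
  next
    case False
    then show ?thesis using F[of u] F[of v] adjD[of u v] uv' by auto
  qed
  fix w assume uw: "{u, w} \<in> edges (delete_verts graph sol)" and r: "rank u < rank v" "rank u < rank w"
  then have uw': "adj u w" "w < size" "w \<notin> sol"
    by (auto simp: delete_verts_edge graph_edge graph_verts)
  have u: "2 * cyc \<le> u" using F[of u] uv' r(1) by (auto simp: rank_def split: if_splits)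
  show "v = w"
  proof (cases "u < 3 * cyc")
    case True
    have "v < cyc" "w < cyc" using adjD[of u v] adjD[of u w] F[of v] F[of w] True u uv' uw' by auto
    moreover have "even v \<longleftrightarrow> \<not> a (v div len)" "even w \<longleftrightarrow> \<not> a (w div len)"
      using F[of v] F[of w] calculation uv' uw' by auto
    moreover have "v = end1 u \<or> nxt v = end1 u" "w = end1 u \<or> nxt w = end1 u"
      using nb[of u v] nb[of u w] calculation u uv' uw' by auto
    ultimately show ?thesis
      using nxt_inj[of v w] nxt_div[of v] nxt_div[of w] even_nxt[of v] even_nxt[of w] by metis
  next
    case False
    have "\<not> x < cyc" if "adj u x" for x
    proof
      assume "x < cyc"
      then have "x = end1 u \<or> nxt x = end1 u" "nxt x < cyc" using nb[of u x] that u uv' by (auto simp: nxt_less)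
      moreover have "cyc \<le> end1 u" using False by (auto simp: end1_def)
      ultimately show False using \<open>x < cyc\<close> by auto
    qed
    then have "\<not> v < cyc" "\<not> w < cyc" using uv' uw' by auto
    then have vw: "2 * cyc \<le> v" "2 * cyc \<le> w" using F[of v] F[of w] uv' uw' by auto
    have "end1 u < cyc + C + 1" "end1 v < cyc + C + 1" "end1 w < cyc + C + 1" using end1_less uv' uw' by auto
    moreover have "end2 u = cyc + C + 1 + u" "end2 v = cyc + C + 1 + v" "end2 w = cyc + C + 1 + w"
      using u vw by (auto simp: end2_def)
    ultimately have "end1 u = end1 v" "end1 u = end1 w" "u \<noteq> v" "u \<noteq> w"
      using uv'(1) uw'(1) by (auto simp: adj_def)
    moreover have "3 * cyc \<le> v" "3 * cyc \<le> w" using adjD[of u v] adjD[of u w] u vw uv' uw' by auto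
    ultimately have "(u - 3 * cyc) div 2 = (v - 3 * cyc) div 2" "(u - 3 * cyc) div 2 = (w - 3 * cyc) div 2"
      "u - 3 * cyc \<noteq> v - 3 * cyc" "u - 3 * cyc \<noteq> w - 3 * cyc"
      using False by (auto simp: end1_def)
    moreover have "y = z" if "x div 2 = y div 2" "x div 2 = z div 2" "x \<noteq> y" "x \<noteq> z" for x y z :: nat
    proof -
      have "x = 2 * (x div 2) + x mod 2" "y = 2 * (y div 2) + y mod 2" "z = 2 * (z div 2) + z mod 2" by simp_all
      moreover have "x mod 2 < 2" "y mod 2 < 2" "z mod 2 < 2" by simp_all
      ultimately show ?thesis using that by linarith
    qed
    ultimately have "v - 3 * cyc = w - 3 * cyc" by blast
    then show ?thesis using \<open>3 * cyc \<le> v\<close> \<open>3 * cyc \<le> w\<close> by simp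
  qed
qed

end

lemma satisfied_imp_cfvs:
  assumes "satisfied_by a"
  shows "\<exists>S. connected_feedback_vertex_set graph S \<and> card S \<le> 6 * V * C"
  unfolding connected_feedback_vertex_set_def feedback_vertex_set_def graph_verts
  using S_size[OF assms] card_S[OF assms] connected_S[OF assms] forest_S[OF assms] by blast

end

section \<open>From a connected feedback vertex set to a satisfying assignment\<close>

context gadget begin

text \<open>Three edges at a common vertex form a triangle in the line graph.\<close>

lemma deg_le_2:
  assumes "forest (delete_verts graph S)"
  shows "card {e \<in> {..<size} - S. v \<in> ends e} \<le> 2"
proof (rule ccontr)
  assume "\<not> ?thesis"
  then obtain T where T: "T \<subseteq> {e \<in> {..<size} - S. v \<in> ends e}" "card T = 3"
    using obtain_subset_with_card_n[of 3 "{e \<in> {..<size} - S. v \<in> ends e}"] by auto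
  then obtain x y z where xyz: "T = {x, y, z}" "x \<noteq> y" "x \<noteq> z" "y \<noteq> z"
    by (auto simp: card_3_iff)
  have edge: "{e, f} \<in> edges (delete_verts graph S)" if "e \<in> T" "f \<in> T" "e \<noteq> f" for e f
    using that T(1) adj_iff[of e f] by (auto simp: delete_verts_edge graph_edge graph_verts)
  have "is_cycle (delete_verts graph S) [x, y, z]"
    unfolding is_cycle_def
  proof (intro conjI allI impI)
    have "x \<in> T" "y \<in> T" "z \<in> T" using xyz(1) by auto
    then have e: "{x, y} \<in> edges (delete_verts graph S)" "{y, z} \<in> edges (delete_verts graph S)"
      "{z, x} \<in> edges (delete_verts graph S)"
      using edge xyz(2-4) by metis+
    fix i assume "i < length [x, y, z]"
    then have "i = 0 \<or> i = 1 \<or> i = 2" by auto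
    then show "{[x, y, z] ! i, [x, y, z] ! (Suc i mod length [x, y, z])} \<in> edges (delete_verts graph S)"
      using e by (elim disjE) (simp_all add: numeral_2_eq_2)
  qed (use xyz in auto)
  then show False using assms by (auto simp: forest_def)
qed

text \<open>Double counting over the cycle vertices and the hubs: edges below \<open>2 * cyc\<close>
  have both ends among them, a pendant edge only one.\<close>

lemma sum_deg:
  assumes "F \<subseteq> {..<size}"
  shows "(\<Sum>v<cyc + C + 1. card {e \<in> F. v \<in> ends e}) =
    2 * card (F \<inter> {..<2 * cyc}) + card (F \<inter> {2 * cyc..<size})"
proof -
  have fin: "finite F" using assms finite_subset by blast
  have c: "card {x \<in> A. P x} = (\<Sum>x\<in>A. of_bool (P x))" if "finite A" for A :: "nat set" and P
    using that by (simp add: of_bool_def sum.If_cases Int_def)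
  have "(\<Sum>v<cyc + C + 1. card {e \<in> F. v \<in> ends e}) = (\<Sum>v<cyc + C + 1. \<Sum>e\<in>F. of_bool (v \<in> ends e))"
    using fin by (simp add: c)
  also have "\<dots> = (\<Sum>e\<in>F. \<Sum>v<cyc + C + 1. of_bool (v \<in> ends e))" by (rule sum.swap)
  also have "\<dots> = (\<Sum>e\<in>F. card {v \<in> {..<cyc + C + 1}. v \<in> ends e})"
    by (simp only: c[OF finite_lessThan])
  also have "\<dots> = (\<Sum>e\<in>F. if e < 2 * cyc then 2 else 1)"
  proof (rule sum.cong[OF refl])
    fix e assume "e \<in> F"
    then have e: "e < size" using assms by auto
    have 1: "end1 e < cyc + C + 1" "end1 e \<noteq> end2 e" using end1_less[OF e] ends_neq[OF e] by auto
    show "card {v \<in> {..<cyc + C + 1}. v \<in> ends e} = (if e < 2 * cyc then 2 else 1)"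
    proof (cases "e < 2 * cyc")
      case True
      then have "end2 e < cyc + C + 1" using nxt_less[of e] hub_less[of "e - cyc"] by (auto simp: end2_def)
      then have "{v \<in> {..<cyc + C + 1}. v \<in> ends e} = {end1 e, end2 e}" using 1 by (auto simp: ends_def)
      then show ?thesis using 1 True by simp
    next
      case False
      then have "end2 e \<ge> cyc + C + 1" by (auto simp: end2_def)
      then have "{v \<in> {..<cyc + C + 1}. v \<in> ends e} = {end1 e}" using 1 by (auto simp: ends_def)
      then show ?thesis using False by simp
    qed
  qed
  also have "\<dots> = 2 * card (F \<inter> {..<2 * cyc}) + card (F \<inter> - {..<2 * cyc})"
    using fin by (simp add: sum.If_cases lessThan_def)
  also have "F \<inter> - {..<2 * cyc} = F \<inter> {2 * cyc..<size}" using assms by auto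
  finally show ?thesis .
qed

lemma cfvs_imp_satisfied:
  assumes cfvs: "connected_feedback_vertex_set graph S" and card: "card S \<le> 6 * V * C"
  shows "\<exists>a. satisfied_by a"
proof -
  have S: "S \<subseteq> {..<size}" and forest: "forest (delete_verts graph S)"
    and conn: "connected_graph (induced_subgraph graph S)"
    using cfvs by (auto simp: connected_feedback_vertex_set_def feedback_vertex_set_def graph_verts)
  define F where "F = {..<size} - S"
  have finF: "finite F" by (simp add: F_def)
  have deg: "card {e \<in> F. v \<in> ends e} \<le> 2" for v
    using deg_le_2[OF forest] unfolding F_def .
  \<comment> \<open>Half the number of cycle edges, named so that the arithmetic below avoids
    division.\<close>
  define h where "h = 2 * C * V"
  have cyc: "cyc = 2 * h" by (simp add: cyc_def len_def h_def)
  let ?A = "card (F \<inter> {..<2 * cyc})" and ?P = "card (F \<inter> {2 * cyc..<size})"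
  have AP: "?A + ?P = card F"
  proof -
    have "card F = card ((F \<inter> {..<2 * cyc}) \<union> (F \<inter> {2 * cyc..<size}))"
      by (rule arg_cong[where f = card]) (auto simp: F_def)
    also have "\<dots> = ?A + ?P" by (rule card_Un_disjoint) (use finF in auto)
    finally show ?thesis by simp
  qed
  have "card F = size - card S"
    unfolding F_def using S by (simp add: card_Diff_subset finite_subset[OF S])
  then have "card F \<ge> 3 * h + 2 * (C + 1)"
    using card by (simp add: size_def cyc h_def algebra_simps)
  moreover have "(\<Sum>v<cyc + C + 1. card {e \<in> F. v \<in> ends e}) \<le> (\<Sum>v<cyc + C + 1. 2)"
    by (rule sum_mono) (rule deg)
  then have "2 * ?A + ?P \<le> 2 * (cyc + C + 1)"
    by (subst sum_deg[symmetric]) (auto simp: F_def)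
  moreover have "?P \<le> card {2 * cyc..<size}" by (rule card_mono) auto
  then have "?P \<le> 2 * h + 2 * (C + 1)" by (simp add: size_def cyc)
  ultimately have bounds: "3 * h + 2 * (C + 1) \<le> card F" "2 * ?A + ?P \<le> 2 * (cyc + C + 1)" "?P \<le> 2 * h + 2 * (C + 1)"
    by blast+
  \<comment> \<open>Twice the lower bound on \<open>q + p\<close> minus the upper bound on
    \<open>2 * q + p\<close> leaves at least \<open>2 * h + 2 * (C + 1)\<close> for
    \<open>p\<close>. So the two upper bounds are attained.\<close>
  have arith: "p = 2 * h + 2 * (C + 1) \<and> 2 * q + p = 2 * (c + C + 1)"
    if "3 * h + 2 * (C + 1) \<le> f" "2 * q + p \<le> 2 * (c + C + 1)" "p \<le> 2 * h + 2 * (C + 1)" "q + p = f" "c = 2 * h"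
    for p q f c :: nat
    using that by auto
  have P: "?P = 2 * h + 2 * (C + 1)" and sum: "2 * ?A + ?P = 2 * (cyc + C + 1)"
    using arith[OF bounds AP cyc] by blast+
  have PF: "F \<inter> {2 * cyc..<size} = {2 * cyc..<size}"
    by (rule card_subset_eq) (use P in \<open>auto simp: size_def cyc\<close>)
  have pend: "e \<in> F" if "2 * cyc \<le> e" "e < size" for e
  proof -
    have "e \<in> {2 * cyc..<size}" using that by simp
    then have "e \<in> F \<inter> {2 * cyc..<size}" by (simp only: PF)
    then show ?thesis by (rule IntD1)
  qed
  have deg2: "card {e \<in> F. v \<in> ends e} = 2" if "v < cyc + C + 1" for v
  proof (rule ccontr)
    assume "card {e \<in> F. v \<in> ends e} \<noteq> 2"
    then have "card {e \<in> F. v \<in> ends e} < 2" using deg[of v] by linarith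
    then have "(\<Sum>v<cyc + C + 1. card {e \<in> F. v \<in> ends e}) < (\<Sum>v<cyc + C + 1. 2)"
      using deg that by (intro sum_strict_mono_ex1) auto
    then have "2 * ?A + ?P < 2 * (cyc + C + 1)"
      by (subst sum_deg[symmetric]) (auto simp: F_def)
    then show False using sum by simp
  qed
  \<comment> \<open>The two pendant edges at a hub already exhaust its degree.\<close>
  have att: "e \<in> S" if "cyc \<le> e" "e < 2 * cyc" for e
  proof (rule ccontr)
    assume "e \<notin> S"
    then have eF: "e \<in> F" using that by (auto simp: F_def size_def)
    let ?h = "hub (e - cyc)"
    let ?D = "{x \<in> F. cyc + ?h \<in> ends x}"
    let ?x = "3 * cyc + 2 * ?h" and ?y = "3 * cyc + 2 * ?h + 1"
    have h: "?h < C + 1" by (rule hub_less)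
    have "?x \<in> F" "?y \<in> F" using pend[of ?x] pend[of ?y] h by (auto simp: size_def)
    moreover have "end1 ?x = cyc + ?h" "end1 ?y = cyc + ?h" "end2 e = cyc + ?h"
      using that by (auto simp: end1_def end2_def)
    ultimately have "{e, ?x, ?y} \<subseteq> ?D" using eF by (auto simp: ends_def)
    moreover have "finite ?D" using finF by auto
    ultimately have "card {e, ?x, ?y} \<le> card ?D" by (rule card_mono[rotated])
    moreover have "card {e, ?x, ?y} = 3" using that by simp
    ultimately show False using deg[of "cyc + ?h"] by linarith
  qed
  \<comment> \<open>At \<open>nxt s\<close>, the pendant edge is in \<open>F\<close> and the joining
    edge is not. As the degree is two, exactly one of the two cycle edges is in
    \<open>F\<close>.\<close>
  have alt: "nxt s \<in> S \<longleftrightarrow> s \<notin> S" if s: "s < cyc" for s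
  proof -
    let ?v = "nxt s"
    have v: "?v < cyc" by (rule nxt_less[OF s])
    have "x = ?v \<or> x = s \<or> x = 2 * cyc + ?v" if "x \<in> F" "?v \<in> ends x" for x
    proof -
      have x: "x < size" "\<not> (cyc \<le> x \<and> x < 2 * cyc)" using that att by (auto simp: F_def)
      show ?thesis
      proof (cases "x < cyc")
        case True
        then show ?thesis using that(2) nxt_inj[of s x] by (auto simp: ends_def end1_def end2_def)
      next
        case False
        then have "end2 x = cyc + C + 1 + x" using x by (auto simp: end2_def)
        then have "end1 x = ?v" using that(2) v by (auto simp: ends_def)
        then show ?thesis using False x v by (auto simp: end1_def split: if_splits)
      qed
    qed
    moreover have "2 * cyc + ?v \<in> F" by (rule pend) (use v in \<open>auto simp: size_def\<close>)
    moreover have "?v \<in> ends ?v" "?v \<in> ends s" "?v \<in> ends (2 * cyc + ?v)"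
      using s v by (auto simp: ends_def end1_def end2_def)
    ultimately have D: "{x \<in> F. ?v \<in> ends x} = insert (2 * cyc + ?v) ({?v, s} \<inter> F)" by auto
    have "card (insert (2 * cyc + ?v) ({?v, s} \<inter> F)) = 2"
      unfolding D[symmetric] by (rule deg2) (use v in simp)
    then have c: "card ({?v, s} \<inter> F) = 1" using s v by (subst (asm) card_insert_disjoint) auto
    have "?v \<in> F \<longleftrightarrow> s \<notin> F"
    proof (cases "s \<in> F")
      case True
      then show ?thesis using c nxt_neq[of s] by (cases "?v \<in> F") auto
    next
      case False
      then show ?thesis using c by (cases "?v \<in> F") auto
    qed
    then show ?thesis using s v by (auto simp: F_def size_def)
  qed
  \<comment> \<open>Membership alternates along a cycle, so its first edge decides about all
    others.\<close>
  define a where "a i = (len * i \<in> S)" for i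
  have cycS: "e \<in> S \<longleftrightarrow> (even e \<longleftrightarrow> a (e div len))" if e: "e < cyc" for e
  proof -
    have "len * i + r \<in> S \<longleftrightarrow> (even r \<longleftrightarrow> a i)" if "i < V" "r < len" for i r
      using that(2)
    proof (induction r)
      case 0
      then show ?case by (simp add: a_def)
    next
      case (Suc r)
      have "Suc (len * i + r) mod len \<noteq> 0" using Suc.prems by (simp flip: add_Suc_right)
      then have "nxt (len * i + r) = len * i + Suc r" using nxt_Suc by simp
      moreover have "len * i + r < cyc" using that(1) Suc.prems by (simp add: less_cyc_iff)
      ultimately show ?case using alt[of "len * i + r"] Suc by (cases "even r"; cases "a i") simp_all
    qed
    from this[of "e div len" "e mod len"] e len_ge
    have "e \<in> S \<longleftrightarrow> (even (e mod len) \<longleftrightarrow> a (e div len))" by (simp add: less_cyc_iff)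
    moreover have "even (e mod len) \<longleftrightarrow> even e" by (simp add: len_def dvd_mod_iff)
    ultimately show ?thesis by simp
  qed
  have "satisfied_by a"
    unfolding satisfied_by_def
  proof (intro allI impI)
    fix j assume j: "j < C" and lit: "\<exists>i<V. pos i j \<or> neg i j"
    show "\<exists>i<V. pos i j \<and> a i \<or> neg i j \<and> \<not> a i"
    proof (rule ccontr)
      assume "\<not> ?thesis"
      then have U: "pos i j \<Longrightarrow> \<not> a i" "neg i j \<Longrightarrow> a i" if "i < V" for i using that by auto
      \<comment> \<open>If no literal of clause \<open>j\<close> is true, a cycle edge in
        \<open>S\<close> has both or none of its ends joined to the hub of \<open>j\<close>. The
        remainder modulo 4 fixes the parity of the edge, and the parity of an edge in
        \<open>S\<close> gives the truth value of its variable.\<close>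
      have hub_nxt: "hub (nxt e) = Suc j \<longleftrightarrow> hub e = Suc j" if e: "e < cyc" "e \<in> S" for e
      proof -
        let ?i = "e div len"
        have i: "?i < V" using e less_cyc_iff by simp
        have par: "even e \<longleftrightarrow> a ?i" using cycS e by simp
        have "e mod 4 < 4" by simp
        then consider "e mod 4 = 0" | "e mod 4 = 1" | "e mod 4 = 2" | "e mod 4 = 3" by linarith
        then show ?thesis
        proof cases
          case 1
          then have n: "nxt e = Suc e" "Suc e mod 4 = 1" "Suc e div 4 = e div 4" "even e"
            using nxt_Suc'[of e] by presburger+
          then have "Suc e div len = ?i" using nxt_div[of e] by simp
          then show ?thesis using 1 n U(1)[OF i] par by (auto simp: hub_def Let_def)
        next
          case 2
          then have n: "nxt e = Suc e" "Suc e mod 4 = 2" "Suc e div 4 = e div 4" "odd e"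
            using nxt_Suc'[of e] by presburger+
          then have "Suc e div len = ?i" using nxt_div[of e] by simp
          then show ?thesis using 2 n U(2)[OF i] par by (auto simp: hub_def Let_def)
        next
          case 3
          then have n: "nxt e = Suc e" "Suc e mod 4 = 3" "even e"
            using nxt_Suc'[of e] by presburger+
          then show ?thesis using 3 hub_3 U(1)[OF i] par by (auto simp: hub_def Let_def)
        next
          case 4
          then have n: "nxt e mod 4 = 0" "odd e" using nxt_mod_4[of e] by presburger+
          then show ?thesis using hub_3[OF 4] U(2)[OF i] par nxt_div[of e] by (auto simp: hub_def Let_def)
        qed
      qed
      \<comment> \<open>The marked vertices are the clause hub and the cycle vertices joined to it.
        No edge in \<open>S\<close> connects a marked with an unmarked vertex, so the part of
        \<open>S\<close> around this hub is cut off from the root.\<close>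
      define mark where "mark v = (if v < cyc then hub v = Suc j else v = cyc + Suc j)" for v
      have S2: "e < 2 * cyc" if "e \<in> S" for e
        using pend[of e] that S by (force simp: F_def not_less[symmetric])
      have mark: "mark (end1 e) \<longleftrightarrow> hub (end1 e) = Suc j" "mark (end2 e) \<longleftrightarrow> hub (end1 e) = Suc j"
        if e: "e \<in> S" for e
        using S2[OF e] hub_nxt[of e] nxt_less[of e] e by (auto simp: mark_def end1_def end2_def)
      let ?R = "\<lambda>x y. {x, y} \<in> edges (induced_subgraph graph S)"
      have closed: "hub (end1 f) = Suc j" if "?R e f" "hub (end1 e) = Suc j" for e f
      proof -
        have "e \<in> S" "f \<in> S" "adj e f" using that(1) graph_edge[of e f] by (auto simp: induced_subgraph_def)
        then show ?thesis using mark[of e] mark[of f] that(2) unfolding adj_def by metis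
      qed
      obtain i where i: "i < V" "pos i j \<or> neg i j" using lit by blast
      obtain r where r: "r < 4" "hub ((i * C + j) * 4 + r) = Suc j"
      proof (cases "pos i j")
        case True
        show ?thesis
        proof (rule that[of 2])
          show "hub ((i * C + j) * 4 + 2) = Suc j"
            using hub_index[OF i(1) j, of 2] True unfolding hub_def Let_def by simp
        qed simp
      next
        case False
        show ?thesis
        proof (rule that[of 0])
          show "hub ((i * C + j) * 4 + 0) = Suc j"
            using hub_index[OF i(1) j, of 0] False i(2) unfolding hub_def Let_def by simp
        qed simp
      qed
      let ?s = "(i * C + j) * 4 + r"
      have s: "?s < cyc" using hub_index[OF i(1) j r(1)] by simp
      have "cyc + ?s \<in> S" "cyc + 3 \<in> S" using att[of "cyc + ?s"] att[of "cyc + 3"] s cyc_3 by auto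
      then have "?R\<^sup>*\<^sup>* (cyc + ?s) (cyc + 3)"
        using conn S unfolding connected_graph_def by (auto simp: induced_subgraph_def graph_verts)
      then have "hub (end1 (cyc + 3)) = Suc j"
      proof (induction rule: rtranclp_induct)
        case base
        have "end1 (cyc + ?s) = ?s" unfolding end1_def using s by simp
        then show ?case using r(2) by simp
      qed (rule closed)
      moreover have "end1 (cyc + 3) = 3" unfolding end1_def using cyc_3 by simp
      ultimately show False using cyc_3 by simp
    qed
  qed
  then show ?thesis by blast
qed

theorem satisfiable_iff_cfvs:
  "(\<exists>a. satisfied_by a) \<longleftrightarrow> (\<exists>S. connected_feedback_vertex_set graph S \<and> card S \<le> 6 * V * C)"
  using satisfied_imp_cfvs cfvs_imp_satisfied by blast

end

section \<open>Computations as satisfiability\<close>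

type_synonym cell = "nat \<times> transition option \<times> nat list"

definition tape_at :: "tape \<Rightarrow> int \<Rightarrow> nat" where
  "tape_at tp z = fst tp (snd tp + z)"

text \<open>The blank and the bits are included because they occur on the initial tapes.\<close>

definition symbols :: "turing_machine \<Rightarrow> nat set" where
  "symbols M = {0, 1, 2} \<union> (\<Union>(q, rs, q', as)\<in>transitions M. fst ` set as)"

definition states :: "turing_machine \<Rightarrow> nat set" where
  "states M = {start_state M} \<union> (\<lambda>(q, rs, q', as). q') ` transitions M"

text \<open>The rows of a tableau are the times and its columns the tape positions, counted relative to the heads: at any
  time, column \<open>T\<close> contains the symbols that the heads read, and a head movement shifts the contents of its
  tape. A cell consists of the state, the transition that is about to be performed (\<open>None\<close> for a pause), which
  are constant on each row, and the symbols on all tapes.\<close>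

definition cells :: "turing_machine \<Rightarrow> cell set" where
  "cells M = states M \<times> insert None (Some ` transitions M) \<times> {cs. set cs \<subseteq> symbols M \<and> length cs = num_tapes M}"

text \<open>Column \<open>T\<close> is cell \<open>0\<close> of the tape, where the head
  starts.\<close>

definition input_sym :: "bool list \<Rightarrow> nat \<Rightarrow> nat \<Rightarrow> nat" where
  "input_sym x T z = (if T \<le> z \<and> z - T < length x then bit_symbol (x ! (z - T)) else 0)"

fun next_state :: "cell \<Rightarrow> nat" where
  "next_state (q, None, c) = q"
| "next_state (q, Some (q1, rs, q', as), c) = q'"

fun cell_act :: "cell \<Rightarrow> nat \<Rightarrow> action" where
  "cell_act (q, None, c) j = (c ! j, Stay)"
| "cell_act (q, Some (q1, rs, q', as), c) j = as ! j"

text \<open>The constraints on pairs of cells: the initial row (\<open>\<kappa>\<close> is the input symbol), the final state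
  (\<open>\<kappa> = 3\<close>), applicability of the transition (\<open>\<kappa> = 4\<close>), constancy on a row (\<open>\<kappa> = 5\<close>), and the passage to the
  next row by a shift of \<open>\<kappa> - 7\<close> or, for the symbols under the heads, \<open>\<kappa> - 10\<close>.\<close>

definition kind_cond :: "bool list \<Rightarrow> nat \<Rightarrow> nat \<Rightarrow> nat \<Rightarrow> nat \<Rightarrow> nat \<Rightarrow> nat \<Rightarrow> bool" where
  "kind_cond x T \<kappa> t z t' z' \<longleftrightarrow>
     (if \<kappa> < 3 then t = 0 \<and> t' = t \<and> z' = z \<and> input_sym x T z = \<kappa>
      else if \<kappa> = 3 then t = T \<and> t' = t \<and> z' = z
      else if \<kappa> = 4 then z = T \<and> t' = t \<and> z' = z
      else if \<kappa> = 5 then t' = t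
      else if \<kappa> < 9 then t' = t + 1 \<and> z \<noteq> T \<and> z + 7 = z' + \<kappa>
      else t' = t + 1 \<and> z = T \<and> z + 10 = z' + \<kappa>)"

definition kind_ok :: "turing_machine \<Rightarrow> nat \<Rightarrow> cell \<Rightarrow> cell \<Rightarrow> bool" where
  "kind_ok M \<kappa> a a' \<longleftrightarrow>
     (if \<kappa> < 3 then fst a = start_state M \<and> snd (snd a) = \<kappa> # replicate (num_tapes M - 1) 0
      else if \<kappa> = 3 then fst a = accept_state M
      else if \<kappa> = 4 then (case fst (snd a) of None \<Rightarrow> True | Some (q1, rs, q', as) \<Rightarrow> q1 = fst a \<and> rs = snd (snd a))
      else if \<kappa> = 5 then fst a = fst a' \<and> fst (snd a) = fst (snd a')
      else fst a' = next_state a \<and>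
        (\<forall>j<num_tapes M. move_offset (snd (cell_act a j)) = int \<kappa> - (if \<kappa> < 9 then 7 else 10) \<longrightarrow>
           snd (snd a') ! j = (if \<kappa> < 9 then snd (snd a) ! j else fst (cell_act a j))))"

text \<open>In \<open>T\<close> steps a head moves at most \<open>T\<close> cells, so
  \<open>T\<close> columns on either side of the head position suffice.\<close>

definition tableau :: "turing_machine \<Rightarrow> bool list \<Rightarrow> nat \<Rightarrow> (nat \<Rightarrow> nat \<Rightarrow> cell) \<Rightarrow> bool" where
  "tableau M x T g \<longleftrightarrow> (\<forall>t\<le>T. \<forall>z<2 * T + 1. g t z \<in> cells M) \<and>
     (\<forall>\<kappa><12. \<forall>t\<le>T. \<forall>z<2 * T + 1. \<forall>t'\<le>T. \<forall>z'<2 * T + 1.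
        kind_cond x T \<kappa> t z t' z' \<longrightarrow> kind_ok M \<kappa> (g t z) (g t' z'))"

section \<open>Tableaux and accepting computations\<close>

lemma tape_at_perform:
  "z + move_offset d = w \<Longrightarrow> tape_at (perform (s, d) tp) z = (if w = 0 then s else tape_at tp w)"
  by (cases tp) (auto simp: tape_at_def algebra_simps)

lemma head_symbol_tape_at: "head_symbol tp = tape_at tp 0"
  by (cases tp) (simp add: tape_at_def)

lemma finite_cells: "wf_tm M \<Longrightarrow> finite (cells M)"
  unfolding cells_def wf_tm_def
  by (intro finite_cartesian_product finite_lists_length_eq) (auto simp: states_def symbols_def)

definition tapes_in :: "turing_machine \<Rightarrow> config \<Rightarrow> bool" where
  "tapes_in M c \<longleftrightarrow> fst c \<in> states M \<and> length (snd c) = num_tapes M \<and>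
     (\<forall>tp\<in>set (snd c). \<forall>z. fst tp z \<in> symbols M)"

lemma tapes_in_step:
  assumes "wf_tm M" "tm_step M c c'" "tapes_in M c"
  shows "tapes_in M c'"
  using assms(2)
proof cases
  case (1 q ts q' as)
  then have len: "length as = num_tapes M" and tr: "fst ` set as \<subseteq> symbols M" "q' \<in> states M"
    using assms(1) unfolding wf_tm_def symbols_def states_def by (fastforce, force, force)
  have "fst (perform a tp) z \<in> symbols M" if "a \<in> set as" "tp \<in> set ts" for a tp z
  proof -
    have "fst tp z \<in> symbols M" using assms(3) 1 that by (auto simp: tapes_in_def)
    moreover have "fst a \<in> symbols M" using tr that by auto
    ultimately show ?thesis by (cases a; cases tp) auto
  qed
  moreover have "\<exists>a tp'. tp = perform a tp' \<and> a \<in> set as \<and> tp' \<in> set ts" if "tp \<in> set (map2 perform as ts)" for tp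
  proof -
    obtain a tp' where "(a, tp') \<in> set (zip as ts)" "tp = perform a tp'"
      using \<open>tp \<in> set (map2 perform as ts)\<close> by (auto simp del: perform.simps)
    then show ?thesis using set_zip_leftD set_zip_rightD by metis
  qed
  ultimately have "\<forall>tp\<in>set (map2 perform as ts). \<forall>z. fst tp z \<in> symbols M" by blast
  then show ?thesis using 1 len tr assms(3) by (simp add: tapes_in_def)
qed

lemma tapes_in_initial: "wf_tm M \<Longrightarrow> tapes_in M (initial_config M x)"
  by (auto simp: tapes_in_def initial_config_def wf_tm_def states_def symbols_def input_tape_def bit_symbol_def)

lemma tape_at_input: "tape_at (input_tape x) (int z - int T) = input_sym x T z"
  by (auto simp: tape_at_def input_tape_def input_sym_def nat_diff_distrib)

lemma accepts_imp_tableau: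
  assumes M: "wf_tm M" and acc: "accepts_within M x T"
  shows "\<exists>g. tableau M x T g"
proof -
  let ?k = "num_tapes M"
  obtain t0 ts0 where t0: "t0 \<le> T" "(tm_step M ^^ t0) (initial_config M x) (accept_state M, ts0)"
    using acc unfolding accepts_within_def by blast
  then obtain f where f: "f 0 = initial_config M x" "f t0 = (accept_state M, ts0)"
    "\<And>i. i < t0 \<Longrightarrow> tm_step M (f i) (f (Suc i))"
    unfolding relpowp_fun_conv by blast
  have in_f: "tapes_in M (f i)" if "i \<le> t0" for i
    using that by (induction i) (auto simp: f(1) tapes_in_initial M intro: tapes_in_step[OF M f(3)])
  have "\<exists>tr. tr \<in> transitions M \<and> fst tr = fst (f i) \<and> fst (snd tr) = map head_symbol (snd (f i)) \<and>
      f (Suc i) = (fst (snd (snd tr)), map2 perform (snd (snd (snd tr))) (snd (f i)))" if "i < t0" for i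
    using f(3)[OF that] by cases force
  then obtain tr where tr: "tr i \<in> transitions M" "fst (tr i) = fst (f i)"
    "fst (snd (tr i)) = map head_symbol (snd (f i))"
    "f (Suc i) = (fst (snd (snd (tr i))), map2 perform (snd (snd (snd (tr i)))) (snd (f i)))" if "i < t0" for i
    by metis
  \<comment> \<open>The accepting run may be shorter than \<open>T\<close>, and further steps may be
    possible from its last configuration. That configuration is frozen by pauses until time
    \<open>T\<close>.\<close>
  define conf where "conf t = f (min t t0)" for t
  define tau where "tau t = (if t < t0 then Some (tr t) else None)" for t
  define g where "g t z = (fst (conf t), tau t, map (\<lambda>tp. tape_at tp (int z - int T)) (snd (conf t)))" for t z
  have in_conf: "tapes_in M (conf t)" for t unfolding conf_def by (rule in_f) simp
  then have len: "length (snd (conf t)) = ?k" for t by (simp add: tapes_in_def)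
  have "g t z \<in> cells M" for t z
    using in_conf[of t] tr(1)[of t] by (auto simp: g_def cells_def tapes_in_def tape_at_def tau_def)
  moreover have "kind_ok M \<kappa> (g t z) (g t' z')"
    if "\<kappa> < 12" "t \<le> T" "z < 2 * T + 1" "t' \<le> T" "z' < 2 * T + 1" "kind_cond x T \<kappa> t z t' z'" for \<kappa> t z t' z'
  proof -
    consider "\<kappa> < 3" | "\<kappa> = 3" | "\<kappa> = 4" | "\<kappa> = 5" | "6 \<le> \<kappa>" by linarith
    then show ?thesis
    proof cases
      case 1
      then have "t = 0" "input_sym x T z = \<kappa>" using that(6) by (auto simp: kind_cond_def)
      moreover have "input_sym [] T z = 0" by (simp add: input_sym_def)
      ultimately show ?thesis
        using 1 by (simp add: kind_ok_def g_def conf_def f(1) initial_config_def tape_at_input)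
    next
      case 2
      then have "t = T" using that(6) by (auto simp: kind_cond_def)
      then show ?thesis using 2 t0(1) by (simp add: kind_ok_def g_def conf_def f(2) min_def)
    next
      case 3
      then have "z = T" using that(6) by (auto simp: kind_cond_def)
      then show ?thesis using 3 tr(2,3)[of t]
        by (cases "tr t") (auto simp: kind_ok_def g_def tau_def conf_def head_symbol_tape_at min_def)
    next
      case 4
      then have "t' = t" using that(6) by (auto simp: kind_cond_def)
      then show ?thesis using 4 by (simp add: kind_ok_def g_def)
    next
      case 5
      then have t': "t' = Suc t" and z: "int z - int z' = int \<kappa> - (if \<kappa> < 9 then 7 else 10)" "z = T \<longleftrightarrow> \<not> \<kappa> < 9"
        using that(6) by (auto simp: kind_cond_def split: if_splits)
      show ?thesis
      proof (cases "t < t0")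
        case True
        obtain q1 rs q' as where e: "tr t = (q1, rs, q', as)" by (cases "tr t")
        have c: "conf t = f t" "conf t' = f (Suc t)" using True t' by (auto simp: conf_def min_def)
        have "f (Suc t) = (q', map2 perform as (snd (f t)))" using tr(4)[OF True] e by simp
        moreover have "length as = ?k" using tr(1)[OF True] e M unfolding wf_tm_def by fastforce
        ultimately have *: "snd (snd (g t' z')) ! j = tape_at (perform (as ! j) (snd (f t) ! j)) (int z' - int T)"
          "fst (g t' z') = q'" if "j < ?k" for j
          using that len[of t] unfolding g_def c by simp_all
        have "fst (g t' z') = q'" using \<open>f (Suc t) = _\<close> unfolding g_def c by simp
        moreover have "g t z = (fst (f t), Some (q1, rs, q', as), map (\<lambda>tp. tape_at tp (int z - int T)) (snd (f t)))"
          using True e c by (simp add: g_def tau_def)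
        moreover have "snd (snd (g t' z')) ! j = (if \<kappa> < 9 then map (\<lambda>tp. tape_at tp (int z - int T)) (snd (f t)) ! j else fst (as ! j))"
          if j: "j < ?k" and m: "move_offset (snd (as ! j)) = int \<kappa> - (if \<kappa> < 9 then 7 else 10)" for j
        proof -
          have "int z' - int T + move_offset (snd (as ! j)) = int z - int T" using m z(1) by simp
          from tape_at_perform[OF this, of "fst (as ! j)" "snd (f t) ! j"] show ?thesis
            using *(1)[OF j] z(2) j len[of t] c by auto
        qed
        ultimately show ?thesis using 5 by (auto simp: kind_ok_def)
      next
        case False
        then have c: "conf t' = conf t" "tau t = None" using t' by (auto simp: conf_def tau_def)
        have "snd (snd (g t' z')) ! j = snd (snd (g t z)) ! j"
          if "0 = int \<kappa> - (if \<kappa> < 9 then 7 else 10)" for j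
          using that z(1) c by (simp add: g_def)
        then show ?thesis using 5 c by (auto simp: kind_ok_def g_def)
      qed
    qed
  qed
  ultimately show ?thesis unfolding tableau_def by blast
qed

text \<open>The symbols that enter at the margins are unconstrained, so the rows are known to be
  correct only in a window that shrinks by one column on either side per step. At time
  \<open>T\<close> it still contains column \<open>T\<close>. Pauses are skipped, hence a run of at
  most \<open>t\<close> steps for row \<open>t\<close>.\<close>

lemma tableau_imp_accepts:
  assumes M: "wf_tm M" and g: "tableau M x T g"
  shows "accepts_within M x T"
proof -
  let ?k = "num_tapes M"
  have cell: "g t z \<in> cells M" if "t \<le> T" "z < 2 * T + 1" for t z
    using g that unfolding tableau_def by blast
  have ok: "kind_ok M \<kappa> (g t z) (g t' z')"
    if "\<kappa> < 12" "t \<le> T" "z < 2 * T + 1" "t' \<le> T" "z' < 2 * T + 1" "kind_cond x T \<kappa> t z t' z'" for \<kappa> t z t' z'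
    using g that unfolding tableau_def by blast
  have k: "0 < ?k" using M by (simp add: wf_tm_def)
  have "\<exists>n\<le>t. \<exists>ts. (tm_step M ^^ n) (initial_config M x) (fst (g t T), ts) \<and> length ts = ?k \<and>
      (\<forall>z j. t \<le> z \<longrightarrow> z + t \<le> 2 * T \<longrightarrow> j < ?k \<longrightarrow> snd (snd (g t z)) ! j = tape_at (ts ! j) (int z - int T))"
    if "t \<le> T" for t
    using that
  proof (induction t)
    case 0
    have *: "fst (g 0 z) = start_state M" "snd (snd (g 0 z)) = input_sym x T z # replicate (?k - 1) 0"
      if "z \<le> 2 * T" for z
    proof -
      have "input_sym x T z < 3" by (simp add: input_sym_def bit_symbol_def)
      then show "fst (g 0 z) = start_state M" "snd (snd (g 0 z)) = input_sym x T z # replicate (?k - 1) 0"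
        using ok[of "input_sym x T z" 0 z 0 z] that by (auto simp: kind_cond_def kind_ok_def)
    qed
    have "input_sym [] T z = 0" for z by (simp add: input_sym_def)
    then have "(input_sym x T z # replicate (?k - 1) 0) ! j =
        tape_at ((input_tape x # replicate (?k - 1) (input_tape [])) ! j) (int z - int T)" if "j < ?k" for z j
      using that by (cases j) (auto simp: tape_at_input)
    then show ?case
      using * k by (intro exI[of _ 0] exI[of _ "input_tape x # replicate (?k - 1) (input_tape [])"] conjI)
        (auto simp: initial_config_def)
  next
    case (Suc t)
    then obtain n ts where n: "n \<le> t" "(tm_step M ^^ n) (initial_config M x) (fst (g t T), ts)"
      and len: "length ts = ?k"
      and sym: "\<And>z j. t \<le> z \<Longrightarrow> z + t \<le> 2 * T \<Longrightarrow> j < ?k \<Longrightarrow> snd (snd (g t z)) ! j = tape_at (ts ! j) (int z - int T)"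
      by auto
    have t: "t < T" using Suc.prems by simp
    have row: "fst (g t z) = fst (g t T)" "fst (snd (g t z)) = fst (snd (g t T))" if "z < 2 * T + 1" for z
      using ok[of 5 t z t T] that t by (auto simp: kind_cond_def kind_ok_def)
    have nextq: "fst (g (Suc t) T) = next_state (g t T)"
      using ok[of 10 t T "Suc t" T] t by (auto simp: kind_cond_def kind_ok_def)
    have nexts: "snd (snd (g (Suc t) z')) ! j = (if z = T then fst (cell_act (g t z) j) else snd (snd (g t z)) ! j)"
      if "j < ?k" "move_offset (snd (cell_act (g t z) j)) = int z - int z'" "z < 2 * T + 1" "z' < 2 * T + 1" for z z' j
    proof -
      define d where "d = snd (cell_act (g t z) j)"
      \<comment> \<open>The kind encodes the shift: \<open>6, 7, 8\<close> away from the heads and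
        \<open>9, 10, 11\<close> under them.\<close>
      define \<kappa> where "\<kappa> = nat (int z - int z' + (if z = T then 10 else 7))"
      have "move_offset d \<in> {-1, 0, 1}" by (cases d) auto
      then have dz: "int z - int z' \<in> {-1, 0, 1}" using that(2) unfolding d_def by simp
      then have \<kappa>: "int \<kappa> = int z - int z' + (if z = T then 10 else 7)" "\<kappa> < 12" "6 \<le> \<kappa>" "\<kappa> < 9 \<longleftrightarrow> z \<noteq> T"
        unfolding \<kappa>_def by (auto split: if_splits)
      have "kind_cond x T \<kappa> t z (Suc t) z'"
        using \<kappa> by (auto simp: kind_cond_def split: if_splits)
      then have "kind_ok M \<kappa> (g t z) (g (Suc t) z')" using ok[of \<kappa> t z "Suc t" z'] that t \<kappa> by auto
      then show ?thesis using \<kappa> that(1,2) by (auto simp: kind_ok_def split: if_splits)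
    qed
    obtain q \<tau> c where gT: "g t T = (q, \<tau>, c)" by (cases "g t T")
    have gz: "g t z = (q, \<tau>, snd (snd (g t z)))" if "z < 2 * T + 1" for z
      using row[OF that] gT by (cases "g t z") auto
    show ?case
    proof (cases \<tau>)
      case None
      have "snd (snd (g (Suc t) z)) ! j = tape_at (ts ! j) (int z - int T)"
        if "Suc t \<le> z" "z + Suc t \<le> 2 * T" "j < ?k" for z j
      proof -
        have "cell_act (g t z) j = (snd (snd (g t z)) ! j, Stay)"
          using that by (subst gz) (auto simp: None)
        then show ?thesis using nexts[of j z z] sym[of z j] that by auto
      qed
      moreover have "fst (g (Suc t) T) = fst (g t T)" using nextq gT None by simp
      ultimately show ?thesis using n len by (intro exI[of _ n] exI[of _ ts]) auto
    next
      case (Some tr)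
      obtain q1 rs q' as where tr: "tr = (q1, rs, q', as)" by (cases tr)
      have trM: "(q1, rs, q', as) \<in> transitions M"
        using cell[of t T] t gT Some tr by (auto simp: cells_def)
      have lens: "length as = ?k" "length c = ?k"
        using trM M cell[of t T] t gT by (auto simp: wf_tm_def cells_def)
      have "q1 = q" "rs = c" using ok[of 4 t T t T] t gT Some tr by (auto simp: kind_cond_def kind_ok_def)
      moreover have "c = map head_symbol ts"
        by (rule nth_equalityI) (use lens len sym[of T] gT t in \<open>auto simp: head_symbol_tape_at\<close>)
      ultimately have "tm_step M (q, ts) (q', map2 perform as ts)"
        using trM by (auto intro: tm_step.intros)
      then have "(tm_step M ^^ Suc n) (initial_config M x) (q', map2 perform as ts)"
        using n(2) gT by (auto intro: relpowp_Suc_I)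
      moreover have "fst (g (Suc t) T) = q'" using nextq gT Some tr by simp
      moreover have "snd (snd (g (Suc t) z')) ! j = tape_at (map2 perform as ts ! j) (int z' - int T)"
        if z': "Suc t \<le> z'" "z' + Suc t \<le> 2 * T" and j: "j < ?k" for z' j
      proof -
        obtain s d where sd: "as ! j = (s, d)" by (cases "as ! j")
        define z where "z = nat (int z' + move_offset d)"
        have "move_offset d \<in> {-1, 0, 1}" by (cases d) auto
        then have z: "int z = int z' + move_offset d" "t \<le> z" "z + t \<le> 2 * T"
          using z' unfolding z_def by auto
        have act: "cell_act (g t z) j = (s, d)"
          using z by (subst gz) (auto simp: Some tr sd)
        have "snd (snd (g (Suc t) z')) ! j = (if z = T then s else snd (snd (g t z)) ! j)"
          using nexts[of j z z'] act z j z' by auto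
        also have "\<dots> = (if z = T then s else tape_at (ts ! j) (int z - int T))"
          using sym[OF z(2,3) j] by simp
        also have "\<dots> = tape_at (map2 perform as ts ! j) (int z' - int T)"
          using j lens len sd tape_at_perform[of "int z' - int T" d "int z - int T" s "ts ! j"] z(1) by auto
        finally show ?thesis .
      qed
      ultimately show ?thesis using n(1) len lens
        by (intro exI[of _ "Suc n"] exI[of _ "map2 perform as ts"]) auto
    qed
  qed
  from this[of T] obtain n ts where n: "n \<le> T" "(tm_step M ^^ n) (initial_config M x) (fst (g T T), ts)" by auto
  moreover have "fst (g T T) = accept_state M"
    using ok[of 3 T T T T] by (auto simp: kind_cond_def kind_ok_def)
  ultimately show ?thesis unfolding accepts_within_def by auto
qed


section \<open>Clauses for tableaux\<close>

lemma digit_pair_less: "u < U \<Longrightarrow> b < B \<Longrightarrow> u * B + b < U * (B :: nat)"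
proof -
  assume "u < U" "b < B"
  then have "u * B + b < Suc u * B" by simp
  also have "\<dots> \<le> U * B" using \<open>u < U\<close> by (intro mult_le_mono1) simp
  finally show ?thesis .
qed

text \<open>Constraints on a single cell appear among the pairs as well; for \<open>v = v'\<close>
  the resulting clause has just one literal.\<close>

definition conflict :: "(nat \<Rightarrow> nat \<Rightarrow> nat \<Rightarrow> bool) \<Rightarrow> nat \<Rightarrow> bool list \<Rightarrow> nat \<Rightarrow> nat \<Rightarrow> nat \<Rightarrow> bool" where
  "conflict ok B x T v v' \<longleftrightarrow>
     (let u = v div B; u' = v' div B; W = 2 * T + 1 in
      \<exists>\<kappa><12. kind_cond x T \<kappa> (u div W) (u mod W) (u' div W) (u' mod W) \<and> \<not> ok \<kappa> (v mod B) (v' mod B))"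

definition num_vars :: "nat \<Rightarrow> nat \<Rightarrow> nat" where
  "num_vars B T = (T + 1) * (2 * T + 1) * B"

text \<open>There is one clause for each cell and one for each ordered pair of variables. A pair
  without conflict leaves its clause without literals, which counts as satisfied; this keeps the
  numbering uniform.\<close>

definition num_clauses :: "nat \<Rightarrow> nat \<Rightarrow> nat" where
  "num_clauses B T = (T + 1) * (2 * T + 1) + num_vars B T * num_vars B T"

text \<open>Variable \<open>u * B + b\<close> says that cell \<open>u\<close> may have value \<open>b\<close>. The first clauses say that each cell has a value, the
  others exclude conflicting pairs; it does no harm if a cell has several values.\<close>

definition pos_lit :: "nat \<Rightarrow> nat \<Rightarrow> nat \<Rightarrow> nat \<Rightarrow> bool" where
  "pos_lit B T i j \<longleftrightarrow> j < (T + 1) * (2 * T + 1) \<and> i div B = j"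

definition neg_lit :: "(nat \<Rightarrow> nat \<Rightarrow> nat \<Rightarrow> bool) \<Rightarrow> nat \<Rightarrow> bool list \<Rightarrow> nat \<Rightarrow> nat \<Rightarrow> nat \<Rightarrow> bool" where
  "neg_lit ok B x T i j \<longleftrightarrow> (T + 1) * (2 * T + 1) \<le> j \<and>
     (let l = j - (T + 1) * (2 * T + 1); v = l div num_vars B T; v' = l mod num_vars B T in
      conflict ok B x T v v' \<and> (i = v \<or> i = v'))"

lemma satisfiable_iff_tableau:
  fixes val :: "nat \<Rightarrow> cell"
  assumes val: "bij_betw val {..<B} (cells M)" and B: "0 < B"
  defines "ok \<equiv> \<lambda>\<kappa> b b'. kind_ok M \<kappa> (val b) (val b')"
  shows "(\<exists>a. gadget_defs.satisfied_by (num_vars B T) (num_clauses B T) (pos_lit B T) (neg_lit ok B x T) a) \<longleftrightarrow>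
    (\<exists>g. tableau M x T g)" (is "?L \<longleftrightarrow> ?R")
proof -
  let ?W = "2 * T + 1"
  define U where "U = (T + 1) * ?W"
  define V where "V = num_vars B T"
  have V: "V = U * B" by (simp add: V_def U_def num_vars_def)
  have C: "num_clauses B T = U + V * V" by (simp add: V_def U_def num_clauses_def)
  have pos: "pos_lit B T i j \<longleftrightarrow> j < U \<and> i div B = j" for i j by (simp add: pos_lit_def U_def)
  have neg: "neg_lit ok B x T i j \<longleftrightarrow> U \<le> j \<and> conflict ok B x T ((j - U) div V) ((j - U) mod V) \<and>
      (i = (j - U) div V \<or> i = (j - U) mod V)" for i j
    by (simp add: neg_lit_def U_def V_def Let_def)
  have node: "u div ?W \<le> T" "u mod ?W < 2 * T + 1" if "u < U" for u
  proof -
    have "u div ?W < T + 1" using that unfolding U_def by (intro less_mult_imp_div_less) simp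
    then show "u div ?W \<le> T" by simp
  qed simp
  have sat: "gadget_defs.satisfied_by (num_vars B T) (num_clauses B T) (pos_lit B T) (neg_lit ok B x T) a \<longleftrightarrow>
      (\<forall>u<U. \<exists>b<B. a (u * B + b)) \<and> (\<forall>v<V. \<forall>v'<V. conflict ok B x T v v' \<longrightarrow> \<not> (a v \<and> a v'))"
    (is "?S \<longleftrightarrow> ?A \<and> ?C") for a
  proof
    assume S: ?S
    show "?A \<and> ?C"
    proof (intro conjI allI impI)
      fix u assume u: "u < U"
      have "u * B + 0 < V" unfolding V by (rule digit_pair_less[OF u B])
      then have "\<exists>i<V. pos_lit B T i u \<or> neg_lit ok B x T i u"
        using u B by (intro exI[of _ "u * B + 0"]) (auto simp: pos)
      then obtain i where "i < V" "pos_lit B T i u \<and> a i \<or> neg_lit ok B x T i u \<and> \<not> a i"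
        using S u unfolding gadget_defs.satisfied_by_def C V_def[symmetric] by (meson trans_less_add1)
      then have "i div B = u" "a i" using u by (auto simp: pos neg)
      then show "\<exists>b<B. a (u * B + b)" using B by (intro exI[of _ "i mod B"]) auto
    next
      fix v v' assume v: "v < V" "v' < V" "conflict ok B x T v v'"
      let ?j = "U + (v * V + v')"
      have j: "?j < U + V * V" using digit_pair_less[OF v(1,2)] by simp
      have d: "(?j - U) div V = v" "(?j - U) mod V = v'" using v by auto
      have "\<exists>i<V. pos_lit B T i ?j \<or> neg_lit ok B x T i ?j"
        using v by (intro exI[of _ v]) (auto simp only: neg d pos)
      then obtain i where "i < V" "pos_lit B T i ?j \<and> a i \<or> neg_lit ok B x T i ?j \<and> \<not> a i"
        using S j unfolding gadget_defs.satisfied_by_def C V_def[symmetric] by meson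
      then show "\<not> (a v \<and> a v')" unfolding neg d pos by auto
    qed
  next
    assume AC: "?A \<and> ?C"
    show ?S
      unfolding gadget_defs.satisfied_by_def C V_def[symmetric]
    proof (intro allI impI)
      fix j assume j: "j < U + V * V" and ex: "\<exists>i<V. pos_lit B T i j \<or> neg_lit ok B x T i j"
      show "\<exists>i<V. pos_lit B T i j \<and> a i \<or> neg_lit ok B x T i j \<and> \<not> a i"
      proof (cases "j < U")
        case True
        then obtain b where "b < B" "a (j * B + b)" using AC by blast
        then show ?thesis using True digit_pair_less[OF True, of b B]
          by (intro exI[of _ "j * B + b"]) (auto simp: pos V)
      next
        case False
        let ?v = "(j - U) div V" and ?v' = "(j - U) mod V"
        have c: "conflict ok B x T ?v ?v'" using ex False by (auto simp: pos neg)
        have "j - U < V * V" using j False by simp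
        moreover have "0 < V" using calculation by (cases V) auto
        ultimately have v: "?v < V" "?v' < V" by (auto simp: less_mult_imp_div_less)
        then have "\<not> a ?v \<or> \<not> a ?v'" using AC c by blast
        then show ?thesis
        proof
          assume "\<not> a ?v"
          then show ?thesis using v c False by (intro exI[of _ ?v]) (simp add: neg not_less)
        next
          assume "\<not> a ?v'"
          then show ?thesis using v c False by (intro exI[of _ ?v']) (simp add: neg not_less)
        qed
      qed
    qed
  qed
  show ?thesis
  proof
    assume ?L
    then obtain a where a: "\<And>u. u < U \<Longrightarrow> \<exists>b<B. a (u * B + b)"
      "\<And>v v'. v < V \<Longrightarrow> v' < V \<Longrightarrow> conflict ok B x T v v' \<Longrightarrow> \<not> (a v \<and> a v')"
      unfolding sat by blast
    then obtain h where h: "\<And>u. u < U \<Longrightarrow> h u < B \<and> a (u * B + h u)" by metis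
    define g where "g t z = val (h (t * ?W + z))" for t z
    have U: "t * ?W + z < U" if "t \<le> T" "z < ?W" for t z
      unfolding U_def using that by (intro digit_pair_less) auto
    have "tableau M x T g"
      unfolding tableau_def
    proof (intro conjI allI impI)
      fix t z assume "t \<le> T" "z < ?W"
      then show "g t z \<in> cells M" using h[OF U] val by (auto simp: g_def bij_betw_def)
    next
      fix \<kappa> t z t' z' assume *: "\<kappa> < (12::nat)" "t \<le> T" "z < ?W" "t' \<le> T" "z' < ?W" "kind_cond x T \<kappa> t z t' z'"
      let ?u = "t * ?W + z" and ?u' = "t' * ?W + z'"
      let ?v = "?u * B + h ?u" and ?v' = "?u' * B + h ?u'"
      have u: "?u < U" "?u' < U" using U * by auto
      note hu = h[OF u(1)] and hu' = h[OF u(2)]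
      have "?v < V" "?v' < V" unfolding V using hu hu' u by (auto intro: digit_pair_less)
      then have "\<not> conflict ok B x T ?v ?v'" using a(2) hu hu' by blast
      moreover have "?v div B = ?u" "?v mod B = h ?u" "?v' div B = ?u'" "?v' mod B = h ?u'" using hu hu' by auto
      moreover have "?u div ?W = t" "?u mod ?W = z" "?u' div ?W = t'" "?u' mod ?W = z'"
        using * by (simp_all del: mult_Suc_right add_mult_distrib2)
      ultimately have "ok \<kappa> (h ?u) (h ?u')" using * unfolding conflict_def Let_def by simp
      then show "kind_ok M \<kappa> (g t z) (g t' z')" by (simp add: ok_def g_def)
    qed
    then show ?R by blast
  next
    assume ?R
    then obtain g where g: "tableau M x T g" by blast
    define h where "h u = g (u div ?W) (u mod ?W)" for u
    have hc: "h u \<in> cells M" if "u < U" for u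
      using g node[OF that] unfolding h_def tableau_def by blast
    define a where "a v \<longleftrightarrow> val (v mod B) = h (v div B)" for v
    have "\<exists>b<B. a (u * B + b)" if u: "u < U" for u
    proof -
      have "h u \<in> val ` {..<B}" using hc[OF u] val by (simp add: bij_betw_def)
      then obtain b where "b < B" "h u = val b" by auto
      then show ?thesis by (intro exI[of _ b]) (auto simp: a_def)
    qed
    moreover have "\<not> (a v \<and> a v')" if v: "v < V" "v' < V" and c: "conflict ok B x T v v'" for v v'
    proof
      assume av: "a v \<and> a v'"
      let ?u = "v div B" and ?u' = "v' div B"
      have u: "?u < U" "?u' < U" using v unfolding V by (auto intro: less_mult_imp_div_less)
      obtain \<kappa> where \<kappa>: "\<kappa> < 12" "kind_cond x T \<kappa> (?u div ?W) (?u mod ?W) (?u' div ?W) (?u' mod ?W)"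
        "\<not> ok \<kappa> (v mod B) (v' mod B)"
        using c unfolding conflict_def Let_def by blast
      have "kind_ok M \<kappa> (h ?u) (h ?u')"
        using g \<kappa>(1,2) node[OF u(1)] node[OF u(2)] unfolding h_def tableau_def by blast
      then show False using av \<kappa>(3) by (simp add: a_def ok_def)
    qed
    ultimately show ?L unfolding sat by blast
  qed
qed

text \<open>\<open>B\<close> and \<open>ok\<close> depend on the machine alone. This order of
  quantifiers allows one fixed program to serve all inputs.\<close>

theorem satisfiable_iff_accepts:
  assumes "wf_tm M"
  shows "\<exists>B ok. 0 < B \<and> (\<forall>x T. (\<exists>a. gadget_defs.satisfied_by (num_vars B T) (num_clauses B T)
    (pos_lit B T) (neg_lit ok B x T) a) \<longleftrightarrow> accepts_within M x T)"
proof -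
  obtain val where val: "bij_betw val {..<card (cells M)} (cells M)"
    using ex_bij_betw_nat_finite[OF finite_cells[OF assms]] by (auto simp: atLeast0LessThan)
  have "(start_state M, None, replicate (num_tapes M) 0) \<in> cells M"
    by (auto simp: cells_def states_def symbols_def)
  then have "0 < card (cells M)" using finite_cells[OF assms] card_gt_0_iff by blast
  have "(\<exists>a. gadget_defs.satisfied_by (num_vars (card (cells M)) T) (num_clauses (card (cells M)) T)
      (pos_lit (card (cells M)) T) (neg_lit (\<lambda>\<kappa> b b'. kind_ok M \<kappa> (val b) (val b')) (card (cells M)) x T) a) \<longleftrightarrow>
      accepts_within M x T" for x T
    unfolding satisfiable_iff_tableau[OF val \<open>0 < card (cells M)\<close>]
    using accepts_imp_tableau[OF assms] tableau_imp_accepts[OF assms] by metis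
  then show ?thesis using \<open>0 < card (cells M)\<close> by metis
qed

section \<open>Encoding of instances\<close>

fun bits_val :: "bool list \<Rightarrow> nat" where
  "bits_val [] = 0"
| "bits_val (b # bs) = of_bool b + 2 * bits_val bs"

lemma binary_0 [simp]: "binary 0 = []"
  by (subst binary.simps) simp

lemma binary_pos: "k \<noteq> 0 \<Longrightarrow> binary k = odd k # binary (k div 2)"
  by (subst binary.simps) simp

lemma bits_val_binary [simp]: "bits_val (binary k) = k"
proof (induction k rule: less_induct)
  case (less k)
  then show ?case by (cases "k = 0") (auto simp: binary_pos)
qed

lemma binary_inject: "binary k = binary k' \<Longrightarrow> k = k'"
  by (metis bits_val_binary)

lemma last_binary: "binary k \<noteq> [] \<Longrightarrow> last (binary k)"
proof (induction k rule: less_induct)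
  case (less k)
  then have k: "k \<noteq> 0" by (auto intro: ccontr)
  show ?case
  proof (cases "k div 2 = 0")
    case True
    then have "k = 1" using k by auto
    then show ?thesis by (simp add: binary_pos)
  next
    case False
    then have "binary (k div 2) \<noteq> []" by (simp add: binary_pos)
    then show ?thesis using less.IH[of "k div 2"] k by (simp add: binary_pos[OF k])
  qed
qed

text \<open>Together with \<open>last_binary\<close>: canonical codes of numbers are recognised by
  their last bit alone.\<close>

lemma binary_bits_val: "b = [] \<or> last b \<Longrightarrow> binary (bits_val b) = b"
proof (induction b)
  case Nil
  then show ?case by simp
next
  case (Cons c b)
  have IH: "binary (bits_val b) = b" using Cons by (cases "b = []") auto
  have "bits_val (c # b) \<noteq> 0"
  proof (cases "b = []")
    case False
    then have "bits_val b \<noteq> 0" using IH by (metis binary_0)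
    then show ?thesis by simp
  qed (use Cons.prems in auto)
  then show ?case using IH by (subst binary_pos) auto
qed

lemma bits_val_sum: "bits_val b = (\<Sum>i<length b. if b ! i then 2 ^ i else 0)"
proof (induction b)
  case (Cons c b)
  have "(\<Sum>i<length (c # b). if (c # b) ! i then 2 ^ i else 0) =
      of_bool c + (\<Sum>i<length b. if b ! i then 2 ^ Suc i else (0::nat))"
    unfolding list.size(4) add_Suc_right Nat.add_0_right sum.lessThan_Suc_shift by simp
  also have "(\<Sum>i<length b. if b ! i then 2 ^ Suc i else (0::nat)) = 2 * (\<Sum>i<length b. if b ! i then 2 ^ i else 0)"
    unfolding sum_distrib_left by (rule sum.cong) auto
  finally show ?case using Cons by simp
qed simp

lemma length_rows: "length (concat (map (\<lambda>i. map (f i) [0..<n]) [0..<m])) = m * n"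
  by (induction m) auto

lemma nth_rows: "i < m \<Longrightarrow> j < n \<Longrightarrow> concat (map (\<lambda>i. map (f i) [0..<n]) [0..<m]) ! (i * n + j) = f i j"
proof (induction m)
  case (Suc m)
  show ?case
  proof (cases "i < m")
    case True
    have "i * n + j < Suc i * n" using Suc.prems by simp
    also have "\<dots> \<le> m * n" using True by (intro mult_le_mono1) simp
    finally show ?thesis using Suc True by (simp add: nth_append length_rows)
  next
    case False
    then have "i = m" using Suc.prems by simp
    then show ?thesis using Suc.prems by (simp add: nth_append length_rows)
  qed
qed simp

text \<open>A description by single positions of the string suits both the proof of injectivity and
  a verifier that reads individual bits.\<close>

lemma eq_encode_instance_iff:
  assumes "verts G = {..<n}"
  shows "x = encode_instance G k \<longleftrightarrow>
    n + 1 + n * n \<le> length x \<and> (\<forall>i<n. x ! i) \<and> \<not> x ! n \<and>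
    (\<forall>i<n. \<forall>j<n. x ! (n + 1 + (i * n + j)) \<longleftrightarrow> {i, j} \<in> edges G) \<and> drop (n + 1 + n * n) x = binary k"
    (is "_ \<longleftrightarrow> ?r")
proof -
  define m where "m = concat (map (\<lambda>i. map (\<lambda>j. {i, j} \<in> edges G) [0..<n]) [0..<n])"
  have len: "length m = n * n" unfolding m_def by (rule length_rows)
  have nth: "m ! (i * n + j) \<longleftrightarrow> {i, j} \<in> edges G" if "i < n" "j < n" for i j
    unfolding m_def using that by (rule nth_rows)
  have enc: "encode_instance G k = replicate n True @ [False] @ m @ binary k"
    by (simp add: encode_instance_def assms m_def Let_def)
  show ?thesis
  proof
    assume x: "x = encode_instance G k"
    have "i * n + j < n * n" if "i < n" "j < n" for i j
    proof -
      have "i * n + j < Suc i * n" using that by simp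
      also have "\<dots> \<le> n * n" using that by (intro mult_le_mono1) simp
      finally show ?thesis .
    qed
    then show ?r unfolding x enc by (auto simp: nth_append len nth)
  next
    assume r: ?r
    have "take (n + 1 + n * n) x = replicate n True @ [False] @ m"
    proof (rule nth_equalityI)
      show "length (take (n + 1 + n * n) x) = length (replicate n True @ [False] @ m)" using r len by simp
      fix l assume "l < length (take (n + 1 + n * n) x)"
      then have l: "l < n + 1 + n * n" using r by simp
      consider "l < n" | "l = n" | "n < l" by linarith
      then show "take (n + 1 + n * n) x ! l = (replicate n True @ [False] @ m) ! l"
      proof cases
        case 3
        define d where "d = l - n - 1"
        have d: "l = n + 1 + d" "d < n * n" using 3 l by (auto simp: d_def)
        have "d div n < n" "d mod n < n" using d(2) by (auto simp: less_mult_imp_div_less intro!: mod_less_divisor gr0I)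
        then have "x ! (n + 1 + (d div n * n + d mod n)) \<longleftrightarrow> m ! (d div n * n + d mod n)" using r nth by blast
        then have "x ! (n + 1 + d) \<longleftrightarrow> m ! d" by (simp only: div_mult_mod_eq)
        then show ?thesis using d len by (simp add: nth_append)
      qed (use r in \<open>auto simp: nth_append\<close>)
    qed
    then show "x = encode_instance G k" unfolding enc using r append_take_drop_id[of "n + 1 + n * n" x] by simp
  qed
qed

lemma encode_instance_inject:
  assumes "simple_graph G" "verts G = {..<n}" "simple_graph G'" "verts G' = {..<n'}"
    "encode_instance G k = encode_instance G' k'"
  shows "G = G' \<and> k = k'"
proof -
  define x where "x = encode_instance G k"
  have 1: "x = encode_instance G k" and 2: "x = encode_instance G' k'" using assms(5) by (auto simp: x_def)
  note * = 1[unfolded eq_encode_instance_iff[OF assms(2)]] 2[unfolded eq_encode_instance_iff[OF assms(4)]]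
  \<comment> \<open>The number of vertices is the position of the first
    \<open>False\<close>.\<close>
  have n: "n = n'" using * by (metis linorder_neqE_nat)
  have sub: "edges H \<subseteq> edges H'"
    if "simple_graph H" "verts H = {..<n}" "\<And>i j. i < n \<Longrightarrow> j < n \<Longrightarrow> {i, j} \<in> edges H \<Longrightarrow> {i, j} \<in> edges H'" for H H' :: "nat graph"
  proof
    fix e assume "e \<in> edges H"
    then have "e \<subseteq> {..<n}" "card e = 2" "e \<in> edges H" using that(1,2) by (auto simp: simple_graph_def)
    moreover then obtain i j where "e = {i, j}" by (auto simp: card_2_iff)
    ultimately show "e \<in> edges H'" using that(3) by auto
  qed
  have e: "{i, j} \<in> edges G \<longleftrightarrow> {i, j} \<in> edges G'" if "i < n" "j < n" for i j
    using *(1) *(2)[folded n] that by simp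
  have "edges G \<subseteq> edges G'" by (rule sub[OF assms(1,2)]) (simp add: e)
  moreover have "edges G' \<subseteq> edges G" by (rule sub[OF assms(3) assms(4)[folded n]]) (simp add: e)
  moreover have "binary k = binary k'" using *(1) *(2)[folded n] by simp
  then have "k = k'" by (rule binary_inject)
  ultimately show ?thesis using assms(2,4) n by (simp add: prod_eq_iff)
qed

section \<open>NP-hardness\<close>

text \<open>The machine enters only through the constants \<open>B\<close>, \<open>ok\<close> and
  its time bound \<open>p\<close>; the input enters through \<open>Bit 0\<close> and its length in
  register \<open>2\<close>.\<close>

locale reduction =
  fixes ok :: "nat \<Rightarrow> nat \<Rightarrow> nat \<Rightarrow> bool" and B :: nat and p :: "nat poly"
  assumes B_pos: "0 < B"
begin

definition T_exp :: exp where "T_exp = Poly (coeffs p) (Var 2)"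
definition W_exp :: exp where "W_exp = Add (Times (Const 2) T_exp) (Const 1)"
definition U_exp :: exp where "U_exp = Times (Add T_exp (Const 1)) W_exp"
definition V_exp :: exp where "V_exp = Times U_exp (Const B)"
definition C_exp :: exp where "C_exp = Add U_exp (Times V_exp V_exp)"
definition len_exp :: exp where "len_exp = Times (Const 4) C_exp"
definition cyc_exp :: exp where "cyc_exp = Times len_exp V_exp"
definition size_exp :: exp where
  "size_exp = Add (Times (Const 3) cyc_exp) (Times (Const 2) (Add C_exp (Const 1)))"

definition sym_exp :: "exp \<Rightarrow> exp" where
  "sym_exp z = Cond (Conj (Leq T_exp z) (Lt (Sub z T_exp) (Var 2)))
     (Add (Const 1) (Bit 0 (Sub z T_exp))) (Const 0)"

definition kind_exp :: "nat \<Rightarrow> exp \<Rightarrow> exp \<Rightarrow> exp \<Rightarrow> exp \<Rightarrow> exp" where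
  "kind_exp \<kappa> t z t' z' =
     (if \<kappa> < 3 then Conj (Conj (Equ t (Const 0)) (Equ t' t)) (Conj (Equ z' z) (Equ (sym_exp z) (Const \<kappa>)))
      else if \<kappa> = 3 then Conj (Equ t T_exp) (Conj (Equ t' t) (Equ z' z))
      else if \<kappa> = 4 then Conj (Equ z T_exp) (Conj (Equ t' t) (Equ z' z))
      else if \<kappa> = 5 then Equ t' t
      else if \<kappa> < 9 then Conj (Equ t' (Add t (Const 1)))
        (Conj (Neg (Equ z T_exp)) (Equ (Add z (Const 7)) (Add z' (Const \<kappa>))))
      else Conj (Equ t' (Add t (Const 1))) (Conj (Equ z T_exp) (Equ (Add z (Const 10)) (Add z' (Const \<kappa>)))))"

text \<open>\<open>ok\<close> is an arbitrary relation, but only finitely many values matter, so its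
  violations are written into the program as a table.\<close>

definition bad_pairs :: "nat \<Rightarrow> (nat \<times> nat) list" where
  "bad_pairs \<kappa> = filter (\<lambda>(b, b'). \<not> ok \<kappa> b b') (List.product [0..<B] [0..<B])"

definition conflict_exp :: "exp \<Rightarrow> exp \<Rightarrow> exp" where
  "conflict_exp v v' = (let u = Quot v (Const B); u' = Quot v' (Const B) in
     foldr (\<lambda>\<kappa>. Disj (Conj (kind_exp \<kappa> (Quot u W_exp) (Rem u W_exp) (Quot u' W_exp) (Rem u' W_exp))
       (Table (bad_pairs \<kappa>) (Rem v (Const B)) (Rem v' (Const B))))) [0..<12] (Const 0))"

definition pos_exp :: "exp \<Rightarrow> exp \<Rightarrow> exp" where
  "pos_exp i j = Conj (Lt j U_exp) (Equ (Quot i (Const B)) j)"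

definition neg_exp :: "exp \<Rightarrow> exp \<Rightarrow> exp" where
  "neg_exp i j = (let l = Sub j U_exp; v = Quot l V_exp; v' = Rem l V_exp in
     Conj (Leq U_exp j) (Conj (conflict_exp v v') (Disj (Equ i v) (Equ i v'))))"

definition hub_exp :: "exp \<Rightarrow> exp" where
  "hub_exp s = (let i = Quot s len_exp; j = Rem (Quot s (Const 4)) C_exp; r = Rem s (Const 4) in
     Cond (Disj (Conj (Equ r (Const 0)) (neg_exp i j))
         (Disj (Conj (Equ r (Const 1)) (Disj (pos_exp i j) (neg_exp i j))) (Conj (Equ r (Const 2)) (pos_exp i j))))
       (Add j (Const 1)) (Const 0))"

definition nxt_exp :: "exp \<Rightarrow> exp" where
  "nxt_exp s = Add (Sub s (Rem s len_exp)) (Rem (Add s (Const 1)) len_exp)"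

definition end1_exp :: "exp \<Rightarrow> exp" where
  "end1_exp e = Cond (Lt e cyc_exp) e (Cond (Lt e (Times (Const 2) cyc_exp)) (Sub e cyc_exp)
     (Cond (Lt e (Times (Const 3) cyc_exp)) (Sub e (Times (Const 2) cyc_exp))
       (Add cyc_exp (Quot (Sub e (Times (Const 3) cyc_exp)) (Const 2)))))"

definition end2_exp :: "exp \<Rightarrow> exp" where
  "end2_exp e = Cond (Lt e cyc_exp) (nxt_exp e) (Cond (Lt e (Times (Const 2) cyc_exp))
     (Add cyc_exp (hub_exp (Sub e cyc_exp))) (Add (Add (Add cyc_exp C_exp) (Const 1)) e))"

definition adj_exp :: "exp \<Rightarrow> exp \<Rightarrow> exp" where
  "adj_exp e f = Conj (Neg (Equ e f))
     (Disj (Disj (Equ (end1_exp e) (end1_exp f)) (Equ (end1_exp e) (end2_exp f)))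
       (Disj (Equ (end2_exp e) (end1_exp f)) (Equ (end2_exp e) (end2_exp f))))"

definition k_exp :: exp where "k_exp = Times (Times (Const 6) V_exp) C_exp"

text \<open>The four pieces are those of \<open>encode_instance\<close>: the size in unary, the
  separator, the adjacency matrix and the bound. The loop variables for the digits of the bound are
  fresh for \<open>k_exp\<close>.\<close>

definition graph_prog :: prog where
  "graph_prog = Then (For 4 size_exp (Out (Const 1))) (Then (Out (Const 0))
     (Then (For 4 size_exp (For 5 size_exp (Out (adj_exp (Var 4) (Var 5))))) (out_binary (fresh k_exp + 4) k_exp)))"

lemma ok_size_exps [simp]: "ok_exp T_exp" "ok_exp W_exp" "ok_exp U_exp" "ok_exp V_exp" "ok_exp C_exp"
  "ok_exp len_exp" "ok_exp cyc_exp" "ok_exp size_exp" "ok_exp k_exp"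
  by (simp_all add: T_exp_def W_exp_def U_exp_def V_exp_def C_exp_def len_exp_def cyc_exp_def size_exp_def k_exp_def)

lemma ok_conflict_exp [simp]: "ok_exp v \<Longrightarrow> ok_exp v' \<Longrightarrow> ok_exp (conflict_exp v v')"
proof -
  assume v: "ok_exp v" "ok_exp v'"
  have "ok_exp (kind_exp \<kappa> t z t' z')" if "ok_exp t" "ok_exp z" "ok_exp t'" "ok_exp z'" for \<kappa> t z t' z'
    using that by (simp add: kind_exp_def sym_exp_def)
  then have "ok_exp (foldr (\<lambda>\<kappa>. Disj (Conj (kind_exp \<kappa> (Quot (Quot v (Const B)) W_exp) (Rem (Quot v (Const B)) W_exp)
      (Quot (Quot v' (Const B)) W_exp) (Rem (Quot v' (Const B)) W_exp))
      (Table (bad_pairs \<kappa>) (Rem v (Const B)) (Rem v' (Const B))))) ks (Const 0))" for ks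
    using v by (induction ks) auto
  then show ?thesis by (simp add: conflict_exp_def Let_def)
qed

lemma ok_adj_exp: "ok_exp e \<Longrightarrow> ok_exp f \<Longrightarrow> ok_exp (adj_exp e f)"
  by (simp add: adj_exp_def end1_exp_def end2_exp_def nxt_exp_def hub_exp_def neg_exp_def pos_exp_def Let_def)

lemma ok_graph_prog: "ok_prog graph_prog"
  by (simp add: graph_prog_def out_binary_def ok_adj_exp)

lemma gadget: "gadget (num_vars B T) (num_clauses B T)"
proof
  show "0 < num_vars B T" using B_pos by (simp add: num_vars_def)
  show "0 < num_clauses B T" by (simp add: num_clauses_def)
qed

section \<open>Correctness of the expressions for the gadget\<close>

context
  fixes x :: "bool list" and I :: "nat \<Rightarrow> bool list" and T :: nat
  assumes I: "I 0 = x" and T: "T = poly p (length x)"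
begin

abbreviation "V \<equiv> num_vars B T"
abbreviation "C \<equiv> num_clauses B T"
abbreviation "pos \<equiv> pos_lit B T"
abbreviation "neg \<equiv> neg_lit ok B x T"

context
  fixes R :: regs
  assumes R: "R 2 = length x"
begin

lemma eval_T: "eval I T_exp R = T"
  by (simp add: T_exp_def eval_Poly R T)

lemma eval_W: "eval I W_exp R = 2 * T + 1"
  by (simp add: W_exp_def eval_T)

lemma eval_U: "eval I U_exp R = (T + 1) * (2 * T + 1)"
  by (simp add: U_exp_def eval_T eval_W)

lemma eval_V: "eval I V_exp R = V"
  by (simp add: V_exp_def eval_U num_vars_def)

lemma eval_C: "eval I C_exp R = C"
  by (simp add: C_exp_def eval_U eval_V num_clauses_def)

lemma eval_len: "eval I len_exp R = gadget_defs.len C"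
  by (simp add: len_exp_def eval_C gadget_defs.len_def)

lemma eval_cyc: "eval I cyc_exp R = gadget_defs.cyc V C"
  by (simp add: cyc_exp_def eval_len eval_V gadget_defs.cyc_def)

lemma eval_size: "eval I size_exp R = gadget_defs.size V C"
  by (simp add: size_exp_def eval_cyc eval_C gadget_defs.size_def)

lemma eval_sym: "eval I (sym_exp z) R = input_sym x T (eval I z R)"
  by (simp add: sym_exp_def input_sym_def eval_T R I bit_symbol_def)

lemma holds_kind: "holds I (kind_exp \<kappa> t z t' z') R \<longleftrightarrow>
    kind_cond x T \<kappa> (eval I t R) (eval I z R) (eval I t' R) (eval I z' R)"
  by (simp add: kind_exp_def kind_cond_def eval_sym eval_T)

lemma holds_conflict: "holds I (conflict_exp v v') R \<longleftrightarrow> conflict ok B x T (eval I v R) (eval I v' R)"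
proof -
  have fold: "holds I (foldr (\<lambda>\<kappa>. Disj (f \<kappa>)) ks (Const 0)) R \<longleftrightarrow> (\<exists>\<kappa>\<in>set ks. holds I (f \<kappa>) R)" for f ks
    by (induction ks) auto
  have bad: "(b mod B, b' mod B) \<in> set (bad_pairs \<kappa>) \<longleftrightarrow> \<not> ok \<kappa> (b mod B) (b' mod B)" for b b' \<kappa>
    using B_pos by (auto simp: bad_pairs_def)
  show ?thesis
    unfolding conflict_exp_def Let_def fold
    by (auto simp: holds_kind eval_W bad conflict_def Let_def)
qed

lemma holds_pos: "holds I (pos_exp i j) R \<longleftrightarrow> pos (eval I i R) (eval I j R)"
  by (simp add: pos_exp_def pos_lit_def eval_U)

lemma holds_neg: "holds I (neg_exp i j) R \<longleftrightarrow> neg (eval I i R) (eval I j R)"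
  by (simp add: neg_exp_def neg_lit_def eval_U eval_V holds_conflict Let_def)

lemma eval_hub: "eval I (hub_exp s) R = gadget_defs.hub C pos neg (eval I s R)"
  by (simp add: hub_exp_def gadget_defs.hub_def eval_len eval_C holds_pos holds_neg Let_def)

lemma eval_nxt: "eval I (nxt_exp s) R = gadget_defs.nxt C (eval I s R)"
  by (simp add: nxt_exp_def gadget_defs.nxt_def eval_len)

lemma eval_end1: "eval I (end1_exp e) R = gadget_defs.end1 V C (eval I e R)"
  by (simp add: end1_exp_def gadget_defs.end1_def eval_cyc)

lemma eval_end2: "eval I (end2_exp e) R = gadget_defs.end2 V C pos neg (eval I e R)"
  by (simp add: end2_exp_def gadget_defs.end2_def eval_cyc eval_C eval_nxt eval_hub)

lemma holds_adj: "holds I (adj_exp e f) R \<longleftrightarrow> gadget_defs.adj V C pos neg (eval I e R) (eval I f R)"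
  by (simp add: adj_exp_def gadget_defs.adj_def eval_end1 eval_end2 disj_assoc)

lemma eval_k: "eval I k_exp R = 6 * V * C"
  by (simp add: k_exp_def eval_V eval_C)

end

lemma out_graph_prog:
  assumes R: "R 2 = length x"
  shows "out I graph_prog R = encode_instance (gadget_defs.graph V C pos neg) (6 * V * C)"
proof -
  interpret gadget V C pos neg by (rule gadget)
  have row: "concat (map (\<lambda>z. [f z]) xs) = map f xs" for f :: "nat \<Rightarrow> bool" and xs
    by (induction xs) auto
  have 1: "out I (For 4 size_exp (Out (Const 1))) R = replicate size True"
    by (simp add: row eval_size[of R, OF R] map_replicate_const)
  have 2: "out I (For 4 size_exp (For 5 size_exp (Out (adj_exp (Var 4) (Var 5))))) R =
      concat (map (\<lambda>i. map (\<lambda>j. {i, j} \<in> edges graph) [0..<size]) [0..<size])"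
  proof -
    have "out I (Out (adj_exp (Var 4) (Var 5))) (R(4 := i, 5 := j)) = [adj i j]" for i j
      using holds_adj[of "R(4 := i, 5 := j)" "Var 4" "Var 5"] R by (simp add: holds_def)
    moreover have "eval I size_exp (R(4 := i)) = size" for i
      by (rule eval_size) (simp add: R)
    ultimately have "out I (For 4 size_exp (For 5 size_exp (Out (adj_exp (Var 4) (Var 5))))) R =
        concat (map (\<lambda>i. map (adj i) [0..<size]) [0..<size])"
      by (simp add: row eval_size[of R, OF R])
    also have "map (\<lambda>i. map (adj i) [0..<size]) [0..<size] =
        map (\<lambda>i. map (\<lambda>j. {i, j} \<in> edges graph) [0..<size]) [0..<size]"
      by (intro map_cong refl) (simp add: graph_edge)
    finally show ?thesis .
  qed
  show ?thesis
    unfolding graph_prog_def out.simps(2) 1 2 out_binary[OF le_add1] eval_k[of R, OF R]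
    by (simp add: encode_instance_def graph_verts Let_def)
qed

end

end

text \<open>By injectivity of the code, no other instance can be responsible for the membership of
  the string.\<close>

lemma encode_in_problem_iff:
  assumes "simple_graph G" "verts G = {..<n}" "\<C> G"
  shows "encode_instance G k \<in> connected_fvs_problem \<C> \<longleftrightarrow>
    (\<exists>S. connected_feedback_vertex_set G S \<and> card S \<le> k)"
proof
  assume "encode_instance G k \<in> connected_fvs_problem \<C>"
  then obtain G' k' n' where *: "encode_instance G k = encode_instance G' k'" "simple_graph G'" "verts G' = {..<n'}"
    "\<exists>S. connected_feedback_vertex_set G' S \<and> card S \<le> k'"
    unfolding connected_fvs_problem_def by blast
  with encode_instance_inject[OF assms(1,2) *(2,3) *(1)]
  show "\<exists>S. connected_feedback_vertex_set G S \<and> card S \<le> k" by simp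
next
  assume "\<exists>S. connected_feedback_vertex_set G S \<and> card S \<le> k"
  then show "encode_instance G k \<in> connected_fvs_problem \<C>"
    using assms unfolding connected_fvs_problem_def by blast
qed

theorem NP_hard_connected_fvs: "NP_hard (connected_fvs_problem is_line_graph)"
  unfolding NP_hard_def
proof
  fix A :: "bool list set"
  assume "A \<in> NP"
  then obtain M and p :: "nat poly" where M: "wf_tm M"
    "\<And>x. x \<in> A \<Longrightarrow> accepts_within M x (poly p (length x))" "\<And>x n. accepts_within M x n \<Longrightarrow> x \<in> A"
    unfolding NP_def by blast
  obtain B ok where B: "0 < B" and sat: "\<And>x T. (\<exists>a. gadget_defs.satisfied_by (num_vars B T) (num_clauses B T)
      (pos_lit B T) (neg_lit ok B x T) a) \<longleftrightarrow> accepts_within M x T"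
    using satisfiable_iff_accepts[OF M(1)] by blast
  interpret reduction ok B p by standard (rule B)
  obtain v where v: "4 \<le> v" "wf_prog v graph_prog" using wf_prog_ok[OF ok_graph_prog] by blast
  define f where "f x = out (inputs x []) graph_prog (env x [])" for x
  have "polytime_computable f"
    unfolding f_def[abs_def] by (rule polytime_computable_out[OF v(2,1)])
  moreover have "x \<in> A \<longleftrightarrow> f x \<in> connected_fvs_problem is_line_graph" for x
  proof -
    define T where "T = poly p (length x)"
    let ?V = "num_vars B T" and ?C = "num_clauses B T"
    interpret g: gadget ?V ?C "pos_lit B T" "neg_lit ok B x T"
      by (rule gadget)
    have "f x = encode_instance g.graph (6 * ?V * ?C)"
      unfolding f_def by (rule out_graph_prog) (simp_all add: inputs_def env_def T_def)
    then have "f x \<in> connected_fvs_problem is_line_graph \<longleftrightarrow>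
        (\<exists>S. connected_feedback_vertex_set g.graph S \<and> card S \<le> 6 * ?V * ?C)"
      using encode_in_problem_iff[where \<C> = is_line_graph, OF g.simple_graph g.graph_verts g.line_graph] by simp
    also have "\<dots> \<longleftrightarrow> accepts_within M x T"
      unfolding g.satisfiable_iff_cfvs[symmetric] by (rule sat)
    \<comment> \<open>Members are accepted within the particular bound \<open>T\<close>; conversely,
      acceptance within any bound shows membership.\<close>
    also have "\<dots> \<longleftrightarrow> x \<in> A" using M(2,3) unfolding T_def by blast
    finally show ?thesis by simp
  qed
  ultimately show "polytime_reducible A (connected_fvs_problem is_line_graph)"
    unfolding polytime_reducible_def by blast
qed

section \<open>Membership in NP\<close>

text \<open>Positions beyond the end count as \<open>False\<close>, in agreement with
  \<open>Bit\<close>.\<close>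

definition bit_at :: "bool list \<Rightarrow> nat \<Rightarrow> bool" where
  "bit_at x i \<longleftrightarrow> i < length x \<and> x ! i"

definition matrix_at :: "bool list \<Rightarrow> nat \<Rightarrow> nat \<Rightarrow> nat \<Rightarrow> bool" where
  "matrix_at x n i j = bit_at x (n + 1 + (i * n + j))"

text \<open>The last condition makes the binary part canonical: it is empty or ends with a leading
  digit one.\<close>

definition encodes_graph :: "bool list \<Rightarrow> nat \<Rightarrow> bool" where
  "encodes_graph x n \<longleftrightarrow> n + 1 + n * n \<le> length x \<and> (\<forall>i<n. bit_at x i) \<and> \<not> bit_at x n \<and>
     (length x = n + 1 + n * n \<or> bit_at x (length x - 1))"

text \<open>In a certificate, \<open>A\<close> is the incidence relation of a root graph whose edges are the vertices of the given graph,
  and \<open>S\<close> the feedback vertex set. The ranks \<open>r\<close> show that a forest remains, the distances \<open>d\<close> that \<open>S\<close> is connected.\<close>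

definition valid_root :: "bool list \<Rightarrow> nat \<Rightarrow> (nat \<Rightarrow> nat \<Rightarrow> bool) \<Rightarrow> bool" where
  "valid_root x n A \<longleftrightarrow>
     (\<forall>v<n. card {u. u < 2 * n \<and> A v u} = 2) \<and>
     (\<forall>v<n. \<forall>v'<n. v \<noteq> v' \<longrightarrow> (\<exists>u<2 * n. A v u \<noteq> A v' u)) \<and>
     (\<forall>v<n. \<forall>v'<n. matrix_at x n v v' \<longleftrightarrow> v \<noteq> v' \<and> (\<exists>u<2 * n. A v u \<and> A v' u))"

definition valid_rank :: "bool list \<Rightarrow> nat \<Rightarrow> (nat \<Rightarrow> bool) \<Rightarrow> (nat \<Rightarrow> nat) \<Rightarrow> bool" where
  "valid_rank x n S r \<longleftrightarrow>
     (\<forall>v<n. \<forall>v'<n. \<not> S v \<and> \<not> S v' \<and> matrix_at x n v v' \<longrightarrow> r v \<noteq> r v') \<and>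
     (\<forall>u<n. \<forall>v<n. \<forall>w<n. \<not> S u \<and> \<not> S v \<and> \<not> S w \<and> matrix_at x n u v \<and> matrix_at x n u w \<and>
        r u < r v \<and> r u < r w \<longrightarrow> v = w)"

definition valid_dist :: "bool list \<Rightarrow> nat \<Rightarrow> (nat \<Rightarrow> bool) \<Rightarrow> (nat \<Rightarrow> nat) \<Rightarrow> bool" where
  "valid_dist x n S d \<longleftrightarrow>
     (\<forall>u<n. \<forall>v<n. S u \<and> S v \<and> (\<forall>y<n. S y \<and> matrix_at x n u y \<longrightarrow> d u \<le> d y) \<and>
        (\<forall>y<n. S y \<and> matrix_at x n v y \<longrightarrow> d v \<le> d y) \<longrightarrow> u = v)"

text \<open>The inner cardinality is the length of the binary representation of \<open>y\<close>, so the summands are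
  \<open>min n (2 ^ i)\<close>: the number in the instance may be exponentially large, but only its minimum with \<open>n\<close> matters.\<close>

definition small_set :: "bool list \<Rightarrow> nat \<Rightarrow> (nat \<Rightarrow> bool) \<Rightarrow> bool" where
  "small_set x n S \<longleftrightarrow> card {v. v < n \<and> S v} \<le> (\<Sum>i<length x - (n + 1 + n * n).
     if bit_at x (n + 1 + n * n + i) then card {y. y < n \<and> card {z. z < y + 1 \<and> is_pow2 z} \<le> i} else 0)"

definition valid :: "bool list \<Rightarrow> nat \<Rightarrow> (nat \<Rightarrow> nat \<Rightarrow> bool) \<Rightarrow> (nat \<Rightarrow> bool) \<Rightarrow> (nat \<Rightarrow> nat) \<Rightarrow> (nat \<Rightarrow> nat) \<Rightarrow> bool" where
  "valid x n A S r d \<longleftrightarrow>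
     encodes_graph x n \<and> valid_root x n A \<and> valid_rank x n S r \<and> valid_dist x n S d \<and> small_set x n S"

section \<open>Soundness of certificates\<close>

lemma bit_length_le_iff: "card {z. z < y + 1 \<and> is_pow2 z} \<le> i \<longleftrightarrow> y < 2 ^ i"
proof -
  have "{z. z < y + 1 \<and> is_pow2 z} = (\<lambda>j. 2 ^ j) ` {j. 2 ^ j \<le> y}"
    by (auto simp: is_pow2_iff)
  moreover have "inj_on (\<lambda>j. 2 ^ j :: nat) A" for A by (auto simp: inj_on_def)
  ultimately have c: "card {z. z < y + 1 \<and> is_pow2 z} = card {j. 2 ^ j \<le> y}"
    by (simp add: card_image)
  have fin: "finite {j. 2 ^ j \<le> y}"
    by (rule finite_subset[of _ "{..y}"]) (auto intro: order_trans[OF less_imp_le[OF less_exp]])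
  show ?thesis
  proof (cases "y < 2 ^ i")
    case True
    have "{j. 2 ^ j \<le> y} \<subseteq> {..<i}"
    proof
      fix j assume "j \<in> {j. 2 ^ j \<le> y}"
      then have "(2::nat) ^ j \<le> y" by simp
      then have "(2::nat) ^ j < 2 ^ i" using True by (rule le_less_trans)
      then show "j \<in> {..<i}" by simp
    qed
    from card_mono[OF finite_lessThan this] have "card {j. 2 ^ j \<le> y} \<le> i" by simp
    then show ?thesis using True c by simp
  next
    case False
    have "{..i} \<subseteq> {j. 2 ^ j \<le> y}"
    proof
      fix j assume "j \<in> {..i}"
      then have "(2::nat) ^ j \<le> 2 ^ i" by (intro power_increasing) auto
      also have "2 ^ i \<le> y" using False by simp
      finally show "j \<in> {j. 2 ^ j \<le> y}" by simp
    qed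
    from card_mono[OF fin this] have "Suc i \<le> card {j. 2 ^ j \<le> y}" by simp
    then show ?thesis using False c by simp
  qed
qed

lemma card_bit_length: "card {y. y < n \<and> card {z. z < y + 1 \<and> is_pow2 z} \<le> i} = min n (2 ^ i)"
proof -
  have "{y. y < n \<and> y < 2 ^ i} = {..<min n (2 ^ i)}" by auto
  then show ?thesis unfolding bit_length_le_iff by simp
qed

text \<open>If a summand for a set bit is cut down to \<open>n\<close>, both sums are at least
  \<open>n\<close> and hence at least \<open>s\<close>; otherwise no summand changes.\<close>

lemma le_bits_val_iff:
  assumes "s \<le> n"
  shows "s \<le> (\<Sum>i<length b. if b ! i then min n (2 ^ i) else 0) \<longleftrightarrow> s \<le> bits_val b"
proof
  assume "s \<le> (\<Sum>i<length b. if b ! i then min n (2 ^ i) else 0)"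
  also have "\<dots> \<le> bits_val b" unfolding bits_val_sum by (rule sum_mono) auto
  finally show "s \<le> bits_val b" .
next
  assume s: "s \<le> bits_val b"
  show "s \<le> (\<Sum>i<length b. if b ! i then min n (2 ^ i) else 0)"
  proof (cases "\<exists>i<length b. b ! i \<and> n \<le> 2 ^ i")
    case True
    then obtain i where i: "i < length b" "b ! i" "n \<le> 2 ^ i" by blast
    have "(if b ! i then min n (2 ^ i) else 0) \<le> (\<Sum>i<length b. if b ! i then min n (2 ^ i) else 0)"
      by (rule member_le_sum) (use i in auto)
    then show ?thesis using i assms by (simp add: min_def)
  next
    case False
    then have "(\<Sum>i<length b. if b ! i then min n (2 ^ i) else 0) = bits_val b"
      unfolding bits_val_sum by (intro sum.cong) auto
    then show ?thesis using s by simp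
  qed
qed

lemma sum_drop_bits:
  "(\<Sum>i<length x - m. if bit_at x (m + i) then card {y. y < n \<and> card {z. z < y + 1 \<and> is_pow2 z} \<le> i} else 0) =
   (\<Sum>i<length (drop m x). if drop m x ! i then min n (2 ^ i) else 0)"
  unfolding card_bit_length by (rule sum.cong) (auto simp: bit_at_def)

lemma valid_sound:
  assumes "valid x n A S r d"
  shows "x \<in> connected_fvs_problem is_line_graph"
proof -
  let ?M = "matrix_at x n" and ?m = "n + 1 + n * n"
  have v: "encodes_graph x n" "valid_root x n A" "valid_rank x n S r" "valid_dist x n S d" "small_set x n S"
    using assms unfolding valid_def by simp_all
  have lx: "?m \<le> length x" and ones: "\<forall>i<n. bit_at x i" and zero: "\<not> bit_at x n"
    and last_bit: "length x = ?m \<or> bit_at x (length x - 1)" using v(1) unfolding encodes_graph_def by simp_all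
  have adj: "?M v v' \<longleftrightarrow> v \<noteq> v' \<and> (\<exists>u<2 * n. A v u \<and> A v' u)" if "v < n" "v' < n" for v v'
    using v(2) that unfolding valid_root_def by simp
  define G :: "nat graph" where "G = ({..<n}, {{i, j} | i j. i < n \<and> j < n \<and> ?M i j})"
  have sym: "?M i j \<longleftrightarrow> ?M j i" if "i < n" "j < n" for i j using adj that by auto
  have edge: "{i, j} \<in> edges G \<longleftrightarrow> i < n \<and> j < n \<and> ?M i j" for i j
    using sym by (auto simp: G_def doubleton_eq_iff)
  have verts: "verts G = {..<n}" by (simp add: G_def)
  have simple: "simple_graph G" using adj by (auto simp: simple_graph_def G_def)
  define ends where "ends v = {u. u < 2 * n \<and> A v u}" for v
  have "is_line_graph G"
  proof (rule is_line_graphI[of G ends])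
    show "inj_on ends (verts G)"
    proof (rule inj_onI)
      fix u u' assume u: "u \<in> verts G" "u' \<in> verts G" "ends u = ends u'"
      then have "\<not> (\<exists>w<2 * n. A u w \<noteq> A u' w)" by (auto simp: ends_def set_eq_iff)
      then show "u = u'" using v(2) u(1,2) unfolding verts lessThan_iff valid_root_def by blast
    qed
  next
    fix u assume "u \<in> verts G"
    then show "card (ends u) = 2" using v(2) verts by (auto simp: ends_def valid_root_def)
  next
    fix u u' assume "u \<in> verts G" "u' \<in> verts G"
    then show "{u, u'} \<in> edges G \<longleftrightarrow> u \<noteq> u' \<and> ends u \<inter> ends u' \<noteq> {}"
      using edge adj verts by (auto simp: ends_def)
  qed (simp add: verts)
  define b where "b = drop ?m x"
  have "b = [] \<or> last b"
  proof (cases "length x = ?m")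
    case False
    then have "bit_at x (length x - 1)" using last_bit by blast
    then have "last x" using last_conv_nth[of x] by (cases "x = []") (auto simp: bit_at_def)
    then show ?thesis using lx False by (auto simp: b_def last_drop)
  qed (simp add: b_def)
  then have bin: "binary (bits_val b) = b" by (rule binary_bits_val)
  have mat: "x ! (n + 1 + (i * n + j)) \<longleftrightarrow> {i, j} \<in> edges G" if ij: "i < n" "j < n" for i j
  proof -
    have "i * n + j < n * n" using ij by (rule digit_pair_less)
    then show ?thesis using ij lx unfolding edge by (simp add: matrix_at_def bit_at_def)
  qed
  have x: "x = encode_instance G (bits_val b)"
    unfolding eq_encode_instance_iff[OF verts] bin
    using ones zero lx mat by (auto simp: bit_at_def b_def)
  let ?S = "{v. v < n \<and> S v}"
  have "forest (delete_verts G ?S)"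
  proof (rule forest_rank[where r = r])
    fix u w assume "{u, w} \<in> edges (delete_verts G ?S)"
    then have "u < n" "w < n" "\<not> S u" "\<not> S w" "?M u w" by (auto simp: delete_verts_edge edge verts)
    then show "r u \<noteq> r w" using v(3) unfolding valid_rank_def by blast
  next
    fix u w y assume "{u, w} \<in> edges (delete_verts G ?S)" "{u, y} \<in> edges (delete_verts G ?S)" "r u < r w" "r u < r y"
    then have "u < n" "w < n" "y < n" "\<not> S u" "\<not> S w" "\<not> S y" "?M u w" "?M u y" "r u < r w" "r u < r y"
      by (auto simp: delete_verts_edge edge verts)
    then show "w = y" using v(3) unfolding valid_rank_def by blast
  qed
  moreover have "connected_graph (induced_subgraph G ?S)"
  proof -
    let ?E = "edges (induced_subgraph G ?S)"
    let ?R = "\<lambda>u w. {u, w} \<in> ?E"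
    define bot where "bot u \<longleftrightarrow> u < n \<and> S u \<and> (\<forall>y<n. S y \<and> ?M u y \<longrightarrow> d u \<le> d y)" for u
    \<comment> \<open>Moving to neighbours of smaller distance ends in a local minimum. There is
      only one, so everything in the set is connected to it.\<close>
    have down: "\<exists>z. bot z \<and> ?R\<^sup>*\<^sup>* u z" if "u < n" "S u" for u
      using that
    proof (induction "d u" arbitrary: u rule: less_induct)
      case less
      show ?case
      proof (cases "bot u")
        case False
        then obtain y where y: "y < n" "S y" "?M u y" "d y < d u"
          using less.prems unfolding bot_def by (auto simp: not_le)
        then obtain z where z: "bot z" "?R\<^sup>*\<^sup>* y z" using less.hyps by blast
        have "?R u y" using y less.prems edge by (auto simp: induced_subgraph_def)
        then show ?thesis using z by (meson converse_rtranclp_into_rtranclp)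
      qed blast
    qed
    have uniq: "z = z'" if "bot z" "bot z'" for z z'
      using v(4) that unfolding bot_def valid_dist_def by blast
    show ?thesis
      unfolding connected_graph_def
    proof (intro ballI)
      fix u w assume "u \<in> verts (induced_subgraph G ?S)" "w \<in> verts (induced_subgraph G ?S)"
      then have uw: "u < n" "S u" "w < n" "S w" by (auto simp: induced_subgraph_def)
      obtain z where z: "bot z" "?R\<^sup>*\<^sup>* u z" using down[OF uw(1,2)] by blast
      obtain z' where z': "bot z'" "?R\<^sup>*\<^sup>* w z'" using down[OF uw(3,4)] by blast
      have "?R\<^sup>*\<^sup>* z w" using reach_sym[OF z'(2)] uniq[OF z(1) z'(1)] by simp
      then show "?R\<^sup>*\<^sup>* u w" using z(2) by (rule rtranclp_trans[rotated])
    qed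
  qed
  ultimately have "connected_feedback_vertex_set G ?S"
    by (auto simp: connected_feedback_vertex_set_def feedback_vertex_set_def verts)
  moreover have "card ?S \<le> bits_val b"
  proof -
    have "card ?S \<le> n" using card_mono[of "{..<n}" ?S] by auto
    moreover have "card ?S \<le> (\<Sum>i<length b. if b ! i then min n (2 ^ i) else 0)"
      using v(5) unfolding small_set_def sum_drop_bits b_def .
    ultimately show ?thesis using le_bits_val_iff by blast
  qed
  ultimately show ?thesis
    unfolding connected_fvs_problem_def using x simple verts \<open>is_line_graph G\<close> by blast
qed


section \<open>Existence of certificates\<close>

lemma compress_less_iff:
  fixes f :: "nat \<Rightarrow> nat"
  assumes "u < n" "v < n"
  shows "card {y. y < n \<and> f y < f u} < card {y. y < n \<and> f y < f v} \<longleftrightarrow> f u < f v"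
proof -
  have fin: "finite {y. y < n \<and> f y < f z}" for z by simp
  have "card {y. y < n \<and> f y < f u} < card {y. y < n \<and> f y < f v}" if "f u < f v"
    by (rule psubset_card_mono[OF fin]) (use that assms in auto)
  moreover have "card {y. y < n \<and> f y < f v} \<le> card {y. y < n \<and> f y < f u}" if "f v \<le> f u"
    by (rule card_mono[OF fin]) (use that in auto)
  ultimately show ?thesis by (metis not_less)
qed

text \<open>For distances from a fixed vertex, every other vertex has a neighbour that is closer to
  it, namely the last but one vertex of a shortest path.\<close>

lemma connected_ex_dist:
  fixes E :: "'a set set"
  assumes "\<And>u v. u \<in> S \<Longrightarrow> v \<in> S \<Longrightarrow> (\<lambda>x y. {x, y} \<in> E)\<^sup>*\<^sup>* u v" "\<And>x y. {x, y} \<in> E \<Longrightarrow> x \<in> S"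
  shows "\<exists>d :: 'a \<Rightarrow> nat. \<forall>u\<in>S. \<forall>v\<in>S. (\<forall>y. {u, y} \<in> E \<longrightarrow> d u \<le> d y) \<longrightarrow> (\<forall>y. {v, y} \<in> E \<longrightarrow> d v \<le> d y) \<longrightarrow> u = v"
proof (cases "S = {}")
  case False
  then obtain r where r: "r \<in> S" by blast
  let ?R = "\<lambda>x y. {x, y} \<in> E"
  define d where "d v = (LEAST m. (?R ^^ m) r v)" for v
  have "v = r" if v: "v \<in> S" and least: "\<forall>y. {v, y} \<in> E \<longrightarrow> d v \<le> d y" for v
  proof (rule ccontr)
    assume "v \<noteq> r"
    obtain m0 where "(?R ^^ m0) r v" using assms(1)[OF r v] rtranclp_imp_relpowp by metis
    then have "(?R ^^ d v) r v" unfolding d_def by (rule LeastI)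
    moreover have "d v \<noteq> 0" using calculation \<open>v \<noteq> r\<close> by (intro notI) simp
    then obtain m where m: "d v = Suc m" by (cases "d v") auto
    ultimately obtain y where y: "(?R ^^ m) r y" "?R y v" by auto
    then have "d y \<le> m" unfolding d_def by (intro Least_le)
    moreover have "{v, y} \<in> E" using y(2) by (simp add: insert_commute)
    ultimately show False using least m by fastforce
  qed
  then show ?thesis by blast
qed simp

lemma valid_complete:
  assumes "x \<in> connected_fvs_problem is_line_graph"
  shows "\<exists>n A S r d. n < length x \<and> (\<forall>v<n. r v \<le> n \<and> d v \<le> n) \<and> valid x n A S r d"
proof -
  obtain G k n Z where x: "x = encode_instance G k" and simple: "simple_graph G" and verts: "verts G = {..<n}"
    and line: "is_line_graph G" and Z: "connected_feedback_vertex_set G Z" "card Z \<le> k"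
    using assms unfolding connected_fvs_problem_def by blast
  let ?M = "matrix_at x n" and ?m = "n + 1 + n * n"
  note enc = x[unfolded eq_encode_instance_iff[OF verts]]
  have lx: "?m \<le> length x" using enc by blast
  have M: "?M i j \<longleftrightarrow> {i, j} \<in> edges G" if ij: "i < n" "j < n" for i j
  proof -
    have "i * n + j < n * n" using ij by (rule digit_pair_less)
    moreover have "x ! (n + 1 + (i * n + j)) \<longleftrightarrow> {i, j} \<in> edges G" using enc ij by blast
    ultimately show ?thesis using lx by (simp add: matrix_at_def bit_at_def)
  qed
  have edge: "u < n \<and> v < n \<and> u \<noteq> v" if "{u, v} \<in> edges G" for u v
    using simple that verts unfolding simple_graph_def by (fastforce simp: card_2_iff doubleton_eq_iff)
  have drop: "drop ?m x = binary k" using enc by blast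

  obtain H :: "nat graph" and f where H: "simple_graph H" and f: "bij_betw f {..<n} (edges H)"
    and iso: "\<And>u v. u < n \<Longrightarrow> v < n \<Longrightarrow> {u, v} \<in> edges G \<longleftrightarrow> {f u, f v} \<in> edges (line_graph H)"
    using line unfolding is_line_graph_def graph_isomorphic_def verts by (auto simp: line_graph_def)
  have fH: "f v \<in> edges H" if "v < n" for v using f that by (auto simp: bij_betw_def)
  then have card_f: "card (f v) = 2" if "v < n" for v using H that by (auto simp: simple_graph_def)
  then have fin_f: "finite (f v)" if "v < n" for v using that card_ge_0_finite by force
  define W where "W = (\<Union>v<n. f v)"
  have finW: "finite W" unfolding W_def using fin_f by auto
  have "card W \<le> (\<Sum>v<n. card (f v))" unfolding W_def by (rule card_UN_le) simp
  also have "\<dots> = 2 * n" using card_f by simp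
  \<comment> \<open>Isolated vertices of the root graph are dropped. Each of its \<open>n\<close>
    edges covers two vertices, so names below \<open>2 * n\<close> suffice.\<close>
  finally have cardW: "card W \<le> 2 * n" .
  obtain h where h: "bij_betw h W {0..<card W}" using ex_bij_betw_finite_nat[OF finW] by blast
  define A where "A v u \<longleftrightarrow> u \<in> h ` f v" for v u
  have inj: "inj_on h W" and fW: "f v \<subseteq> W" if "v < n" for v
    using h that by (auto simp: bij_betw_def W_def)
  have hless: "h u < 2 * n" if "u \<in> W" for u
    using h that cardW by (auto simp: bij_betw_def dest!: equalityD1)
  have A: "{u. u < 2 * n \<and> A v u} = h ` f v" if v: "v < n" for v
    using hless fW[OF v] by (auto simp: A_def)
  have injn: "inj_on h W" if "v < n" for v :: nat using inj that .
  have 1: "card {u. u < 2 * n \<and> A v u} = 2" if v: "v < n" for v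
    unfolding A[OF v] using card_image[OF inj_on_subset[OF injn[OF v] fW[OF v]]] card_f[OF v] by simp
  have 2: "\<exists>u<2 * n. A v u \<noteq> A v' u" if v: "v < n" "v' < n" "v \<noteq> v'" for v v'
  proof (rule ccontr)
    assume "\<not> ?thesis"
    then have "{u. u < 2 * n \<and> A v u} = {u. u < 2 * n \<and> A v' u}" by auto
    then have "h ` f v = h ` f v'" using A v by simp
    then have "f v = f v'" using inj_on_image_eq_iff[OF injn[OF v(1)] fW fW] v by blast
    then show False using f v by (auto simp: bij_betw_def inj_on_def)
  qed
  have 3: "?M v v' \<longleftrightarrow> v \<noteq> v' \<and> (\<exists>u<2 * n. A v u \<and> A v' u)" if v: "v < n" "v' < n" for v v'
  proof -
    have "?M v v' \<longleftrightarrow> f v \<noteq> f v' \<and> f v \<inter> f v' \<noteq> {}"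
      unfolding M[OF v] iso[OF v] line_graph_edge using fH v by simp
    also have "f v \<noteq> f v' \<longleftrightarrow> v \<noteq> v'" using f v by (auto simp: bij_betw_def inj_on_def)
    also have "f v \<inter> f v' \<noteq> {} \<longleftrightarrow> h ` f v \<inter> h ` f v' \<noteq> {}"
      using inj_on_image_Int[OF injn[OF v(1)] fW[OF v(1)] fW[OF v(2)]] by auto
    also have "\<dots> \<longleftrightarrow> (\<exists>u<2 * n. A v u \<and> A v' u)"
      unfolding A[OF v(1), symmetric] A[OF v(2), symmetric] by auto
    finally show ?thesis .
  qed

  have ZV: "Z \<subseteq> {..<n}" and forest: "forest (delete_verts G Z)" and conn: "connected_graph (induced_subgraph G Z)"
    using Z(1) verts by (auto simp: connected_feedback_vertex_set_def feedback_vertex_set_def)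
  have del: "{u, v} \<in> edges (delete_verts G Z) \<longleftrightarrow> {u, v} \<in> edges G \<and> u \<notin> Z \<and> v \<notin> Z" for u v
    using edge[of u v] by (auto simp: delete_verts_edge verts)
  have "\<exists>r :: nat \<Rightarrow> nat. (\<forall>u v. {u, v} \<in> edges (delete_verts G Z) \<longrightarrow> r u \<noteq> r v) \<and>
    (\<forall>u v w. {u, v} \<in> edges (delete_verts G Z) \<longrightarrow> {u, w} \<in> edges (delete_verts G Z) \<longrightarrow> r u < r v \<longrightarrow> r u < r w \<longrightarrow> v = w)"
    by (rule forest_ex_rank[of "{..<n}"]) (use edge del forest in auto)
  then obtain r0 :: "nat \<Rightarrow> nat" where r0: "\<And>u v. {u, v} \<in> edges (delete_verts G Z) \<Longrightarrow> r0 u \<noteq> r0 v"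
    "\<And>u v w. {u, v} \<in> edges (delete_verts G Z) \<Longrightarrow> {u, w} \<in> edges (delete_verts G Z) \<Longrightarrow> r0 u < r0 v \<Longrightarrow> r0 u < r0 w \<Longrightarrow> v = w"
    by blast
  \<comment> \<open>Replacing a rank by the number of vertices of smaller rank preserves the order
    and makes it at most \<open>n\<close>, so that it fits into \<open>n\<close> bits in
    unary.\<close>
  define r where "r v = card {y. y < n \<and> r0 y < r0 v}" for v
  have r: "r u < r v \<longleftrightarrow> r0 u < r0 v" if "u < n" "v < n" for u v
    unfolding r_def using that by (rule compress_less_iff)
  have le_n: "card {y. y < n \<and> P y} \<le> n" for P
    using card_mono[of "{..<n}" "{y. y < n \<and> P y}"] by auto
  have 4: "r v \<noteq> r v'" if "v < n" "v' < n" "v \<notin> Z \<and> v' \<notin> Z \<and> ?M v v'" for v v'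
  proof -
    have "r0 v \<noteq> r0 v'" using r0(1)[of v v'] that M del by auto
    then have "r v < r v' \<or> r v' < r v" using r that by (metis linorder_neqE_nat)
    then show ?thesis by auto
  qed
  have 5: "v = w" if "u < n" "v < n" "w < n"
    "u \<notin> Z \<and> v \<notin> Z \<and> w \<notin> Z \<and> ?M u v \<and> ?M u w \<and> r u < r v \<and> r u < r w" for u v w
    using r0(2)[of u v w] that M del r by auto

  let ?E = "edges (induced_subgraph G Z)"
  have ind: "{u, v} \<in> ?E \<longleftrightarrow> {u, v} \<in> edges G \<and> u \<in> Z \<and> v \<in> Z" for u v
    by (auto simp: induced_subgraph_def)
  have "\<exists>d :: nat \<Rightarrow> nat. \<forall>u\<in>Z. \<forall>v\<in>Z. (\<forall>y. {u, y} \<in> ?E \<longrightarrow> d u \<le> d y) \<longrightarrow> (\<forall>y. {v, y} \<in> ?E \<longrightarrow> d v \<le> d y) \<longrightarrow> u = v"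
  proof (rule connected_ex_dist)
    fix u v assume "u \<in> Z" "v \<in> Z"
    then show "(\<lambda>x y. {x, y} \<in> ?E)\<^sup>*\<^sup>* u v"
      using conn ZV verts unfolding connected_graph_def by (auto simp: induced_subgraph_def)
  qed (use ind in blast)
  then obtain d0 :: "nat \<Rightarrow> nat" where d0: "\<And>u v. u \<in> Z \<Longrightarrow> v \<in> Z \<Longrightarrow> (\<And>y. {u, y} \<in> ?E \<Longrightarrow> d0 u \<le> d0 y) \<Longrightarrow>
      (\<And>y. {v, y} \<in> ?E \<Longrightarrow> d0 v \<le> d0 y) \<Longrightarrow> u = v" by blast
  define d where "d v = card {y. y < n \<and> d0 y < d0 v}" for v
  have d: "d u \<le> d v \<longleftrightarrow> d0 u \<le> d0 v" if "u < n" "v < n" for u v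
    unfolding d_def not_less[symmetric] compress_less_iff[OF that(2,1)] ..
  have 6: "u = v" if uv: "u < n" "v < n" "u \<in> Z \<and> v \<in> Z \<and> (\<forall>y<n. y \<in> Z \<and> ?M u y \<longrightarrow> d u \<le> d y) \<and>
      (\<forall>y<n. y \<in> Z \<and> ?M v y \<longrightarrow> d v \<le> d y)" for u v
  proof (rule d0)
    fix y
    show "d0 u \<le> d0 y" if "{u, y} \<in> ?E"
      using that uv ind[of u y] edge[of u y] M[of u y] d[of u y] by auto
    show "d0 v \<le> d0 y" if "{v, y} \<in> ?E"
      using that uv ind[of v y] edge[of v y] M[of v y] d[of v y] by auto
  qed (use uv in auto)

  have Zset: "{v. v < n \<and> v \<in> Z} = Z" using ZV by auto
  have "card Z \<le> n" using card_mono[OF _ ZV] by simp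
  then have 7: "card {v. v < n \<and> v \<in> Z} \<le> (\<Sum>i<length x - ?m.
        if bit_at x (?m + i) then card {y. y < n \<and> card {z. z < y + 1 \<and> is_pow2 z} \<le> i} else 0)"
    unfolding sum_drop_bits drop Zset using le_bits_val_iff[of "card Z" n "binary k"] Z(2) by simp
  have 8: "length x = ?m \<or> bit_at x (length x - 1)"
  proof (cases "length x = ?m")
    case False
    then have "binary k \<noteq> []" using drop lx by (metis drop_eq_Nil le_antisym)
    then have "last (drop ?m x)" unfolding drop by (rule last_binary)
    then have "last x" using lx False by (simp add: last_drop)
    moreover have "x \<noteq> []" using lx by auto
    ultimately show ?thesis using last_conv_nth[of x] by (simp add: bit_at_def)
  qed simp
  have "encodes_graph x n"
    unfolding encodes_graph_def using enc lx 8 by (auto simp: bit_at_def)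
  moreover have "valid_root x n A" unfolding valid_root_def using 1 2 3 by blast
  moreover have "valid_rank x n (\<lambda>v. v \<in> Z) r" unfolding valid_rank_def using 4 5 by blast
  moreover have "valid_dist x n (\<lambda>v. v \<in> Z) d" unfolding valid_dist_def using 6 by blast
  moreover have "small_set x n (\<lambda>v. v \<in> Z)" unfolding small_set_def by (rule 7)
  ultimately have "valid x n A (\<lambda>v. v \<in> Z) r d" unfolding valid_def by blast
  moreover have "n < length x" using lx by simp
  moreover have "r v \<le> n \<and> d v \<le> n" for v unfolding r_def d_def by (intro conjI le_n)
  ultimately show ?thesis by blast
qed

section \<open>The verifier as an expression\<close>

definition matrix_exp :: "nat \<Rightarrow> nat \<Rightarrow> exp" where
  "matrix_exp i j = Bit 0 (Add (Add (Var 4) (Const 1)) (Add (Times (Var i) (Var 4)) (Var j)))"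

text \<open>Register \<open>4\<close> holds the number \<open>n\<close> of vertices. The certificate
  consists of \<open>n\<close> rows of \<open>2 * n\<close> incidence bits, \<open>n\<close> bits
  for the set, and \<open>n\<close> rows of \<open>n\<close> bits for the ranks and again for the
  distances.\<close>

definition inc_exp :: "nat \<Rightarrow> nat \<Rightarrow> exp" where
  "inc_exp i j = Bit 1 (Add (Times (Var i) (Times (Const 2) (Var 4))) (Var j))"

definition set_exp :: "nat \<Rightarrow> exp" where
  "set_exp i = Bit 1 (Add (Times (Var 4) (Times (Const 2) (Var 4))) (Var i))"

text \<open>Ranks are stored in unary and read by counting ones, so that every block of bits has a
  meaning.\<close>

definition rank_exp :: "nat \<Rightarrow> exp" where
  "rank_exp i = Sum 9 (Var 4) (Bit 1 (Add (Add (Times (Var 4) (Times (Const 2) (Var 4))) (Var 4))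
     (Add (Times (Var i) (Var 4)) (Var 9))))"

text \<open>Compared with \<open>rank_exp\<close>, the factor 3 also skips the \<open>n * n\<close>
  bits of the ranks.\<close>

definition dist_exp :: "nat \<Rightarrow> exp" where
  "dist_exp i = Sum 9 (Var 4) (Bit 1 (Add (Add (Times (Var 4) (Times (Const 3) (Var 4))) (Var 4))
     (Add (Times (Var i) (Var 4)) (Var 9))))"

definition head_exp :: exp where
  "head_exp = Add (Add (Var 4) (Const 1)) (Times (Var 4) (Var 4))"

definition encoding_exp :: exp where
  "encoding_exp = Conj (Leq head_exp (Var 2)) (Conj (Univ 5 (Var 4) (Bit 0 (Var 5))) (Conj (Neg (Bit 0 (Var 4)))
     (Disj (Equ (Var 2) head_exp) (Bit 0 (Sub (Var 2) (Const 1))))))"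

definition root_exp :: exp where
  "root_exp = Conj (Univ 5 (Var 4) (Equ (Sum 6 (Times (Const 2) (Var 4)) (inc_exp 5 6)) (Const 2)))
     (Conj (Univ 5 (Var 4) (Univ 6 (Var 4) (Impl (Neg (Equ (Var 5) (Var 6)))
         (Exis 7 (Times (Const 2) (Var 4)) (Neg (Iff (inc_exp 5 7) (inc_exp 6 7)))))))
       (Univ 5 (Var 4) (Univ 6 (Var 4) (Iff (matrix_exp 5 6) (Conj (Neg (Equ (Var 5) (Var 6)))
         (Exis 7 (Times (Const 2) (Var 4)) (Conj (inc_exp 5 7) (inc_exp 6 7))))))))"

definition forest_exp :: exp where
  "forest_exp = Conj
     (Univ 5 (Var 4) (Univ 6 (Var 4) (Impl (Conj (Neg (set_exp 5)) (Conj (Neg (set_exp 6)) (matrix_exp 5 6)))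
        (Neg (Equ (rank_exp 5) (rank_exp 6))))))
     (Univ 5 (Var 4) (Univ 6 (Var 4) (Univ 7 (Var 4) (Impl
        (Conj (Neg (set_exp 5)) (Conj (Neg (set_exp 6)) (Conj (Neg (set_exp 7)) (Conj (matrix_exp 5 6)
          (Conj (matrix_exp 5 7) (Conj (Lt (rank_exp 5) (rank_exp 6)) (Lt (rank_exp 5) (rank_exp 7))))))))
        (Equ (Var 6) (Var 7))))))"

definition local_min_exp :: "nat \<Rightarrow> exp" where
  "local_min_exp i = Univ 8 (Var 4) (Impl (Conj (set_exp 8) (matrix_exp i 8)) (Leq (dist_exp i) (dist_exp 8)))"

definition connected_exp :: exp where
  "connected_exp = Univ 5 (Var 4) (Univ 6 (Var 4)
     (Impl (Conj (set_exp 5) (Conj (set_exp 6) (Conj (local_min_exp 5) (local_min_exp 6)))) (Equ (Var 5) (Var 6))))"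

definition bound_exp :: exp where
  "bound_exp = Leq (Sum 5 (Var 4) (set_exp 5)) (Sum 5 (Sub (Var 2) head_exp)
     (Cond (Bit 0 (Add head_exp (Var 5)))
       (Sum 6 (Var 4) (Leq (Sum 7 (Add (Var 6) (Const 1)) (Truth (Pow2 (Var 7)))) (Var 5))) (Const 0)))"

text \<open>The number of vertices is found by search below the length of the instance instead of
  being guessed.\<close>

definition valid_exp :: exp where
  "valid_exp = Exis 4 (Var 2)
     (Conj encoding_exp (Conj root_exp (Conj forest_exp (Conj connected_exp bound_exp))))"

lemma ok_valid_exp: "ok_exp valid_exp"
  by (simp add: valid_exp_def encoding_exp_def root_exp_def forest_exp_def connected_exp_def bound_exp_def
      local_min_exp_def head_exp_def dist_exp_def rank_exp_def set_exp_def inc_exp_def matrix_exp_def)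

definition cert_inc :: "bool list \<Rightarrow> nat \<Rightarrow> nat \<Rightarrow> nat \<Rightarrow> bool" where
  "cert_inc w n v u = bit_at w (v * (2 * n) + u)"

definition cert_set :: "bool list \<Rightarrow> nat \<Rightarrow> nat \<Rightarrow> bool" where
  "cert_set w n v = bit_at w (n * (2 * n) + v)"

definition cert_rank :: "bool list \<Rightarrow> nat \<Rightarrow> nat \<Rightarrow> nat" where
  "cert_rank w n v = card {z. z < n \<and> bit_at w (n * (2 * n) + n + (v * n + z))}"

definition cert_dist :: "bool list \<Rightarrow> nat \<Rightarrow> nat \<Rightarrow> nat" where
  "cert_dist w n v = card {z. z < n \<and> bit_at w (n * (3 * n) + n + (v * n + z))}"

context
  fixes x w :: "bool list" and I :: "nat \<Rightarrow> bool list"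
  assumes I: "I 0 = x" "I 1 = w"
begin

lemma eval_Bit_at: "eval I (Bit j e) R = of_bool (bit_at (I j) (eval I e R))"
  by (simp add: bit_at_def)

lemma holds_Bit_at: "holds I (Bit j e) R \<longleftrightarrow> bit_at (I j) (eval I e R)"
  by (simp add: bit_at_def)

lemma holds_matrix: "holds I (matrix_exp i j) R \<longleftrightarrow> matrix_at x (R 4) (R i) (R j)"
  unfolding matrix_exp_def holds_Bit_at I matrix_at_def by simp

lemma holds_inc: "holds I (inc_exp i j) R \<longleftrightarrow> cert_inc w (R 4) (R i) (R j)"
  unfolding inc_exp_def holds_Bit_at I cert_inc_def by simp

lemma holds_set: "holds I (set_exp i) R \<longleftrightarrow> cert_set w (R 4) (R i)"
  unfolding set_exp_def holds_Bit_at I cert_set_def by simp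

lemma eval_inc: "eval I (inc_exp i j) R = of_bool (cert_inc w (R 4) (R i) (R j))"
  unfolding inc_exp_def eval_Bit_at I cert_inc_def by simp

lemma eval_set: "eval I (set_exp i) R = of_bool (cert_set w (R 4) (R i))"
  unfolding set_exp_def eval_Bit_at I cert_set_def by simp

lemma eval_rank: "i \<noteq> 9 \<Longrightarrow> eval I (rank_exp i) R = cert_rank w (R 4) (R i)"
  unfolding rank_exp_def eval.simps(6) eval_Bit_at I cert_rank_def sum_of_bool[symmetric] by simp

lemma eval_dist: "i \<noteq> 9 \<Longrightarrow> eval I (dist_exp i) R = cert_dist w (R 4) (R i)"
  unfolding dist_exp_def eval.simps(6) eval_Bit_at I cert_dist_def sum_of_bool[symmetric] by simp

lemma eval_head: "eval I head_exp R = R 4 + 1 + R 4 * R 4"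
  by (simp add: head_exp_def)

lemma holds_local_min: "i \<noteq> 9 \<Longrightarrow> i \<noteq> 8 \<Longrightarrow> i \<noteq> 4 \<Longrightarrow> holds I (local_min_exp i) R \<longleftrightarrow>
    (\<forall>y<R 4. cert_set w (R 4) y \<and> matrix_at x (R 4) (R i) y \<longrightarrow> cert_dist w (R 4) (R i) \<le> cert_dist w (R 4) y)"
  by (simp add: local_min_exp_def holds_set holds_matrix eval_dist)

lemma eval_Leq: "eval I (Leq a b) R = of_bool (eval I a R \<le> eval I b R)"
  by (simp add: Leq_def eval_Neg holds_def)

lemma holds_valid_body:
  assumes R: "R 2 = length x"
  shows "holds I (Conj encoding_exp (Conj root_exp (Conj forest_exp (Conj connected_exp bound_exp)))) R \<longleftrightarrow>
    valid x (R 4) (cert_inc w (R 4)) (cert_set w (R 4)) (cert_rank w (R 4)) (cert_dist w (R 4))"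
proof -
  let ?n = "R 4"
  have 1: "holds I encoding_exp R \<longleftrightarrow> encodes_graph x ?n"
    by (simp add: encodes_graph_def encoding_exp_def eval_head R holds_Bit_at I del: holds_Bit)
  have 2: "holds I root_exp R \<longleftrightarrow> valid_root x ?n (cert_inc w ?n)"
    unfolding valid_root_def sum_of_bool[symmetric]
    by (simp add: root_exp_def holds_inc holds_matrix eval_inc)
  have 3: "holds I forest_exp R \<longleftrightarrow> valid_rank x ?n (cert_set w ?n) (cert_rank w ?n)"
    by (simp add: valid_rank_def forest_exp_def holds_set holds_matrix eval_rank)
  have 4: "holds I connected_exp R \<longleftrightarrow> valid_dist x ?n (cert_set w ?n) (cert_dist w ?n)"
    by (simp add: valid_dist_def connected_exp_def holds_set holds_local_min)
  have 5: "holds I bound_exp R \<longleftrightarrow> small_set x ?n (cert_set w ?n)"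
    unfolding small_set_def sum_of_bool[symmetric]
    by (simp add: bound_exp_def eval_set eval_head holds_Bit_at I R eval_Leq cong: if_cong del: holds_Bit sum.lessThan_Suc)
  show ?thesis unfolding holds_Conj 1 2 3 4 5 valid_def ..
qed

lemma holds_valid:
  assumes "R 2 = length x"
  shows "holds I valid_exp R \<longleftrightarrow> (\<exists>n<length x. valid x n (cert_inc w n) (cert_set w n) (cert_rank w n) (cert_dist w n))"
proof -
  have "holds I (Conj encoding_exp (Conj root_exp (Conj forest_exp (Conj connected_exp bound_exp)))) (R(4 := n)) \<longleftrightarrow>
      valid x n (cert_inc w n) (cert_set w n) (cert_rank w n) (cert_dist w n)" for n
    using holds_valid_body[of "R(4 := n)"] assms by simp
  then show ?thesis unfolding valid_exp_def holds_Exis eval.simps(2) assms by blast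
qed

end

text \<open>A certificate records the relations and functions only on a finite range, so validity
  must depend on this range alone.\<close>

lemma valid_cong:
  assumes "\<And>v u. v < n \<Longrightarrow> u < 2 * n \<Longrightarrow> A v u = A' v u" "\<And>v. v < n \<Longrightarrow> S v = S' v"
    "\<And>v. v < n \<Longrightarrow> r v = r' v" "\<And>v. v < n \<Longrightarrow> d v = d' v"
  shows "valid x n A S r d \<longleftrightarrow> valid x n A' S' r' d'"
  unfolding valid_def valid_root_def valid_rank_def valid_dist_def small_set_def
  by (simp add: assms cong: conj_cong)

definition certificate ::
  "nat \<Rightarrow> (nat \<Rightarrow> nat \<Rightarrow> bool) \<Rightarrow> (nat \<Rightarrow> bool) \<Rightarrow> (nat \<Rightarrow> nat) \<Rightarrow> (nat \<Rightarrow> nat) \<Rightarrow> bool list" where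
  "certificate n A S r d =
     concat (map (\<lambda>v. map (A v) [0..<2 * n]) [0..<n]) @ map S [0..<n] @
     concat (map (\<lambda>v. map (\<lambda>z. z < r v) [0..<n]) [0..<n]) @
     concat (map (\<lambda>v. map (\<lambda>z. z < d v) [0..<n]) [0..<n])"

lemma length_certificate: "length (certificate n A S r d) = n * (2 * n) + n + n * n + n * n"
  unfolding certificate_def length_append length_rows by simp

lemma certificate_fields:
  assumes "v < n"
  shows "u < 2 * n \<Longrightarrow> cert_inc (certificate n A S r d) n v u = A v u"
    "cert_set (certificate n A S r d) n v = S v"
    "r v \<le> n \<Longrightarrow> cert_rank (certificate n A S r d) n v = r v"
    "d v \<le> n \<Longrightarrow> cert_dist (certificate n A S r d) n v = d v"
proof -
  define a b c e where "a = concat (map (\<lambda>v. map (A v) [0..<2 * n]) [0..<n])" and "b = map S [0..<n]"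
    and "c = concat (map (\<lambda>v. map (\<lambda>z. z < r v) [0..<n]) [0..<n])"
    and "e = concat (map (\<lambda>v. map (\<lambda>z. z < d v) [0..<n]) [0..<n])"
  have w: "certificate n A S r d = a @ b @ c @ e"
    by (simp add: certificate_def a_def b_def c_def e_def)
  have len: "length a = n * (2 * n)" "length b = n" "length c = n * n" "length e = n * n"
    unfolding a_def b_def c_def e_def length_rows by simp_all
  show "cert_inc (certificate n A S r d) n v u = A v u" if u: "u < 2 * n"
  proof -
    have "v * (2 * n) + u < n * (2 * n)" by (rule digit_pair_less[OF assms u])
    moreover have "a ! (v * (2 * n) + u) = A v u" unfolding a_def by (rule nth_rows[OF assms u])
    ultimately show ?thesis unfolding cert_inc_def bit_at_def w by (simp add: nth_append len)
  qed
  show "cert_set (certificate n A S r d) n v = S v"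
    unfolding cert_set_def bit_at_def w using assms by (simp add: nth_append len) (simp add: b_def)
  have sub: "v * n + z < n * n" if "z < n" for z by (rule digit_pair_less[OF assms that])
  have min: "card {z. z < n \<and> z < m} = m" if "m \<le> n" for m
  proof -
    have "{z. z < n \<and> z < m} = {..<m}" using that by auto
    then show ?thesis by simp
  qed
  show "cert_rank (certificate n A S r d) n v = r v" if "r v \<le> n"
  proof -
    have "bit_at (a @ b @ c @ e) (n * (2 * n) + n + (v * n + z)) \<longleftrightarrow> z < r v" if z: "z < n" for z
    proof -
      have "c ! (v * n + z) = (z < r v)" unfolding c_def by (rule nth_rows[OF assms z])
      then show ?thesis using sub[OF z] by (simp add: bit_at_def nth_append len)
    qed
    then have "{z. z < n \<and> bit_at (a @ b @ c @ e) (n * (2 * n) + n + (v * n + z))} = {z. z < n \<and> z < r v}" by auto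
    then show ?thesis unfolding cert_rank_def w using min[OF that] by simp
  qed
  show "cert_dist (certificate n A S r d) n v = d v" if "d v \<le> n"
  proof -
    have "bit_at (a @ b @ c @ e) (n * (3 * n) + n + (v * n + z)) \<longleftrightarrow> z < d v" if z: "z < n" for z
    proof -
      have "e ! (v * n + z) = (z < d v)" unfolding e_def by (rule nth_rows[OF assms z])
      then show ?thesis using sub[OF z] by (simp add: bit_at_def nth_append len)
    qed
    then have "{z. z < n \<and> bit_at (a @ b @ c @ e) (n * (3 * n) + n + (v * n + z))} = {z. z < n \<and> z < d v}" by auto
    then show ?thesis unfolding cert_dist_def w using min[OF that] by simp
  qed
qed

theorem connected_fvs_in_NP: "connected_fvs_problem is_line_graph \<in> NP"
proof (rule NP_I[of "fresh valid_exp + 4" valid_exp "\<lambda>n. 4 * (n * n) + n"])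
  show "wf_exp (fresh valid_exp + 4) valid_exp" using ok_valid_exp by (simp add: wf_exp_def)
  show "4 \<le> fresh valid_exp + 4" by simp
  show "poly_fun (\<lambda>n. 4 * (n * n) + n)"
    by (intro poly_fun_add poly_fun_mult poly_fun_const poly_fun_ident)
next
  fix x assume "x \<in> connected_fvs_problem is_line_graph"
  then obtain n A S r d where n: "n < length x" and le: "\<And>v. v < n \<Longrightarrow> r v \<le> n \<and> d v \<le> n"
    and valid: "valid x n A S r d" using valid_complete by blast
  define w where "w = certificate n A S r d"
  have "valid x n (cert_inc w n) (cert_set w n) (cert_rank w n) (cert_dist w n) \<longleftrightarrow> valid x n A S r d"
    unfolding w_def by (rule valid_cong) (simp_all add: certificate_fields le)
  then have "holds (inputs x w) valid_exp (env x w)"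
    using valid n holds_valid[of "inputs x w" x w "env x w"] by (auto simp: inputs_def env_def)
  moreover have "length w \<le> 4 * (length x * length x) + length x"
  proof -
    \<comment> \<open>A certificate for \<open>n\<close> vertices has \<open>4 * (n * n) + n\<close>
      bits, and \<open>n\<close> is below the length of the instance.\<close>
    have "n * n \<le> length x * length x" using n by (intro mult_le_mono) auto
    then show ?thesis unfolding w_def length_certificate using n by simp
  qed
  ultimately show "\<exists>w. length w \<le> 4 * (length x * length x) + length x \<and> eval (inputs x w) valid_exp (env x w) \<noteq> 0"
    unfolding holds_def by blast
next
  fix x w assume "eval (inputs x w) valid_exp (env x w) \<noteq> 0"
  then have "holds (inputs x w) valid_exp (env x w)" by (simp add: holds_def)
  then obtain n where "valid x n (cert_inc w n) (cert_set w n) (cert_rank w n) (cert_dist w n)"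
    using holds_valid[of "inputs x w" x w "env x w"] by (auto simp: inputs_def env_def)
  then show "x \<in> connected_fvs_problem is_line_graph" by (rule valid_sound)
qed

theorem theorem5: "NP_complete (connected_fvs_problem is_line_graph)"
  unfolding NP_complete_def using connected_fvs_in_NP NP_hard_connected_fvs by blast

end
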